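(* Let $d\ge1$ be an integer, let $1\le q<\infty$, and let $I\subseteq\mathbb{R}$ be a bounded open interval. Let $A_n\to A$ in $W^{1,q}(I,\mathrm{Norm}(d))$ as $n\to\infty$ and set $\Lambda:=\mathcal{E}_u(A)$, $\Lambda_n:=\mathcal{E}_u(A_n):I\to\mathcal{A}_d(\mathbb{C})$. Then $$\|\mathbf{d}_2(\Lambda,\Lambda_n)\|_{L^\infty(I)}\to0,\qquad \big\|\,|\dot\Lambda|-|\dot\Lambda_n|\,\big\|_{L^q(I)}\to0,\qquad |\mathscr{E}_q(\Lambda)-\mathscr{E}_q(\Lambda_n)|\to0,$$ as $n\to\infty$.
   Context: $M_d(\mathbb{C})$ is the space of complex $d\times d$ matrices with the Frobenius norm $\|\cdot\|_2$, and $\mathrm{Norm}(d)=\{A\in M_d(\mathbb{C}):A^*A=AA^*\}$. $W^{1,q}(I,\mathrm{Norm}(d))$ is the set of $A\in W^{1,q}(I,M_d(\mathbb{C}))$ with values in $\mathrm{Norm}(d)$, with the topology induced by the norm $\|A\|_{L^q}+\|A'\|_{L^q}$; we use absolutely continuous representatives. $\mathcal{A}_d(\mathbb{C})$ is the set of unordered $d$-tuples $[z]=[z_1,\dots,z_d]$ of complex numbers with the metric $\mathbf{d}_2([z],[w])=\min_{\sigma\in S_d}(\sum_i|z_i-w_{\sigma(i)}|^2)^{1/2}$, $S_d$ the symmetric group. For $A\in W^{1,q}(I,\mathrm{Norm}(d))$, $\mathcal{E}_u(A)(x)\in\mathcal{A}_d(\mathbb{C})$ is the unordered tuple of eigenvalues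 of $A(x)$ with multiplicity. A curve $\gamma:I\to X$ in a complete metric space $(X,\mathsf{d})$ belongs to $AC^q(I,X)$ if there is $m\in L^q(I)$ with $\mathsf{d}(\gamma(x),\gamma(y))\le\int_x^ym(t)\,dt$ for all $x\le y$ in $I$. Then the metric speed $|\dot\gamma|(x)=\lim_{h\to0}\frac{\mathsf{d}(\gamma(x+h),\gamma(x))}{|h|}$ exists for almost every $x\in I$ and lies in $L^q(I)$; the $q$-energy is $\mathscr{E}_q(\gamma)=\int_I(|\dot\gamma|(t))^q\,dt$. The curves $\Lambda,\Lambda_n$ belong to $AC^q(I,\mathcal{A}_d(\mathbb{C}))$. *)

theory Defs
  imports
    "HOL-Analysis.Analysis"
    "HOL-Computational_Algebra.Computational_Algebra"
    "HOL-Combinatorics.Combinatorics"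
    "HOL-Probability.Essential_Supremum"
begin

section \<open>Lebesgue and Sobolev spaces on an interval\<close>

text \<open>Norms take values in \<open>[0, \<infinity>]\<close>; like \<^const>\<open>esssup\<close>, they are \<open>\<infinity>\<close> on
  functions outside the space, so a bound on a norm also asserts measurability and integrability.\<close>

definition Lq_norm :: "real \<Rightarrow> real set \<Rightarrow> (real \<Rightarrow> 'b::real_normed_vector) \<Rightarrow> ennreal" where
  "Lq_norm q I f =
     (if f \<in> borel_measurable (lebesgue_on I) \<and> integrable (lebesgue_on I) (\<lambda>x. norm (f x) powr q)
      then ennreal ((LINT x|lebesgue_on I. norm (f x) powr q) powr (1 / q))
      else \<infinity>)"

definition Linf_norm :: "real set \<Rightarrow> (real \<Rightarrow> 'b::real_normed_vector) \<Rightarrow> ennreal" where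
  "Linf_norm I f = esssup (lebesgue_on I) (\<lambda>x. ennreal (norm (f x)))"

definition locally_integrable_on :: "(real \<Rightarrow> 'b::euclidean_space) \<Rightarrow> real set \<Rightarrow> bool" where
  "locally_integrable_on u I \<longleftrightarrow> (\<forall>K. compact K \<and> K \<subseteq> I \<longrightarrow> u absolutely_integrable_on K)"

text \<open>Test functions are continuously differentiable with compact support in \<open>I\<close>, as in
  Brezis's treatment of Sobolev spaces on an interval; by mollification, smooth test functions
  give the same weak derivatives.\<close>

definition test_function :: "real set \<Rightarrow> (real \<Rightarrow> real) \<Rightarrow> bool" where
  "test_function I \<phi> \<longleftrightarrow> \<phi> C1_differentiable_on UNIV \<and>
     compact (closure {x. \<phi> x \<noteq> 0}) \<and> closure {x. \<phi> x \<noteq> 0} \<subseteq> I"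

definition is_weak_deriv ::
    "real set \<Rightarrow> (real \<Rightarrow> 'b::euclidean_space) \<Rightarrow> (real \<Rightarrow> 'b) \<Rightarrow> bool" where
  "is_weak_deriv I u v \<longleftrightarrow> locally_integrable_on u I \<and> locally_integrable_on v I \<and>
     (\<forall>\<phi>. test_function I \<phi> \<longrightarrow>
        (LINT x|lebesgue_on I. deriv \<phi> x *\<^sub>R u x) = - (LINT x|lebesgue_on I. \<phi> x *\<^sub>R v x))"

text \<open>Weak derivatives are unique only almost everywhere; this picks one of them.\<close>

definition weak_deriv :: "real set \<Rightarrow> (real \<Rightarrow> 'b::euclidean_space) \<Rightarrow> real \<Rightarrow> 'b" where
  "weak_deriv I u = (SOME v. is_weak_deriv I u v)"

definition absolutely_continuous_on :: "real set \<Rightarrow> (real \<Rightarrow> 'b::real_normed_vector) \<Rightarrow> bool" where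
  "absolutely_continuous_on I u \<longleftrightarrow>
     (\<forall>\<epsilon>>0. \<exists>\<delta>>0. \<forall>(n::nat) s t.
        (\<forall>k<n. s k \<le> t k \<and> {s k..t k} \<subseteq> I) \<and>
        disjoint_family_on (\<lambda>k. {s k<..<t k}) {..<n} \<and>
        (\<Sum>k<n. t k - s k) < \<delta> \<longrightarrow>
        (\<Sum>k<n. norm (u (t k) - u (s k))) < \<epsilon>)"

text \<open>Elements of \<open>W\<^sup>1\<^sup>,\<^sup>q\<close> are represented by their absolutely continuous representatives.\<close>

definition W1q :: "real \<Rightarrow> real set \<Rightarrow> (real \<Rightarrow> 'b::euclidean_space) set" where
  "W1q q I = {u. absolutely_continuous_on I u \<and> (\<exists>v. is_weak_deriv I u v) \<and>
     Lq_norm q I u < \<infinity> \<and> Lq_norm q I (weak_deriv I u) < \<infinity>}"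

definition W1q_norm :: "real \<Rightarrow> real set \<Rightarrow> (real \<Rightarrow> 'b::euclidean_space) \<Rightarrow> ennreal" where
  "W1q_norm q I u = Lq_norm q I u + Lq_norm q I (weak_deriv I u)"

section \<open>Normal matrices and their unordered eigenvalues\<close>

text \<open>The library norm on \<^typ>\<open>complex^'n^'n\<close> is the Frobenius norm.\<close>

definition conj_transpose :: "complex^'n^'m \<Rightarrow> complex^'m^'n" where
  "conj_transpose A = (\<chi> i j. cnj (A $ j $ i))"

definition Norm_matrices :: "(complex^'n^'n) set" where
  "Norm_matrices = {A. conj_transpose A ** A = A ** conj_transpose A}"

definition W1q_Norm :: "real \<Rightarrow> real set \<Rightarrow> (real \<Rightarrow> complex^'n^'n) set" where
  "W1q_Norm q I = {A \<in> W1q q I. \<forall>x\<in>I. A x \<in> Norm_matrices}"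

definition charpoly :: "complex^'n^'n \<Rightarrow> complex poly" where
  "charpoly A = det (mat [:0, 1:] - (\<chi> i j. [:A $ i $ j:]))"

text \<open>Unordered \<open>d\<close>-tuples are multisets of size \<open>d\<close>.\<close>

definition unordered_eigenvalues :: "complex^'n^'n \<Rightarrow> complex multiset" where
  "unordered_eigenvalues A = proots (charpoly A)"

definition eigenvalue_curve :: "(real \<Rightarrow> complex^'n^'n) \<Rightarrow> real \<Rightarrow> complex multiset" where
  "eigenvalue_curve A = (\<lambda>x. unordered_eigenvalues (A x))"

definition tuple_dist :: "complex list \<Rightarrow> complex list \<Rightarrow> real" where
  "tuple_dist zs ws =
     Min ((\<lambda>\<sigma>. sqrt (\<Sum>i<length zs. (cmod (zs ! i - ws ! \<sigma> i))\<^sup>2)) ` {\<sigma>. \<sigma> permutes {..<length zs}})"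

text \<open>Only meaningful for multisets of equal size; \<open>d2_mset\<close> below shows that the choice of
  enumerations does not matter.\<close>

definition d2 :: "complex multiset \<Rightarrow> complex multiset \<Rightarrow> real" where
  "d2 M N = tuple_dist (SOME zs. mset zs = M) (SOME ws. mset ws = N)"

lemma tuple_dist_cong:
  assumes "mset zs = mset zs'" "mset ws = mset ws'" "length zs = length ws"
  shows "tuple_dist zs ws = tuple_dist zs' ws'"
proof -
  have le: "(\<lambda>\<sigma>. sqrt (\<Sum>i<length zs. (cmod (zs ! i - ws ! \<sigma> i))\<^sup>2)) ` {\<sigma>. \<sigma> permutes {..<length zs}}
     \<subseteq> (\<lambda>\<sigma>. sqrt (\<Sum>i<length zs'. (cmod (zs' ! i - ws' ! \<sigma> i))\<^sup>2)) ` {\<sigma>. \<sigma> permutes {..<length zs'}}"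
    if eq: "mset zs = mset zs'" "mset ws = mset ws'" "length zs = length ws"
    for zs zs' ws ws' :: "complex list"
  proof -
    define n where "n = length zs"
    have len: "length zs = n" "length zs' = n" "length ws = n" "length ws' = n"
      using eq eq(1,2)[THEN mset_eq_length] by (simp_all add: n_def)
    obtain p where p: "p permutes {..<n}" "permute_list p zs' = zs"
      using mset_eq_permutation[OF eq(1)] len by auto
    obtain r where r: "r permutes {..<n}" "permute_list r ws' = ws"
      using mset_eq_permutation[OF eq(2)] len by auto
    have "sqrt (\<Sum>i<n. (cmod (zs ! i - ws ! \<sigma> i))\<^sup>2)
        \<in> (\<lambda>\<sigma>. sqrt (\<Sum>i<n. (cmod (zs' ! i - ws' ! \<sigma> i))\<^sup>2)) ` {\<sigma>. \<sigma> permutes {..<n}}"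
      if s: "\<sigma> permutes {..<n}" for \<sigma>
    proof (rule image_eqI)
      show "r \<circ> \<sigma> \<circ> inv p \<in> {\<sigma>. \<sigma> permutes {..<n}}"
        using p r s by (auto intro!: permutes_compose permutes_inv)
      have "(\<Sum>i<n. (cmod (zs' ! i - ws' ! (r \<circ> \<sigma> \<circ> inv p) i))\<^sup>2)
          = (\<Sum>i<n. (cmod (zs' ! p i - ws' ! (r \<circ> \<sigma> \<circ> inv p) (p i)))\<^sup>2)"
        using sum.permute[OF p(1), of "\<lambda>i. (cmod (zs' ! i - ws' ! (r \<circ> \<sigma> \<circ> inv p) i))\<^sup>2"]
        by (simp add: o_def)
      also have "\<dots> = (\<Sum>i<n. (cmod (zs ! i - ws ! \<sigma> i))\<^sup>2)"
      proof (rule sum.cong[OF refl])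
        fix i assume "i \<in> {..<n}"
        then have i: "i < n" "\<sigma> i < n"
          using permutes_in_image[OF s] by auto
        have "zs ! i = zs' ! p i"
          using permute_list_nth[of p zs' i] p len i by simp
        moreover have "ws ! \<sigma> i = ws' ! r (\<sigma> i)"
          using permute_list_nth[of r ws' "\<sigma> i"] r len i by simp
        ultimately show "(cmod (zs' ! p i - ws' ! (r \<circ> \<sigma> \<circ> inv p) (p i)))\<^sup>2
            = (cmod (zs ! i - ws ! \<sigma> i))\<^sup>2"
          using permutes_inverses(2)[OF p(1)] by simp
      qed
      finally show "sqrt (\<Sum>i<n. (cmod (zs ! i - ws ! \<sigma> i))\<^sup>2)
          = sqrt (\<Sum>i<n. (cmod (zs' ! i - ws' ! (r \<circ> \<sigma> \<circ> inv p) i))\<^sup>2)" by simp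
    qed
    then show ?thesis by (auto simp: len)
  qed
  have "length zs' = length ws'"
    using assms(3) assms(1,2)[THEN mset_eq_length] by simp
  then show ?thesis
    unfolding tuple_dist_def
    by (intro arg_cong[where f = Min] subset_antisym le[OF assms] le[OF assms(1,2)[symmetric]])
qed

lemma d2_mset:
  assumes "length zs = length ws"
  shows "d2 (mset zs) (mset ws) = tuple_dist zs ws"
proof -
  have zs: "mset (SOME zs'. mset zs' = mset zs) = mset zs"
    by (rule someI[of "\<lambda>zs'. mset zs' = mset zs"], rule refl)
  have ws: "mset (SOME ws'. mset ws' = mset ws) = mset ws"
    by (rule someI[of "\<lambda>ws'. mset ws' = mset ws"], rule refl)
  show ?thesis
    unfolding d2_def
    by (intro tuple_dist_cong zs ws) (simp add: mset_eq_length[OF zs] mset_eq_length[OF ws] assms)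
qed

lemma degree_charpoly: "degree (charpoly (A :: complex^'n^'n)) = CARD('n)"
proof -
  define B where "B = mat [:0, 1:] - (\<chi> i j. [:A $ i $ j:])"
  have B: "B $ i $ j = (if i = j then [:- A $ i $ j, 1:] else [:- A $ i $ j:])" for i j
    by (simp add: B_def mat_def)
  let ?t = "\<lambda>p. of_int (sign p) * (\<Prod>i\<in>UNIV. B $ i $ p i)"
  let ?S = "{p. p permutes (UNIV :: 'n set)}"
  have deg_id: "degree (?t id) = CARD('n)"
    by (simp add: B degree_prod_eq_sum_degree)
  have deg_less: "degree (?t p) < CARD('n)" if "p \<in> ?S - {id}" for p
  proof -
    obtain k where "p k \<noteq> k" using \<open>p \<in> ?S - {id}\<close> by (auto simp: fun_eq_iff)
    then have k: "\<exists>k. k \<noteq> p k" by metis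
    have "degree (?t p) \<le> degree (of_int (sign p) :: complex poly) + degree (\<Prod>i\<in>UNIV. B $ i $ p i)"
      by (rule degree_mult_le)
    also have "\<dots> \<le> (\<Sum>i\<in>UNIV. degree (B $ i $ p i))"
      using degree_prod_sum_le[of UNIV "\<lambda>i. B $ i $ p i"] by (simp add: o_def)
    also have "\<dots> < (\<Sum>i\<in>(UNIV :: 'n set). 1)"
      using k by (intro sum_strict_mono_ex1) (auto simp: B)
    finally show ?thesis by simp
  qed
  have pos: "0 < CARD('n)" by simp
  have rest: "degree (\<Sum>p\<in>?S - {id}. ?t p) < degree (?t id)"
    unfolding deg_id using deg_less pos by (intro degree_sum_less) auto
  have "det B = ?t id + (\<Sum>p\<in>?S - {id}. ?t p)"
    unfolding det_def by (subst sum.remove[of _ id]) (auto simp: finite_permutations)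
  then have "degree (det B) = CARD('n)"
    by (simp only: degree_add_eq_left[OF rest] deg_id)
  then show ?thesis
    by (simp only: charpoly_def B_def)
qed

lemma size_unordered_eigenvalues: "size (unordered_eigenvalues (A :: complex^'n^'n)) = CARD('n)"
  by (simp add: unordered_eigenvalues_def size_proots_complex degree_charpoly)

section \<open>Curves in metric spaces\<close>

text \<open>The first argument is the metric of the target space.  At points where the limit does not
  exist (a null set, for the curves in question) the value is unspecified.\<close>

definition metric_speed :: "('a \<Rightarrow> 'a \<Rightarrow> real) \<Rightarrow> (real \<Rightarrow> 'a) \<Rightarrow> real \<Rightarrow> real" where
  "metric_speed d \<gamma> x = Lim (at 0) (\<lambda>h. d (\<gamma> (x + h)) (\<gamma> x) / \<bar>h\<bar>)"

text \<open>Infinite energy is represented by \<open>\<infinity>\<close>, and \<open>\<bar>\<infinity> - r\<bar> = \<bar>r - \<infinity>\<bar> = \<bar>\<infinity> - \<infinity>\<bar> = \<infinity>\<close> in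
  \<^typ>\<open>ereal\<close>, so that convergence of energy differences to \<open>0\<close> entails finiteness.\<close>

definition energy :: "('a \<Rightarrow> 'a \<Rightarrow> real) \<Rightarrow> real \<Rightarrow> real set \<Rightarrow> (real \<Rightarrow> 'a) \<Rightarrow> ereal" where
  "energy d q I \<gamma> =
     (if integrable (lebesgue_on I) (\<lambda>x. metric_speed d \<gamma> x powr q)
      then ereal (LINT x|lebesgue_on I. metric_speed d \<gamma> x powr q) else \<infinity>)"

end

theory Submission
  imports Defs
begin

text \<open>Hoffman--Wielandt is avoided: normal matrices are unitarily diagonalizable and the unitary group is
  compact, so \<open>d2\<close> of the spectra is a continuous function of two normal matrices, which together with
  the embedding of \<open>W\<^sup>1\<^sup>,\<^sup>q\<close> into bounded functions gives the uniform convergence.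

  For the speeds, let \<open>x\<close> be a point at which \<open>A\<close> is differentiable.  If the derivative compressed to
  some eigenspace of \<open>A x\<close> is not scalar, then the eigenvalue splits to first order, so the number of
  distinct eigenvalues is larger at all nearby points; there are only countably many such \<open>x\<close>.  At the
  other points first-order perturbation theory shows that the speed equals the norm of the diagonal of
  \<open>U\<^sup>* A'(x) U\<close>, for every unitary \<open>U\<close> diagonalizing \<open>A x\<close>.  As \<open>U\<close> is arbitrary, limits of
  diagonalizing matrices of \<open>An n x\<close> are admissible, and the speeds converge almost everywhere along
  subsequences.  The speeds are dominated by \<open>\<bar>An n'\<bar>\<close>, which converges in \<open>L\<^sup>q\<close>.\<close>

text \<open>With the notation for formal power series present, every \<open>$\<close> has two parses.\<close>

no_notation fps_nth (infixl \<open>$\<close> 75)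

section \<open>Unitary diagonalization of normal matrices\<close>

text \<open>The obstacle is multiple eigenvalues: eigenvectors of \<open>A x\<close> need not be
  continuous in \<open>x\<close>, and on a multiple eigenspace the diagonal of the derivative
  depends on the basis. Hence no eigenvector is followed in \<open>x\<close>. Unitary matrices are
  chosen independently at each point and compared through their overlaps, which are small between
  different eigenvalues but uncontrolled within one eigenspace. There the control comes from the
  derivative being scalar, and then the norm of the diagonal is the same for all bases. The count of
  exceptional points is topological: a subset of the line has only countably many isolated points,
  so almost every \<open>x\<close> is a limit of points with the same number of distinct
  eigenvalues. One such sequence suffices, since what it yields concerns the derivative alone and
  then serves every other approach to \<open>x\<close>. Constants such as
  \<open>real CARD('n) ^ 3\<close> are crude because they only have to provide boundedness or
  domination.\<close>

lemma selfadjoint_eigenvector: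
  fixes f :: "'a::euclidean_space \<Rightarrow> 'a"
  assumes lin: "linear f" and sa: "\<And>x y. f x \<bullet> y = x \<bullet> f y"
    and W: "subspace W" "f ` W \<subseteq> W" and w: "w \<in> W" "w \<noteq> 0"
  obtains v \<mu> where "v \<in> W" "norm v = 1" "f v = \<mu> *\<^sub>R v"
proof -
  \<comment> \<open>The Rayleigh quotient attains its maximum on the unit sphere of
    \<open>W\<close>; the maximizer will be the eigenvector.\<close>
  have "compact (sphere 0 1 \<inter> W)"
    using closed_subspace[OF W(1)] by (intro compact_Int_closed) auto
  moreover have "sgn w \<in> sphere 0 1 \<inter> W"
    using w W(1) by (auto simp: norm_sgn sgn_div_norm subspace_scale)
  moreover have "continuous_on (sphere 0 1 \<inter> W) (\<lambda>v. v \<bullet> f v)"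
    using lin by (intro continuous_intros linear_continuous_on linear_conv_bounded_linear[THEN iffD1])
  ultimately obtain v where v: "v \<in> sphere 0 1 \<inter> W"
      and max: "\<And>y. y \<in> sphere 0 1 \<inter> W \<Longrightarrow> y \<bullet> f y \<le> v \<bullet> f v"
    using continuous_attains_sup[of "sphere 0 1 \<inter> W" "\<lambda>v. v \<bullet> f v"] by blast
  define \<mu> where "\<mu> = v \<bullet> f v"
  have le: "z \<bullet> f z \<le> \<mu> * (z \<bullet> z)" if "z \<in> W" for z
  proof (cases "z = 0")
    case False
    have "sgn z \<bullet> f (sgn z) \<le> \<mu>"
      unfolding \<mu>_def using that W(1) False
      by (intro max) (auto simp: norm_sgn sgn_div_norm subspace_scale)
    moreover have "sgn z \<bullet> f (sgn z) = (z \<bullet> f z) / (z \<bullet> z)"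
      by (simp add: sgn_div_norm linear_scale[OF lin] norm_eq_sqrt_inner field_simps)
    ultimately show ?thesis
      using False by (simp add: field_simps)
  qed (simp add: linear_0[OF lin])
  have vv: "v \<bullet> v = 1" using v by (simp add: norm_eq_1)
  \<comment> \<open>\<open>y\<close> is the residual of the eigenvalue equation. On \<open>W\<close>
    the expression \<open>z \<bullet> f z - \<mu> * (z \<bullet> z)\<close> is never positive and
    vanishes at \<open>v\<close>; moving to \<open>v + t *\<^sub>R y\<close> changes it by
    \<open>2 * t * (y \<bullet> y)\<close> up to a multiple of \<open>t\<^sup>2\<close>, which
    forces \<open>y = 0\<close>.\<close>
  define y where "y = f v - \<mu> *\<^sub>R v"
  have yW: "y \<in> W"
    using v W by (auto simp: y_def intro!: subspace_diff subspace_scale)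
  define K where "K = \<mu> * (y \<bullet> y) - y \<bullet> f y"
  have ineq: "2 * t * (y \<bullet> y) \<le> t\<^sup>2 * K" for t
  proof -
    have 1: "(v + t *\<^sub>R y) \<bullet> f (v + t *\<^sub>R y) \<le> \<mu> * ((v + t *\<^sub>R y) \<bullet> (v + t *\<^sub>R y))"
      using v W yW by (intro le subspace_add subspace_scale) auto
    have 2: "(v + t *\<^sub>R y) \<bullet> f (v + t *\<^sub>R y) = \<mu> + 2 * t * (y \<bullet> f v) + t\<^sup>2 * (y \<bullet> f y)"
      using sa[of v y]
      by (simp add: linear_add[OF lin] linear_scale[OF lin] inner_add_left inner_add_right
            power2_eq_square \<mu>_def inner_commute algebra_simps)
    have 3: "\<mu> * ((v + t *\<^sub>R y) \<bullet> (v + t *\<^sub>R y)) = \<mu> + 2 * t * (\<mu> * (y \<bullet> v)) + t\<^sup>2 * (\<mu> * (y \<bullet> y))"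
      using vv by (simp add: inner_add_left inner_add_right power2_eq_square inner_commute algebra_simps)
    have "y \<bullet> y = y \<bullet> f v - \<mu> * (y \<bullet> v)"
      using y_def inner_diff_right[of y "f v" "\<mu> *\<^sub>R v"] by simp
    then have 4: "2 * t * (y \<bullet> y) = 2 * t * (y \<bullet> f v) - 2 * t * (\<mu> * (y \<bullet> v))"
      by (simp add: right_diff_distrib)
    show ?thesis
      using 1 unfolding 2 3 4 K_def right_diff_distrib by linarith
  qed
  have "y \<bullet> y = 0"
  proof (rule ccontr)
    assume "y \<bullet> y \<noteq> 0"
    then have pos: "y \<bullet> y > 0" by simp
    \<comment> \<open>Chosen so that \<open>t * K \<le> y \<bullet> y\<close>; the
      \<open>+ 1\<close> keeps the denominator positive.\<close>
    define t where "t = (y \<bullet> y) / (\<bar>K\<bar> + 1)"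
    have t: "t > 0" using pos by (simp add: t_def)
    have "2 * t * (y \<bullet> y) \<le> t * (t * K)" using ineq[of t] by (simp add: power2_eq_square)
    then have "2 * (y \<bullet> y) \<le> t * K" using t by (simp add: mult.assoc)
    also have "\<dots> \<le> t * (\<bar>K\<bar> + 1)" using t by (intro mult_left_mono) auto
    also have "\<dots> = y \<bullet> y" by (simp add: t_def)
    finally show False using pos by simp
  qed
  then have "f v = \<mu> *\<^sub>R v" by (simp add: y_def)
  with v show thesis by (intro that[of v \<mu>]) auto
qed

text \<open>Conjugate-linear in the first argument. Its real part is the library inner product, so
  \<open>complex^'n\<close> can be treated both as a complex space and as a real Euclidean space of
  twice the dimension.\<close>

definition cinner :: "complex^'n \<Rightarrow> complex^'n \<Rightarrow> complex" where
  "cinner x y = (\<Sum>i\<in>UNIV. cnj (x $ i) * y $ i)"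

lemma cinner_add_right: "cinner x (y + z) = cinner x y + cinner x z"
  and cinner_scale_right: "cinner x (c *s y) = c * cinner x y"
  and cinner_scaleR_right: "cinner x (r *\<^sub>R y) = r *\<^sub>R cinner x y"
  and cinner_zero_right [simp]: "cinner x 0 = 0"
  by (simp_all add: cinner_def algebra_simps sum.distrib sum_distrib_left scaleR_sum_right)

lemma cinner_commute: "cinner y x = cnj (cinner x y)"
  by (simp add: cinner_def mult.commute)

lemma Re_cinner: "Re (cinner x y) = x \<bullet> y"
  by (simp add: cinner_def inner_vec_def inner_complex_def)

lemma Im_cinner: "Im (cinner x y) = (\<i> *s x) \<bullet> y"
  by (simp add: cinner_def inner_vec_def inner_complex_def sum_subtractf[symmetric] algebra_simps)

lemma cinner_self: "cinner x x = of_real ((norm x)\<^sup>2)"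
proof (rule complex_eqI)
  show "Re (cinner x x) = Re (of_real ((norm x)\<^sup>2))"
    by (simp add: Re_cinner dot_square_norm)
  have "cinner x x = cnj (cinner x x)" by (rule cinner_commute)
  then show "Im (cinner x x) = Im (of_real ((norm x)\<^sup>2))"
    by (simp add: complex_eq_iff)
qed

lemma cinner_conj_transpose: "cinner (conj_transpose M *v x) y = cinner x (M *v y)"
proof -
  have "cinner (conj_transpose M *v x) y = (\<Sum>i\<in>UNIV. \<Sum>j\<in>UNIV. M $ j $ i * cnj (x $ j) * y $ i)"
    by (simp add: cinner_def matrix_vector_mult_def conj_transpose_def sum_distrib_right)
  also have "\<dots> = (\<Sum>j\<in>UNIV. \<Sum>i\<in>UNIV. M $ j $ i * cnj (x $ j) * y $ i)"
    by (rule sum.swap)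
  also have "\<dots> = cinner x (M *v y)"
    by (simp add: cinner_def matrix_vector_mult_def sum_distrib_left mult_ac)
  finally show ?thesis .
qed

lemma conj_transpose_conj_transpose [simp]: "conj_transpose (conj_transpose M) = M"
  by (simp add: conj_transpose_def vec_eq_iff)

lemma conj_transpose_nth [simp]: "conj_transpose M $ i $ j = cnj (M $ j $ i)"
  by (simp add: conj_transpose_def)

lemma conj_transpose_mult: "conj_transpose (M ** N) = conj_transpose N ** conj_transpose M"
  by (simp add: conj_transpose_def matrix_matrix_mult_def vec_eq_iff mult.commute)

lemma linear_matrix_vector_mult_complex: "linear ((*v) (M :: complex^'n^'m))"
proof (rule linearI)
  show "M *v (r *\<^sub>R x) = r *\<^sub>R (M *v x)" for r x
    by (simp add: matrix_vector_mult_def vec_eq_iff scaleR_sum_right)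
qed (rule matrix_vector_right_distrib)

lemma matrix_vector_mult_scale: "M *v (c *s x) = c *s (M *v x)" for M :: "complex^'n^'m"
  by (simp add: vector_scalar_commute)

text \<open>A normal matrix is a combination of two commuting Hermitian ones, which are diagonalized in turn.\<close>

lemma normal_eigenvector:
  fixes M :: "complex^'n^'n"
  assumes M: "M \<in> Norm_matrices" and W: "subspace W"
    and cW: "\<And>x. x \<in> W \<Longrightarrow> \<i> *s x \<in> W"
    and inv: "\<And>x. x \<in> W \<Longrightarrow> M *v x \<in> W" "\<And>x. x \<in> W \<Longrightarrow> conj_transpose M *v x \<in> W"
    and w: "w \<in> W" "w \<noteq> 0"
  obtains v c where "v \<in> W" "norm v = 1" "M *v v = c *s v" "conj_transpose M *v v = cnj c *s v"
proof -
  let ?N = "conj_transpose M"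
  \<comment> \<open>The factor \<open>\<i>\<close> in \<open>g\<close> turns the skew-Hermitian
    difference into a Hermitian one.\<close>
  define f where "f x = M *v x + ?N *v x" for x
  define g where "g x = \<i> *s (M *v x - ?N *v x)" for x
  have adj: "(M *v x) \<bullet> y = x \<bullet> (?N *v y)" "(?N *v x) \<bullet> y = x \<bullet> (M *v y)" for x y
    using cinner_conj_transpose[of M x y] cinner_conj_transpose[of ?N x y]
    by (simp_all add: Re_cinner[symmetric])
  have i_adj: "(\<i> *s x) \<bullet> y = - (x \<bullet> (\<i> *s y))" for x y :: "complex^'n"
    by (simp add: inner_vec_def inner_complex_def sum_negf[symmetric])
  have MN: "M *v (?N *v x) = ?N *v (M *v x)" for x
    using M by (simp add: Norm_matrices_def matrix_vector_mul_assoc)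
  note lin = linear_matrix_vector_mult_complex
  have linf: "linear f" unfolding f_def using lin[of M] lin[of ?N] by (intro linear_compose_add)
  have i_lin: "linear ((*s) (\<i>::complex) :: complex^'n \<Rightarrow> _)"
    by (rule linearI) (simp_all add: vec_eq_iff algebra_simps)
  have ling: "linear g"
    unfolding g_def
    by (rule linear_compose[OF linear_compose_sub[OF lin lin] i_lin, unfolded o_def])
  have saf: "f x \<bullet> y = x \<bullet> f y" for x y
    by (simp add: f_def inner_add_left inner_add_right adj)
  have sag: "g x \<bullet> y = x \<bullet> g y" for x y
    by (simp add: g_def i_adj inner_diff_left inner_diff_right adj vector_sub_rdistrib
          matrix_vector_mult_scale vector_ssub_ldistrib)
  have fW: "f ` W \<subseteq> W" using inv W by (auto simp: f_def intro: subspace_add)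
  have gW: "g x \<in> W" if "x \<in> W" for x
    using inv W that by (auto simp: g_def intro!: cW subspace_diff)
  obtain v0 \<alpha> where v0: "v0 \<in> W" "norm v0 = 1" "f v0 = \<alpha> *\<^sub>R v0"
    using selfadjoint_eigenvector[OF linf saf W fW w] by blast
  define E where "E = {x \<in> W. f x = \<alpha> *\<^sub>R x}"
  have E: "subspace E"
    using W by (auto simp: E_def subspace_def linear_0[OF linf] linear_add[OF linf]
        linear_scale[OF linf] algebra_simps)
  have fg: "f (g x) = g (f x)" for x
    by (simp add: f_def g_def matrix_vector_mult_scale matrix_vector_right_distrib matrix_vector_mult_diff_distrib MN
        vec_eq_iff algebra_simps)
  \<comment> \<open>Commuting maps preserve each other's eigenspaces, so \<open>g\<close> has an
    eigenvector inside the eigenspace \<open>E\<close> of \<open>f\<close>.\<close>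
  have gE: "g ` E \<subseteq> E"
    using gW by (auto simp: E_def fg linear_scale[OF ling])
  have "v0 \<noteq> 0" using v0(2) by auto
  then obtain v \<beta> where v: "v \<in> E" "norm v = 1" "g v = \<beta> *\<^sub>R v"
    using selfadjoint_eigenvector[OF ling sag E gE, of v0] v0 by (auto simp: E_def)
  have eq: "M *v v + ?N *v v = \<alpha> *\<^sub>R v" "\<i> *s (M *v v - ?N *v v) = \<beta> *\<^sub>R v"
    using v by (auto simp: E_def f_def g_def)
  \<comment> \<open>\<open>M\<close> is half of \<open>f - \<i> g\<close> and its adjoint is half of
    \<open>f + \<i> g\<close>; as \<open>\<alpha>\<close> and \<open>\<beta>\<close> are real, the
    two eigenvalues are conjugate.\<close>
  define c where "c = (of_real \<alpha> - \<i> * of_real \<beta>) / 2"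
  have 1: "(M *v v) $ i = c * v $ i \<and> (?N *v v) $ i = cnj c * v $ i" for i
  proof -
    have e1: "(M *v v) $ i + (?N *v v) $ i = of_real \<alpha> * v $ i"
      using arg_cong[OF eq(1), of "\<lambda>x. x $ i"]
      by (simp only: vector_add_component vector_scaleR_component) (simp only: scaleR_conv_of_real)
    have "\<i> * ((M *v v) $ i - (?N *v v) $ i) = of_real \<beta> * v $ i"
      using arg_cong[OF eq(2), of "\<lambda>x. x $ i"]
      by (simp only: vector_minus_component vector_smult_component vector_scaleR_component) (simp only: scaleR_conv_of_real)
    moreover have "D = - \<i> * (\<i> * D)" for D by (simp add: complex_eq_iff)
    ultimately have e2: "(M *v v) $ i - (?N *v v) $ i = - \<i> * of_real \<beta> * v $ i"
      by (metis mult.assoc)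
    have "2 * (M *v v) $ i = of_real \<alpha> * v $ i + - \<i> * of_real \<beta> * v $ i"
      "2 * (?N *v v) $ i = of_real \<alpha> * v $ i - - \<i> * of_real \<beta> * v $ i"
      unfolding e1[symmetric] e2[symmetric] by simp_all
    then show ?thesis by (simp add: c_def field_simps)
  qed
  show thesis
    using v(1,2) 1 by (intro that[of v c]) (auto simp: E_def vec_eq_iff)
qed

text \<open>The complement of the vectors already found is invariant under \<open>M\<close> because
  they are eigenvectors of the adjoint too, hence the second equation in the induction. The index
  set consists of elements of \<open>'n\<close>, so that for \<open>S = UNIV\<close> the vectors can
  serve as the columns of a matrix.\<close>

lemma orthonormal_eigenvectors_normal:
  fixes M :: "complex^'n^'n" and S :: "'n set"
  assumes M: "M \<in> Norm_matrices"
  shows "\<exists>u z. (\<forall>i\<in>S. \<forall>j\<in>S. cinner (u i) (u j) = (if i = j then 1 else 0)) \<and>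
    (\<forall>i\<in>S. M *v u i = z i *s u i \<and> conj_transpose M *v u i = cnj (z i) *s u i)"
  using finite[of S]
proof (induction S rule: finite_induct)
  case (insert k S)
  then obtain u z where u: "\<And>i j. i \<in> S \<Longrightarrow> j \<in> S \<Longrightarrow> cinner (u i) (u j) = (if i = j then 1 else 0)"
    and z: "\<And>i. i \<in> S \<Longrightarrow> M *v u i = z i *s u i"
      "\<And>i. i \<in> S \<Longrightarrow> conj_transpose M *v u i = cnj (z i) *s u i" by metis
  define W where "W = {x. \<forall>i\<in>S. cinner (u i) x = 0}"
  have W: "subspace W"
    by (auto simp: W_def subspace_def cinner_add_right cinner_scaleR_right)
  have cW: "\<i> *s x \<in> W" if "x \<in> W" for x
    using that by (auto simp: W_def cinner_scale_right)
  have cscl: "cinner (c *s x) y = cnj c * cinner x y" for c and x y :: "complex^'n"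
    by (simp add: cinner_def sum_distrib_left mult_ac)
  have inv: "M *v x \<in> W" "conj_transpose M *v x \<in> W" if "x \<in> W" for x
    using that z cinner_conj_transpose[of M _ x] cinner_conj_transpose[of "conj_transpose M" _ x]
    by (auto simp: W_def cscl simp flip: cinner_conj_transpose)
  obtain w where w: "w \<in> W" "w \<noteq> 0"
  proof -
    \<comment> \<open>Complex orthogonality to \<open>u i\<close> is real orthogonality to
      \<open>u i\<close> and \<open>\<i> *s u i\<close>. These are at most \<open>2 * card S\<close>
      vectors in a real space of dimension \<open>2 * CARD('n)\<close>.\<close>
    let ?B = "u ` S \<union> (\<lambda>i. \<i> *s u i) ` S"
    have "dim ?B \<le> card ?B" using insert.hyps by (intro dim_le_card') auto
    also have "\<dots> \<le> card (u ` S) + card ((\<lambda>i. \<i> *s u i) ` S)" by (rule card_Un_le)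
    also have "\<dots> \<le> 2 * card S" using card_image_le[OF insert.hyps(1)]
      by (metis add_mono mult_2)
    also have "\<dots> < 2 * CARD('n)"
      using insert.hyps psubset_card_mono[of UNIV S] by (auto simp: psubset_eq)
    finally have "dim ?B < DIM(complex^'n)" by (simp add: mult.commute)
    then obtain w where w: "w \<noteq> 0" "\<And>y. y \<in> span ?B \<Longrightarrow> orthogonal w y"
      using orthogonal_to_subspace_exists by blast
    have "cinner (u i) w = 0" if "i \<in> S" for i
    proof -
      have "orthogonal w (u i)" "orthogonal w (\<i> *s u i)"
        using that by (auto intro!: w(2) span_base)
      then show ?thesis
        by (simp add: complex_eq_iff Re_cinner Im_cinner orthogonal_def inner_commute)
    qed
    then show thesis using w(1) by (intro that) (auto simp: W_def)
  qed
  obtain v c where v: "v \<in> W" "norm v = 1" "M *v v = c *s v" "conj_transpose M *v v = cnj c *s v"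
    using normal_eigenvector[OF M W cW inv w] by blast
  have "cinner (u i) v = 0" "cinner v (u i) = 0" if "i \<in> S" for i
    using v(1) that cinner_commute[of v "u i"] by (auto simp: W_def)
  moreover have "cinner v v = 1" using v(2) by (simp add: cinner_self)
  ultimately show ?case
    using u z v insert.hyps
    by (intro exI[of _ "u(k := v)"] exI[of _ "z(k := c)"]) auto
qed auto

definition diag_matrix :: "complex^'n \<Rightarrow> complex^'n^'n" where
  "diag_matrix z = (\<chi> i j. if i = j then z $ i else 0)"

lemma diag_matrix_nth [simp]: "diag_matrix z $ i $ j = (if i = j then z $ i else 0)"
  by (simp add: diag_matrix_def)

lemma mult_diag_matrix_nth [simp]: "(M ** diag_matrix z) $ i $ j = M $ i $ j * z $ j"
  by (simp add: matrix_matrix_mult_def if_distrib[of "\<lambda>x. _ * x"] cong: if_cong)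

lemma diag_matrix_mult_nth [simp]: "(diag_matrix z ** M) $ i $ j = z $ i * M $ i $ j"
  by (simp add: matrix_matrix_mult_def if_distrib[of "\<lambda>x. x * _"] cong: if_cong)

text \<open>The columns of \<open>U\<close> are orthonormal eigenvectors and \<open>z\<close> lists
  their eigenvalues. Neither the order of \<open>z\<close> nor the bases of multiple eigenspaces are
  fixed; both freedoms are exploited later.\<close>

definition unitary_diag :: "complex^'n^'n \<Rightarrow> complex^'n \<Rightarrow> complex^'n^'n \<Rightarrow> bool" where
  "unitary_diag U z M \<longleftrightarrow> conj_transpose U ** U = mat 1 \<and> M ** U = U ** diag_matrix z"

lemma unitary_right_inverse:
  fixes U :: "complex^'n^'n"
  assumes "conj_transpose U ** U = mat 1" shows "U ** conj_transpose U = mat (1::complex)"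
  using assms matrix_left_right_inverse[of "conj_transpose U" U] by simp

lemma unitary_diag_eq:
  assumes "unitary_diag U z M"
  shows "M = U ** diag_matrix z ** conj_transpose U" "conj_transpose U ** M ** U = diag_matrix z"
proof -
  have U: "conj_transpose U ** U = mat 1" "M ** U = U ** diag_matrix z"
    using assms by (auto simp: unitary_diag_def)
  show "M = U ** diag_matrix z ** conj_transpose U"
    using unitary_right_inverse[OF U(1)] U(2)
    by (metis matrix_mul_assoc matrix_mul_rid)
  show "conj_transpose U ** M ** U = diag_matrix z"
    using U by (metis matrix_mul_assoc matrix_mul_lid)
qed

theorem normal_unitary_diag:
  fixes M :: "complex^'n^'n"
  assumes "M \<in> Norm_matrices"
  obtains U z where "unitary_diag U z M"
proof -
  obtain u z where u: "\<And>i j :: 'n. cinner (u i) (u j) = (if i = j then 1 else 0)"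
    and z: "\<And>i. M *v u i = z i *s u i"
    using orthonormal_eigenvectors_normal[OF assms, of UNIV] by (metis UNIV_I)
  define U where "U = (\<chi> i j. u j $ i)"
  have "conj_transpose U ** U = mat 1"
    using u by (simp add: vec_eq_iff matrix_matrix_mult_def U_def cinner_def mat_def)
  moreover have "(M ** U) $ i $ j = (U ** diag_matrix (\<chi> j. z j)) $ i $ j" for i j
    using arg_cong[OF z[of j], of "\<lambda>x. x $ i"]
    by (simp add: U_def matrix_matrix_mult_def[of M] matrix_vector_mult_def mult.commute)
  ultimately show thesis
    by (intro that[of U "\<chi> j. z j"]) (simp add: unitary_diag_def vec_eq_iff)
qed

definition entries :: "complex^'n \<Rightarrow> complex multiset" where
  "entries z = image_mset (($) z) (mset_set UNIV)"

lemma poly_det: "poly (det P) x = det (\<chi> i j. poly (P $ i $ j) x)"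
  for P :: "'a::comm_ring_1 poly^'n^'n"
  by (simp add: det_def poly_sum poly_prod)

text \<open>Similar matrices have equal characteristic polynomials. The identity is checked at each
  point \<open>x\<close>, where it becomes one between determinants of complex matrices.\<close>

theorem unordered_eigenvalues_unitary_diag:
  fixes M :: "complex^'n^'n"
  assumes "unitary_diag U z M"
  shows "unordered_eigenvalues M = entries z"
proof -
  have U: "conj_transpose U ** U = mat 1" "M ** U = U ** diag_matrix z"
    using assms by (auto simp: unitary_diag_def)
  have "poly (charpoly M) x = poly (\<Prod>i\<in>UNIV. [:- z $ i, 1:]) x" for x
  proof -
    have "poly (charpoly M) x = det (mat x - M)"
      unfolding charpoly_def poly_det
      by (rule arg_cong[where f = det]) (simp add: vec_eq_iff mat_def)
    also have "\<dots> = det (conj_transpose U) * det (mat x - M) * det U"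
      using arg_cong[OF U(1), of det] by (simp add: det_mul algebra_simps)
    also have "\<dots> = det (conj_transpose U ** (mat x - M) ** U)"
      by (simp add: det_mul)
    also have "conj_transpose U ** (mat x - M) ** U = mat x - diag_matrix z"
    proof -
      have "(mat x - M) ** U = U ** (mat x - diag_matrix z)"
        using U(2) by (simp add: vec_eq_iff matrix_matrix_mult_def mat_def left_diff_distrib
          right_diff_distrib sum_subtractf if_distrib[of "\<lambda>x. _ * x"] if_distrib[of "\<lambda>x. x * _"]
          mult.commute cong: if_cong)
      then show ?thesis
        using U(1) by (metis matrix_mul_assoc matrix_mul_lid)
    qed
    also have "det (mat x - diag_matrix z) = (\<Prod>i\<in>UNIV. x - z $ i)"
      by (subst det_diagonal) (auto simp: mat_def)
    finally show ?thesis by (simp add: poly_prod)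
  qed
  then have "charpoly M = (\<Prod>i\<in>UNIV. [:- z $ i, 1:])"
    by (simp add: poly_eq_poly_eq_iff[symmetric] fun_eq_iff)
  then show ?thesis
    by (simp add: unordered_eigenvalues_def entries_def proots_prod image_mset.id
      sum_unfold_sum_mset)
qed

section \<open>Continuity of the spectrum\<close>

text \<open>Lets compactness arguments prove convergence of a whole sequence: the limit is known
  beforehand and only further subsequences have to be produced.\<close>

lemma tendsto_by_subsequences:
  fixes X :: "nat \<Rightarrow> 'a::topological_space"
  assumes "\<And>r. strict_mono (r :: nat \<Rightarrow> nat) \<Longrightarrow> \<exists>s. strict_mono (s :: nat \<Rightarrow> nat) \<and> (\<lambda>n. X (r (s n))) \<longlonglongrightarrow> L"
  shows "X \<longlonglongrightarrow> L"
proof (rule topological_tendstoI)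
  fix S assume S: "open S" "L \<in> S"
  show "\<forall>\<^sub>F n in sequentially. X n \<in> S"
  proof (rule ccontr)
    assume "\<not> ?thesis"
    then obtain r :: "nat \<Rightarrow> nat" where r: "strict_mono r" "\<And>n. X (r n) \<notin> S"
      using not_eventually_sequentiallyD by blast
    then obtain s :: "nat \<Rightarrow> nat" where "(\<lambda>n. X (r (s n))) \<longlonglongrightarrow> L" using assms by blast
    then show False using topological_tendstoD[OF _ S] r(2) by fastforce
  qed
qed

lemma tendsto_matrix_mult:
  fixes f :: "'a \<Rightarrow> complex^'n^'m" and g :: "'a \<Rightarrow> complex^'k^'n"
  assumes "(f \<longlongrightarrow> M) F" "(g \<longlongrightarrow> N) F"
  shows "((\<lambda>x. f x ** g x) \<longlongrightarrow> M ** N) F"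
  unfolding matrix_matrix_mult_def
  by (intro vec_tendstoI) (auto intro!: tendsto_intros assms)

lemma tendsto_conj_transpose:
  assumes "(f \<longlongrightarrow> M) F"
  shows "((\<lambda>x. conj_transpose (f x)) \<longlongrightarrow> conj_transpose M) F"
  unfolding conj_transpose_def
  by (intro vec_tendstoI) (auto intro!: tendsto_intros assms)

lemma tendsto_diag_matrix:
  assumes "(f \<longlongrightarrow> z) F"
  shows "((\<lambda>x. diag_matrix (f x)) \<longlongrightarrow> diag_matrix z) F"
  unfolding diag_matrix_def
  by (intro vec_tendstoI) (auto intro!: tendsto_intros assms)

lemma closed_Norm_matrices: "closed (Norm_matrices :: (complex^'n^'n) set)"
  unfolding closed_sequential_limits
proof (intro allI impI, elim conjE)
  fix X and L :: "complex^'n^'n"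
  assume X: "\<forall>n. X n \<in> Norm_matrices" and L: "X \<longlonglongrightarrow> L"
  have "(\<lambda>n. conj_transpose (X n) ** X n) \<longlonglongrightarrow> conj_transpose L ** L"
    by (intro tendsto_matrix_mult tendsto_conj_transpose L)
  moreover have "(\<lambda>n. conj_transpose (X n) ** X n) \<longlonglongrightarrow> L ** conj_transpose L"
    using X by (simp add: Norm_matrices_def tendsto_matrix_mult tendsto_conj_transpose L)
  ultimately show "L \<in> Norm_matrices"
    unfolding Norm_matrices_def using LIMSEQ_unique by blast
qed

section \<open>Unitary matrices and limits of diagonalizations\<close>

lemma unitary_row_col:
  fixes U :: "complex^'n^'n"
  assumes "conj_transpose U ** U = mat 1"
  shows "(\<Sum>i\<in>UNIV. cnj (U $ i $ j) * U $ i $ k) = (if j = k then 1 else 0)"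
    and "(\<Sum>i\<in>UNIV. U $ j $ i * cnj (U $ k $ i)) = (if j = k then 1 else 0)"
  using arg_cong[OF assms, of "\<lambda>M. M $ j $ k"]
    arg_cong[OF unitary_right_inverse[OF assms], of "\<lambda>M. M $ j $ k"]
  by (simp_all add: matrix_matrix_mult_def mat_def)

lemma unitary_entry_le:
  fixes U :: "complex^'n^'n"
  assumes "conj_transpose U ** U = mat 1"
  shows "cmod (U $ i $ j) \<le> 1"
proof -
  have "complex_of_real (\<Sum>k\<in>UNIV. (cmod (U $ i $ k))\<^sup>2) = 1"
    using unitary_row_col(2)[OF assms, of i i] by (simp flip: complex_norm_square)
  then have "(\<Sum>k\<in>UNIV. (cmod (U $ i $ k))\<^sup>2) = 1"
    using of_real_eq_1_iff by blast
  moreover have "(cmod (U $ i $ j))\<^sup>2 \<le> (\<Sum>k\<in>UNIV. (cmod (U $ i $ k))\<^sup>2)"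
    by (rule member_le_sum) auto
  ultimately show ?thesis by (simp add: power2_le_imp_le abs_square_le_1)
qed

text \<open>The true value is the square root of the dimension; summing the entries gives a weaker
  bound that is enough to extract convergent subsequences.\<close>

lemma norm_unitary_le:
  fixes U :: "complex^'n^'n"
  assumes "conj_transpose U ** U = mat 1"
  shows "norm U \<le> real CARD('n) * real CARD('n)"
proof -
  have "norm U \<le> (\<Sum>i\<in>UNIV. norm (U $ i))"
    unfolding norm_vec_def by (rule L2_set_le_sum) auto
  also have "\<dots> \<le> (\<Sum>i\<in>UNIV. \<Sum>j\<in>UNIV. cmod (U $ i $ j))"
    unfolding norm_vec_def[of "U $ _"] by (intro sum_mono L2_set_le_sum) auto
  also have "\<dots> \<le> (\<Sum>i\<in>(UNIV::'n set). \<Sum>j\<in>(UNIV::'n set). 1)"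
    by (intro sum_mono unitary_entry_le assms)
  finally show ?thesis by simp
qed

text \<open>Takes the place of continuity of eigenvectors, which can fail where eigenvalues cross.
  Unitary matrices form a bounded set; where a subsequence of them converges, so do the eigenvalues,
  being the diagonal of the conjugated matrices.\<close>

lemma unitary_diag_limit:
  fixes M :: "nat \<Rightarrow> complex^'n^'n"
  assumes U: "\<And>k. unitary_diag (U k) (z k) (M k)" and M: "M \<longlonglongrightarrow> M0"
  obtains r U0 z0 where "strict_mono (r :: nat \<Rightarrow> nat)" "(\<lambda>k. U (r k)) \<longlonglongrightarrow> U0"
    "(\<lambda>k. z (r k)) \<longlonglongrightarrow> z0" "unitary_diag U0 z0 M0"
proof -
  have un: "conj_transpose (U k) ** U k = mat 1" for k
    using U by (simp add: unitary_diag_def)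
  have "bounded (range U)"
    using norm_unitary_le[OF un] by (auto simp: bounded_iff)
  then obtain U0 r where r: "strict_mono r" and U0: "(\<lambda>k. U (r k)) \<longlonglongrightarrow> U0"
    using bounded_imp_convergent_subsequence[of U] by (auto simp: o_def)
  have M': "(\<lambda>k. M (r k)) \<longlonglongrightarrow> M0"
    using LIMSEQ_subseq_LIMSEQ[OF M r] by (simp add: o_def)
  define T where "T = conj_transpose U0 ** M0 ** U0"
  have T: "(\<lambda>k. conj_transpose (U (r k)) ** M (r k) ** U (r k)) \<longlonglongrightarrow> T"
    unfolding T_def by (intro tendsto_matrix_mult tendsto_conj_transpose U0 M')
  have D: "(\<lambda>k. diag_matrix (z (r k))) \<longlonglongrightarrow> T"
    using T unitary_diag_eq(2)[OF U] by simp
  define z0 where "z0 = (\<chi> i. T $ i $ i)"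
  have z0: "(\<lambda>k. z (r k)) \<longlonglongrightarrow> z0"
  proof (rule vec_tendstoI)
    fix i
    have "(\<lambda>k. diag_matrix (z (r k)) $ i $ i) \<longlonglongrightarrow> T $ i $ i"
      by (intro tendsto_vec_nth D)
    then show "(\<lambda>k. z (r k) $ i) \<longlonglongrightarrow> z0 $ i" by (simp add: z0_def)
  qed
  have "(\<lambda>k. conj_transpose (U (r k)) ** U (r k)) \<longlonglongrightarrow> conj_transpose U0 ** U0"
    by (intro tendsto_matrix_mult tendsto_conj_transpose U0)
  then have 1: "conj_transpose U0 ** U0 = mat 1"
    unfolding un by (simp add: LIMSEQ_const_iff)
  have "(\<lambda>k. M (r k) ** U (r k)) \<longlonglongrightarrow> M0 ** U0"
    by (intro tendsto_matrix_mult U0 M')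
  moreover have "(\<lambda>k. M (r k) ** U (r k)) \<longlonglongrightarrow> U0 ** diag_matrix z0"
    using U by (simp add: unitary_diag_def tendsto_matrix_mult U0 tendsto_diag_matrix z0)
  ultimately have "M0 ** U0 = U0 ** diag_matrix z0" by (rule LIMSEQ_unique)
  with 1 show thesis by (intro that[OF r U0 z0]) (simp add: unitary_diag_def)
qed

section \<open>The distance of spectra as a minimum over relabellings\<close>

definition permute_vec :: "('n \<Rightarrow> 'n) \<Rightarrow> 'a^'n \<Rightarrow> 'a^'n" where
  "permute_vec p w = (\<chi> i. w $ p i)"

lemma permute_vec_nth [simp]: "permute_vec p w $ i = w $ p i"
  by (simp add: permute_vec_def)

lemma norm_permute_vec:
  assumes "p permutes (UNIV :: 'n::finite set)"
  shows "norm (permute_vec p w :: 'a::real_normed_vector^'n) = norm w"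
  unfolding norm_vec_def L2_set_def permute_vec_nth
  using sum.permute[OF assms, of "\<lambda>i. (norm (w $ i))\<^sup>2"] by (simp add: o_def)

text \<open>An enumeration of the index type conjugates the permutations of list positions into
  permutations of \<open>'n\<close>. From here on \<open>d2\<close> is a minimum of Euclidean norms
  and lists disappear.\<close>

lemma d2_entries:
  fixes z w :: "complex^'n"
  shows "d2 (entries z) (entries w) =
    Min ((\<lambda>p. norm (z - permute_vec p w)) ` {p. p permutes (UNIV :: 'n set)})"
proof -
  obtain xs :: "'n list" where xs: "set xs = UNIV" "distinct xs"
    using finite_distinct_list[of "UNIV :: 'n set"] by auto
  have ent: "entries y = mset (map (($) y) xs)" for y :: "complex^'n"
    unfolding entries_def mset_map mset_set_set[OF xs(2), unfolded xs(1), symmetric] by simp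
  define n where "n = length xs"
  define f where "f = (!) xs"
  have f: "bij_betw f {..<n} UNIV"
    unfolding f_def n_def using bij_betw_nth[OF xs(2)] xs(1) by simp
  \<comment> \<open>Conjugation by \<open>f\<close>, in the form in which
    \<open>bij_betw_permutations\<close> states it.\<close>
  define F where "F = (\<lambda>\<sigma> x. if x \<in> UNIV then f (\<sigma> (inv_into {..<n} f x)) else x)"
  have F: "{p. p permutes UNIV} = F ` {\<sigma>. \<sigma> permutes {..<n}}"
    using bij_betw_permutations[OF f] unfolding F_def bij_betw_def by blast
  have "sqrt (\<Sum>i<n. (cmod (map (($) z) xs ! i - map (($) w) xs ! \<sigma> i))\<^sup>2) = norm (z - permute_vec (F \<sigma>) w)"
    if \<sigma>: "\<sigma> permutes {..<n}" for \<sigma>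
  proof -
    have "(\<Sum>i<n. (cmod (map (($) z) xs ! i - map (($) w) xs ! \<sigma> i))\<^sup>2)
        = (\<Sum>i<n. (cmod (z $ f i - w $ F \<sigma> (f i)))\<^sup>2)"
    proof (intro sum.cong refl)
      fix i assume i: "i \<in> {..<n}"
      then have "\<sigma> i < n" using permutes_in_image[OF \<sigma>, of i] by simp
      with i bij_betw_imp_inj_on[OF f]
      show "(cmod (map (($) z) xs ! i - map (($) w) xs ! \<sigma> i))\<^sup>2 = (cmod (z $ f i - w $ F \<sigma> (f i)))\<^sup>2"
        by (simp add: F_def n_def f_def)
    qed
    also have "\<dots> = (\<Sum>i\<in>UNIV. (cmod (z $ i - w $ F \<sigma> i))\<^sup>2)"
      by (rule sum.reindex_bij_betw[OF f])
    finally show ?thesis by (simp add: norm_vec_def L2_set_def)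
  qed
  then have "(\<lambda>\<sigma>. sqrt (\<Sum>i<n. (cmod (map (($) z) xs ! i - map (($) w) xs ! \<sigma> i))\<^sup>2)) ` {\<sigma>. \<sigma> permutes {..<n}}
      = (\<lambda>p. norm (z - permute_vec p w)) ` F ` {\<sigma>. \<sigma> permutes {..<n}}"
    unfolding image_image by (intro image_cong refl) blast
  then show ?thesis
    unfolding ent F by (subst d2_mset) (simp_all add: tuple_dist_def n_def)
qed

lemma entries_permute_vec:
  assumes "p permutes (UNIV :: 'n::finite set)"
  shows "entries (permute_vec p w :: complex^'n) = entries w"
proof -
  have "image_mset (($) w) (image_mset p (mset_set UNIV)) = image_mset (($) w) (mset_set UNIV)"
    using permutes_inj_on[OF assms] permutes_image[OF assms] by (simp add: image_mset_mset_set)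
  moreover have "(($) (permute_vec p w)) = ($) w \<circ> p" by (auto simp: fun_eq_iff)
  ultimately show ?thesis
    by (simp add: entries_def multiset.map_comp)
qed

lemma d2_entries_le: "d2 (entries z) (entries w) \<le> norm (z - w)"
  for z w :: "complex^'n"
proof -
  have "norm (z - permute_vec id w) \<in> (\<lambda>p. norm (z - permute_vec p w)) ` {p. p permutes UNIV}"
    by (intro imageI) (simp only: mem_Collect_eq permutes_id)
  then show ?thesis
    unfolding d2_entries by (intro Min_le) (auto simp: finite_permutations vec_eq_iff permute_vec_def)
qed

lemma d2_entries_attained:
  fixes z w :: "complex^'n"
  obtains p where "p permutes UNIV" "d2 (entries z) (entries w) = norm (z - permute_vec p w)"
proof -
  let ?S = "(\<lambda>p. norm (z - permute_vec p w)) ` {p. p permutes (UNIV :: 'n set)}"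
  have "Min ?S \<in> ?S"
    by (intro Min_in) (auto simp: finite_permutations intro!: exI[of _ id] permutes_id[unfolded id_def])
  then show thesis using that unfolding d2_entries by blast
qed

lemma d2_entries_self [simp]: "d2 (entries z) (entries z) = 0"
  for z :: "complex^'n"
  using d2_entries_le[of z z] d2_entries_attained[of z z]
  by (metis antisym cancel_comm_monoid_add_class.diff_cancel norm_ge_zero norm_zero)

text \<open>The permutation that is optimal for \<open>z\<close> and \<open>w\<close> is a
  competitor for \<open>z'\<close> and \<open>w'\<close>. Exchanging the two pairs gives Lipschitz
  continuity.\<close>

lemma d2_entries_diff_le: "d2 (entries z') (entries w') - d2 (entries z) (entries w) \<le> norm (z' - z) + norm (w' - w)"
  for z w :: "complex^'n"
proof -
  obtain p where p: "p permutes UNIV" "d2 (entries z) (entries w) = norm (z - permute_vec p w)"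
    by (rule d2_entries_attained)
  have "d2 (entries z') (entries w') \<le> norm (z' - permute_vec p w')"
    using d2_entries_le[of z' "permute_vec p w'"] by (simp add: entries_permute_vec[OF p(1)])
  also have "z' - permute_vec p w' = (z - permute_vec p w) + (z' - z) - permute_vec p (w' - w)"
    by (simp add: vec_eq_iff)
  also have "norm \<dots> \<le> norm (z - permute_vec p w) + norm (z' - z) + norm (permute_vec p (w' - w))"
    by (smt (verit) norm_triangle_ineq norm_triangle_ineq4)
  finally show ?thesis by (simp add: p(2) norm_permute_vec[OF p(1)])
qed

lemma tendsto_d2_entries:
  fixes z w :: "'a \<Rightarrow> complex^'n"
  assumes "(z \<longlongrightarrow> z0) F" "(w \<longlongrightarrow> w0) F"
  shows "((\<lambda>k. d2 (entries (z k)) (entries (w k))) \<longlongrightarrow> d2 (entries z0) (entries w0)) F"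
proof (rule Lim_null[THEN iffD2])
  have "((\<lambda>k. norm (z k - z0) + norm (w k - w0)) \<longlongrightarrow> norm (z0 - z0) + norm (w0 - w0)) F"
    by (intro tendsto_intros assms)
  then have lim: "((\<lambda>k. norm (z k - z0) + norm (w k - w0)) \<longlongrightarrow> 0) F" by simp
  show "((\<lambda>k. d2 (entries (z k)) (entries (w k)) - d2 (entries z0) (entries w0)) \<longlongrightarrow> 0) F"
    using d2_entries_diff_le[of "z _" "w _" z0 w0] d2_entries_diff_le[of z0 w0 "z _" "w _"]
    by (intro Lim_null_comparison[OF _ lim] always_eventually allI)
      (auto simp: abs_le_iff norm_minus_commute algebra_simps)
qed

text \<open>The limiting eigenvectors depend on the subsequence, but the limiting eigenvalues are
  the spectra of \<open>M0\<close> and \<open>N0\<close> in some order, and \<open>d2\<close> does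
  not see the order.\<close>

lemma tendsto_d2_normal:
  fixes M N :: "nat \<Rightarrow> complex^'n^'n"
  assumes "\<And>k. M k \<in> Norm_matrices" "\<And>k. N k \<in> Norm_matrices" and M: "M \<longlonglongrightarrow> M0" and N: "N \<longlonglongrightarrow> N0"
  shows "(\<lambda>k. d2 (unordered_eigenvalues (M k)) (unordered_eigenvalues (N k)))
    \<longlonglongrightarrow> d2 (unordered_eigenvalues M0) (unordered_eigenvalues N0)"
proof (rule tendsto_by_subsequences)
  fix r :: "nat \<Rightarrow> nat" assume r: "strict_mono r"
  have "\<forall>k. \<exists>U z. unitary_diag U z (M (r k))"
    using normal_unitary_diag assms(1) by metis
  then obtain U z where U: "\<And>k. unitary_diag (U k) (z k) (M (r k))" by metis
  have "\<forall>k. \<exists>V w. unitary_diag V w (N (r k))"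
    using normal_unitary_diag assms(2) by metis
  then obtain V w where V: "\<And>k. unitary_diag (V k) (w k) (N (r k))" by metis
  obtain s U0 z0 where s: "strict_mono s" "(\<lambda>k. z (s k)) \<longlonglongrightarrow> z0" "unitary_diag U0 z0 M0"
    using unitary_diag_limit[OF U LIMSEQ_subseq_LIMSEQ[OF M r, unfolded o_def]] by metis
  have V': "\<And>k. unitary_diag (V (s k)) (w (s k)) (N (r (s k)))" using V by blast
  obtain t V0 w0 where t: "strict_mono t" "(\<lambda>k. w (s (t k))) \<longlonglongrightarrow> w0" "unitary_diag V0 w0 N0"
    using unitary_diag_limit[OF V' LIMSEQ_subseq_LIMSEQ[OF N strict_mono_o[OF r s(1)], unfolded o_def]]
    by metis
  have z: "(\<lambda>k. z (s (t k))) \<longlonglongrightarrow> z0"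
    using LIMSEQ_subseq_LIMSEQ[OF s(2) t(1)] by (simp add: o_def)
  have "(\<lambda>k. d2 (entries (z (s (t k)))) (entries (w (s (t k))))) \<longlonglongrightarrow> d2 (entries z0) (entries w0)"
    by (intro tendsto_d2_entries z t)
  then show "\<exists>s. strict_mono s \<and> (\<lambda>n. d2 (unordered_eigenvalues (M (r (s n)))) (unordered_eigenvalues (N (r (s n)))))
       \<longlonglongrightarrow> d2 (unordered_eigenvalues M0) (unordered_eigenvalues N0)"
    using s(1) t(1)
    by (intro exI[of _ "s \<circ> t"])
      (simp add: strict_mono_o unordered_eigenvalues_unitary_diag[OF U] unordered_eigenvalues_unitary_diag[OF V]
        unordered_eigenvalues_unitary_diag[OF s(3)] unordered_eigenvalues_unitary_diag[OF t(3)])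
qed

lemma continuous_on_d2_normal:
  "continuous_on (Norm_matrices \<times> Norm_matrices)
    (\<lambda>(M :: complex^'n^'n, N :: complex^'n^'n). d2 (unordered_eigenvalues M) (unordered_eigenvalues N))"
proof (rule continuous_on_sequentiallyI)
  fix x :: "nat \<Rightarrow> (complex^'n^'n) \<times> (complex^'n^'n)" and a
  assume x: "\<forall>n. x n \<in> Norm_matrices \<times> Norm_matrices" "x \<longlonglongrightarrow> a"
  have "fst (x n) \<in> Norm_matrices" "snd (x n) \<in> Norm_matrices" for n
    using x(1) by (auto simp: mem_Times_iff)
  then show "(\<lambda>n. case x n of (M, N) \<Rightarrow> d2 (unordered_eigenvalues M) (unordered_eigenvalues N))
      \<longlonglongrightarrow> (case a of (M, N) \<Rightarrow> d2 (unordered_eigenvalues M) (unordered_eigenvalues N))"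
    using tendsto_d2_normal[OF _ _ tendsto_fst[OF x(2)] tendsto_snd[OF x(2)]]
    by (simp add: case_prod_unfold)
qed

lemma d2_normal_self [simp]:
  assumes "M \<in> Norm_matrices" shows "d2 (unordered_eigenvalues M) (unordered_eigenvalues M) = 0"
  using normal_unitary_diag[OF assms] unordered_eigenvalues_unitary_diag d2_entries_self by metis

lemma d2_normal_nonneg:
  fixes M N :: "complex^'n^'n"
  assumes "M \<in> Norm_matrices" "N \<in> Norm_matrices"
  shows "0 \<le> d2 (unordered_eigenvalues M) (unordered_eigenvalues N)"
proof -
  obtain U z where "unitary_diag U z M" using normal_unitary_diag[OF assms(1)] by blast
  moreover obtain V w where "unitary_diag V w N" using normal_unitary_diag[OF assms(2)] by blast
  ultimately show ?thesis
    using d2_entries_attained[of z w] by (metis norm_ge_zero unordered_eigenvalues_unitary_diag)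
qed

lemma d2_normal_uniform:
  assumes "0 < \<epsilon>"
  obtains \<delta> where "0 < \<delta>" "\<And>M N :: complex^'n^'n. \<lbrakk>M \<in> Norm_matrices; N \<in> Norm_matrices; norm M \<le> R; norm N \<le> R;
    norm (M - N) < \<delta>\<rbrakk> \<Longrightarrow> d2 (unordered_eigenvalues M) (unordered_eigenvalues N) < \<epsilon>"
proof -
  let ?K = "(Norm_matrices \<inter> cball 0 R) :: (complex^'n^'n) set"
  let ?f = "\<lambda>(M :: complex^'n^'n, N :: complex^'n^'n). d2 (unordered_eigenvalues M) (unordered_eigenvalues N)"
  have "compact (?K \<times> ?K)"
    by (intro compact_Times closed_Int_compact closed_Norm_matrices compact_cball)
  moreover have "continuous_on (?K \<times> ?K) ?f"
    by (rule continuous_on_subset[OF continuous_on_d2_normal]) auto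
  ultimately have "uniformly_continuous_on (?K \<times> ?K) ?f"
    by (rule compact_uniformly_continuous[rotated])
  then obtain \<delta> where \<delta>: "\<delta> > 0"
    "\<And>x y. x \<in> ?K \<times> ?K \<Longrightarrow> y \<in> ?K \<times> ?K \<Longrightarrow> dist y x < \<delta> \<Longrightarrow> dist (?f y) (?f x) < \<epsilon>"
    unfolding uniformly_continuous_on_def using assms by meson
  show thesis
  proof (rule that[OF \<delta>(1)])
    fix M N :: "complex^'n^'n"
    assume "M \<in> Norm_matrices" "N \<in> Norm_matrices" "norm M \<le> R" "norm N \<le> R" "norm (M - N) < \<delta>"
    \<comment> \<open>The pair \<open>(M, M)\<close> has distance \<open>0\<close>, so uniform
      continuity bounds the distance at the nearby pair \<open>(M, N)\<close>.\<close>
    then show "d2 (unordered_eigenvalues M) (unordered_eigenvalues N) < \<epsilon>"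
      using \<delta>(2)[of "(M, M)" "(M, N)"] d2_normal_nonneg[of M N]
      by (simp add: dist_Pair_Pair dist_norm norm_minus_commute)
  qed
qed

lemma unitary_diag_permute:
  fixes U :: "complex^'n^'n"
  assumes U: "unitary_diag U z M" and p: "p permutes UNIV"
  shows "unitary_diag (\<chi> i. permute_vec p (U $ i)) (permute_vec p z) M"
proof -
  have "inj p" using p by (rule permutes_inj)
  have "conj_transpose U ** U = mat 1" "M ** U = U ** diag_matrix z"
    using U by (auto simp: unitary_diag_def)
  then have "(\<Sum>k\<in>UNIV. cnj (U $ k $ i) * U $ k $ j) = (if i = j then 1 else 0)"
    "(M ** U) $ i $ j = U $ i $ j * z $ j" for i j
    by (auto simp: unitary_row_col(1))
  then show ?thesis
    using \<open>inj p\<close>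
    by (simp add: unitary_diag_def vec_eq_iff matrix_matrix_mult_def[of M]
        matrix_matrix_mult_def[of "conj_transpose _"] mat_def inj_eq)
qed

text \<open>Lists the eigenvalues of \<open>N\<close> in an order optimal for \<open>l\<close>. The
  distance of spectra becomes the norm of a difference of vectors, to which componentwise limits
  apply.\<close>

lemma unitary_diag_nearest:
  fixes N :: "complex^'n^'n"
  assumes U: "unitary_diag U l M" and N: "N \<in> Norm_matrices"
  obtains V \<mu> where "unitary_diag V \<mu> N"
    "norm (l - \<mu>) = d2 (unordered_eigenvalues M) (unordered_eigenvalues N)"
proof -
  obtain V0 \<mu>0 where V0: "unitary_diag V0 \<mu>0 N" using normal_unitary_diag[OF N] by blast
  obtain p where p: "p permutes UNIV" "d2 (entries l) (entries \<mu>0) = norm (l - permute_vec p \<mu>0)"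
    by (rule d2_entries_attained)
  show thesis
    using that[OF unitary_diag_permute[OF V0 p(1)]] p(2)
    by (simp add: unordered_eigenvalues_unitary_diag[OF U] unordered_eigenvalues_unitary_diag[OF V0])
qed

section \<open>First-order perturbation of eigenvalues\<close>

lemma d2_entries_commute: "d2 (entries z) (entries w) = d2 (entries w) (entries z)"
  for z w :: "complex^'n"
proof -
  have le: "d2 (entries w) (entries z) \<le> d2 (entries z) (entries w)" for z w :: "complex^'n"
  proof -
    obtain p where p: "p permutes UNIV" "d2 (entries z) (entries w) = norm (z - permute_vec p w)"
      by (rule d2_entries_attained)
    have "d2 (entries w) (entries z) = d2 (entries (permute_vec p w)) (entries z)"
      by (simp add: entries_permute_vec[OF p(1)])
    also have "\<dots> \<le> norm (permute_vec p w - z)" by (rule d2_entries_le)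
    finally show ?thesis by (simp add: p(2) norm_minus_commute)
  qed
  show ?thesis by (intro antisym le)
qed

text \<open>\<open>f\<close> factors through \<open>g\<close>, and the induced surjection of
  \<open>range g\<close> onto \<open>range f\<close> is injective because the finite cardinalities
  agree. With old eigenvalues as \<open>f\<close> and new ones as \<open>g\<close>: if distinct
  eigenvalues do not merge and their number is unchanged, none splits.\<close>

lemma inj_of_card_range_eq:
  fixes f :: "'n::finite \<Rightarrow> 'a" and g :: "'n \<Rightarrow> 'b"
  assumes fg: "\<And>i j. g i = g j \<Longrightarrow> f i = f j" and card: "card (range f) = card (range g)"
    and eq: "f i = f j"
  shows "g i = g j"
proof -
  define \<phi> where "\<phi> = f \<circ> inv_into UNIV g"
  have \<phi>: "\<phi> (g i) = f i" for i
    unfolding \<phi>_def o_def by (rule fg) (simp add: f_inv_into_f)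
  have "range f = \<phi> ` range g" by (auto simp: \<phi> image_image)
  then have "inj_on \<phi> (range g)" using card by (intro eq_card_imp_inj_on) auto
  then show ?thesis using eq \<phi> by (metis inj_onD rangeI)
qed

lemma tendsto_bounded_mult_0:
  fixes f g :: "'a \<Rightarrow> complex"
  assumes "\<And>k. cmod (f k) \<le> c" "(g \<longlongrightarrow> 0) F"
  shows "((\<lambda>k. f k * g k) \<longlongrightarrow> 0) F"
proof (rule Lim_null_comparison)
  show "\<forall>\<^sub>F k in F. norm (f k * g k) \<le> c * norm (g k)"
    using assms(1) by (intro always_eventually allI) (auto simp: norm_mult intro!: mult_right_mono)
  show "((\<lambda>k. c * norm (g k)) \<longlongrightarrow> 0) F"
    using tendsto_mult[OF tendsto_const tendsto_norm[OF assms(2)], of c] by simp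
qed

lemma matrix_mult_scaleR:
  fixes X Y :: "complex^'n^'n"
  shows "X ** (r *\<^sub>R Y) = r *\<^sub>R (X ** Y)" "(r *\<^sub>R X) ** Y = r *\<^sub>R (X ** Y)"
  by (simp_all add: matrix_matrix_mult_def vec_eq_iff scaleR_sum_right)

lemma matrix_mult_distribs:
  fixes X Y Z :: "complex^'n^'n"
  shows "X ** (Y + Z) = X ** Y + X ** Z" "(X + Y) ** Z = X ** Z + Y ** Z"
    "X ** (Y - Z) = X ** Y - X ** Z" "(X - Y) ** Z = X ** Z - Y ** Z"
  by (simp_all add: matrix_matrix_mult_def vec_eq_iff sum.distrib sum_subtractf algebra_simps)

lemma tendsto_0_mult_cancel:
  fixes f g :: "'a \<Rightarrow> complex"
  assumes fg: "((\<lambda>k. f k * g k) \<longlongrightarrow> 0) F" and g: "(g \<longlongrightarrow> c) F" and c: "c \<noteq> 0"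
  shows "(f \<longlongrightarrow> 0) F"
proof (rule Lim_transform_eventually)
  show "((\<lambda>k. f k * g k / g k) \<longlongrightarrow> 0) F"
    using tendsto_divide[OF fg g c] by simp
  show "\<forall>\<^sub>F k in F. f k * g k / g k = f k"
    using tendsto_imp_eventually_ne[OF g c] by (rule eventually_mono) simp
qed

text \<open>Perturbations \<open>N k\<close> of \<open>M\<close> with matched eigenvalues and steps
  \<open>h k\<close> of either sign. Only difference quotients along the sequence have to converge,
  so the setting covers both the special sequence on which no eigenvalue splits and an arbitrary
  one.\<close>

locale eigen_perturbation =
  fixes U M B :: "complex^'n^'n" and l :: "complex^'n"
    and V N :: "nat \<Rightarrow> complex^'n^'n" and m :: "nat \<Rightarrow> complex^'n" and h :: "nat \<Rightarrow> real"
  assumes U: "unitary_diag U l M" and V: "\<And>k. unitary_diag (V k) (m k) (N k)"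
    and m: "m \<longlonglongrightarrow> l" and h0: "\<And>k. h k \<noteq> 0" and h: "h \<longlonglongrightarrow> 0"
    and deriv: "(\<lambda>k. (N k - M) /\<^sub>R h k) \<longlonglongrightarrow> B"
begin

text \<open>Overlaps: entry \<open>(i, j)\<close> is the inner product of the \<open>i\<close>th
  eigenvector of \<open>N k\<close> with the \<open>j\<close>th one of \<open>M\<close>. Convergence
  of \<open>W k\<close> cannot be expected, as the bases of multiple eigenspaces are
  arbitrary.\<close>

definition W where "W k = conj_transpose (V k) ** U"
definition D where "D k = conj_transpose U ** ((N k - M) /\<^sub>R h k) ** U"
abbreviation C where "C \<equiv> conj_transpose U ** B ** U"

lemma unitary_U: "conj_transpose U ** U = mat 1" "U ** conj_transpose U = mat 1"
  using U unitary_right_inverse by (auto simp: unitary_diag_def)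

lemma unitary_V: "conj_transpose (V k) ** V k = mat 1" "V k ** conj_transpose (V k) = mat 1"
  using V unitary_right_inverse by (auto simp: unitary_diag_def)

lemma unitary_W: "conj_transpose (W k) ** W k = mat 1"
  unfolding W_def conj_transpose_mult using unitary_U unitary_V
  by (metis conj_transpose_conj_transpose matrix_mul_assoc matrix_mul_lid)

lemma D: "(\<lambda>k. D k $ i $ j) \<longlonglongrightarrow> C $ i $ j"
  unfolding D_def by (intro tendsto_vec_nth tendsto_matrix_mult tendsto_const deriv)

lemma NM: "N k = M + h k *\<^sub>R ((N k - M) /\<^sub>R h k)"
  using h0[of k] by simp

text \<open>\<open>conj_transpose (V k) ** (N k - M) ** U\<close>, computed in two ways.\<close>

lemma sandwich: "(m k $ i - l $ j) * W k $ i $ j = of_real (h k) * (W k ** D k) $ i $ j"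
proof -
  have 1: "conj_transpose (V k) ** N k = diag_matrix (m k) ** conj_transpose (V k)"
    using unitary_V(1)[of k] unitary_diag_eq(1)[OF V[of k]] by (metis matrix_mul_assoc matrix_mul_lid)
  have 2: "M ** U = U ** diag_matrix l" using U by (simp add: unitary_diag_def)
  have "conj_transpose (V k) ** (N k - M) ** U = diag_matrix (m k) ** W k - W k ** diag_matrix l"
  proof -
    have "conj_transpose (V k) ** M ** U = W k ** diag_matrix l"
      unfolding W_def by (metis 2 matrix_mul_assoc)
    then show ?thesis
      unfolding matrix_mult_distribs 1 by (simp add: W_def matrix_mul_assoc)
  qed
  moreover have "conj_transpose (V k) ** (N k - M) ** U = h k *\<^sub>R (W k ** D k)"
  proof -
    have "W k ** D k = conj_transpose (V k) ** (U ** conj_transpose U) ** ((N k - M) /\<^sub>R h k) ** U"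
      unfolding W_def D_def by (simp only: matrix_mul_assoc)
    then show ?thesis
      using h0[of k] by (simp add: unitary_U matrix_mult_scaleR)
  qed
  ultimately have "(diag_matrix (m k) ** W k - W k ** diag_matrix l) $ i $ j = (h k *\<^sub>R (W k ** D k)) $ i $ j"
    by simp
  then show ?thesis
    by (simp only: vector_minus_component vector_scaleR_component diag_matrix_mult_nth mult_diag_matrix_nth)
       (simp add: algebra_simps scaleR_conv_of_real)
qed

text \<open>Row \<open>p\<close> of the product combines row \<open>p\<close> of \<open>W k\<close>
  with convergent coefficients \<open>D k $ i $ j\<close>, so decay of the row carries over.\<close>

lemma WD_0:
  assumes "\<And>i. (\<lambda>k. a k * W k $ p $ i) \<longlonglongrightarrow> 0"
  shows "(\<lambda>k. a k * (W k ** D k) $ p $ j) \<longlonglongrightarrow> 0"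
proof -
  have "(\<lambda>k. \<Sum>i\<in>UNIV. (a k * W k $ p $ i) * D k $ i $ j) \<longlonglongrightarrow> (\<Sum>i\<in>UNIV. 0 * C $ i $ j)"
    by (intro tendsto_sum tendsto_mult assms D)
  then show ?thesis by (simp add: matrix_matrix_mult_def sum_distrib_left mult.assoc)
qed

text \<open>In \<open>sandwich\<close> the right side vanishes with \<open>h k\<close>, while the
  factor \<open>m k $ i - l $ j\<close> has a nonzero limit. New eigenvectors thus become orthogonal
  to the old eigenspaces of other eigenvalues.\<close>

lemma W_off_diag_0:
  assumes "l $ i \<noteq> l $ j"
  shows "(\<lambda>k. W k $ i $ j) \<longlonglongrightarrow> 0"
proof -
  have "(\<lambda>k. of_real (h k) * W k $ i $ j) \<longlonglongrightarrow> 0" for j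
    using tendsto_bounded_mult_0[OF unitary_entry_le[OF unitary_W] tendsto_of_real[OF h, simplified]]
    by (simp add: mult.commute)
  then have "(\<lambda>k. (m k $ i - l $ j) * W k $ i $ j) \<longlonglongrightarrow> 0"
    unfolding sandwich by (rule WD_0)
  then have "(\<lambda>k. W k $ i $ j * (m k $ i - l $ j)) \<longlonglongrightarrow> 0"
    by (simp only: mult.commute)
  moreover have "(\<lambda>k. m k $ i - l $ j) \<longlonglongrightarrow> l $ i - l $ j"
    by (intro tendsto_intros m)
  ultimately show ?thesis
    by (rule tendsto_0_mult_cancel) (use assms in simp)
qed

text \<open>If eigenvalues that coincide at \<open>M\<close> stay equal, \<open>D k\<close> on their
  eigenspace is asymptotically the diagonal matrix of eigenvalue difference quotients. The deviation
  is a sum over \<open>p\<close>: terms from the same group vanish, the others contain two small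
  overlaps, one of which absorbs the division by \<open>h k\<close>.\<close>

lemma splitting:
  assumes same: "\<And>i j. l $ i = l $ j \<Longrightarrow> \<forall>\<^sub>F k in sequentially. m k $ i = m k $ j"
    and ij: "l $ i = l $ j"
  shows "(\<lambda>k. D k $ i $ j - (if i = j then (m k $ i - l $ i) / of_real (h k) else 0)) \<longlonglongrightarrow> 0"
proof -
  have M: "conj_transpose U ** M ** U = diag_matrix l" by (rule unitary_diag_eq(2)[OF U])
  have N: "conj_transpose U ** N k ** U = conj_transpose (W k) ** diag_matrix (m k) ** W k" for k
    unfolding W_def conj_transpose_mult
    by (subst unitary_diag_eq(1)[OF V[of k]]) (simp add: matrix_mul_assoc)
  \<comment> \<open>The perturbed matrix is expanded in the old eigenbasis, and
    \<open>m k $ i\<close> times the orthonormality relation of columns \<open>i\<close> and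
    \<open>j\<close> of \<open>W k\<close> is subtracted; every summand then carries a difference of
    new eigenvalues.\<close>
  have eq: "of_real (h k) * D k $ i $ j - (if i = j then m k $ i - l $ i else 0)
      = (\<Sum>p\<in>UNIV. (m k $ p - m k $ i) * (cnj (W k $ p $ i) * W k $ p $ j))" for k
  proof -
    have "conj_transpose U ** N k ** U = conj_transpose U ** M ** U + h k *\<^sub>R D k"
      unfolding D_def by (subst NM) (simp add: matrix_mult_distribs matrix_mult_scaleR)
    then have "(conj_transpose (W k) ** diag_matrix (m k) ** W k) $ i $ j = (diag_matrix l + h k *\<^sub>R D k) $ i $ j"
      by (simp add: M N)
    then have "(\<Sum>p\<in>UNIV. m k $ p * (cnj (W k $ p $ i) * W k $ p $ j))
        = (if i = j then l $ i else 0) + of_real (h k) * D k $ i $ j"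
      by (simp add: matrix_matrix_mult_def[of _ "W k"] scaleR_conv_of_real[of "h k" "D k $ i $ j"] mult_ac)
    moreover have "(\<Sum>p\<in>UNIV. m k $ i * (cnj (W k $ p $ i) * W k $ p $ j)) = (if i = j then m k $ i else 0)"
      using unitary_row_col(1)[OF unitary_W, of k i j] by (simp flip: sum_distrib_left)
    ultimately show ?thesis
      by (simp add: left_diff_distrib sum_subtractf)
  qed
  have lim: "(\<lambda>k. \<Sum>p\<in>UNIV. (m k $ p - m k $ i) * (cnj (W k $ p $ i) * W k $ p $ j) / of_real (h k)) \<longlonglongrightarrow> (\<Sum>p\<in>(UNIV::'n set). 0)"
  proof (rule tendsto_sum)
    fix p
    show "(\<lambda>k. (m k $ p - m k $ i) * (cnj (W k $ p $ i) * W k $ p $ j) / of_real (h k)) \<longlonglongrightarrow> 0"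
    proof (cases "l $ p = l $ i")
      case True
      show ?thesis
        by (rule tendsto_eventually) (use same[OF True] in \<open>auto elim: eventually_mono\<close>)
    next
      \<comment> \<open>By \<open>sandwich\<close>, \<open>W k $ p $ j\<close> divided by
        \<open>h k\<close> is \<open>(W k ** D k) $ p $ j / (m k $ p - l $ j)\<close>, whose
        denominator has a nonzero limit; the other overlap tends to \<open>0\<close>.\<close>
      case False
      have md: "(\<lambda>k. m k $ p - l $ j) \<longlonglongrightarrow> l $ p - l $ j"
        by (intro tendsto_intros m)
      have nz: "l $ p - l $ j \<noteq> 0" using False ij by simp
      have "(\<lambda>k. cnj (W k $ p $ i)) \<longlonglongrightarrow> 0"
        using tendsto_cnj[OF W_off_diag_0[OF False]] by simp
      then have "(\<lambda>k. W k $ p $ q * cnj (W k $ p $ i)) \<longlonglongrightarrow> 0" for q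
        by (rule tendsto_bounded_mult_0[OF unitary_entry_le[OF unitary_W]])
      then have "(\<lambda>k. cnj (W k $ p $ i) * W k $ p $ q) \<longlonglongrightarrow> 0" for q
        by (simp only: mult.commute)
      then have "(\<lambda>k. cnj (W k $ p $ i) * (W k ** D k) $ p $ j) \<longlonglongrightarrow> 0"
        by (rule WD_0)
      then have "(\<lambda>k. (m k $ p - m k $ i) * (cnj (W k $ p $ i) * (W k ** D k) $ p $ j) / (m k $ p - l $ j))
        \<longlonglongrightarrow> (l $ p - l $ i) * 0 / (l $ p - l $ j)"
        by (rule tendsto_divide[OF tendsto_mult[OF tendsto_diff[OF tendsto_vec_nth[OF m] tendsto_vec_nth[OF m]]] md nz])
      moreover have "\<forall>\<^sub>F k in sequentially. m k $ p - l $ j \<noteq> 0"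
        using md nz by (intro tendsto_imp_eventually_ne) auto
      then have "\<forall>\<^sub>F k in sequentially.
          (m k $ p - m k $ i) * (cnj (W k $ p $ i) * (W k ** D k) $ p $ j) / (m k $ p - l $ j)
          = (m k $ p - m k $ i) * (cnj (W k $ p $ i) * W k $ p $ j) / of_real (h k)"
      proof (rule eventually_mono)
        fix k assume nz: "m k $ p - l $ j \<noteq> 0"
        have "W k $ p $ j * (m k $ p - l $ j) = (W k ** D k) $ p $ j * of_real (h k)"
          using sandwich[of k p j] unfolding mult.commute[of "m k $ p - l $ j"] mult.commute[of "of_real (h k)"] .
        then have eq: "(W k ** D k) $ p $ j / (m k $ p - l $ j) = W k $ p $ j / of_real (h k)"
          using nz h0[of k] frac_eq_eq[of "m k $ p - l $ j" "of_real (h k)"] by auto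
        show "(m k $ p - m k $ i) * (cnj (W k $ p $ i) * (W k ** D k) $ p $ j) / (m k $ p - l $ j)
          = (m k $ p - m k $ i) * (cnj (W k $ p $ i) * W k $ p $ j) / of_real (h k)"
          unfolding times_divide_eq_right[symmetric] eq ..
      qed
      ultimately show ?thesis
        unfolding mult_zero_right div_0 by (rule Lim_transform_eventually)
    qed
  qed
  have eq': "(\<Sum>p\<in>UNIV. (m k $ p - m k $ i) * (cnj (W k $ p $ i) * W k $ p $ j) / of_real (h k))
      = D k $ i $ j - (if i = j then (m k $ i - l $ i) / of_real (h k) else 0)" for k
    unfolding sum_divide_distrib[symmetric] eq[symmetric] using h0[of k]
    by (simp add: diff_divide_distrib)
  show ?thesis using lim unfolding eq' sum.neutral_const .
qed

text \<open>The difference quotients in \<open>splitting\<close> agree for indices of a group that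
  stays together, so the limit of the block is scalar. The conclusion mentions only
  \<open>U\<close>, \<open>B\<close> and \<open>l\<close>, so a single suitable sequence establishes
  it.\<close>

lemma block_scalar:
  assumes same: "\<And>i j. l $ i = l $ j \<Longrightarrow> \<forall>\<^sub>F k in sequentially. m k $ i = m k $ j"
    and ij: "l $ i = l $ j"
  shows "C $ i $ j = (if i = j then C $ i $ i else 0)" "C $ i $ i = C $ j $ j"
proof -
  show "C $ i $ j = (if i = j then C $ i $ i else 0)"
  proof (cases "i = j")
    case False
    then have "(\<lambda>k. D k $ i $ j) \<longlonglongrightarrow> 0" using splitting[OF same ij] by simp
    then show ?thesis using LIMSEQ_unique[OF D] False by auto
  qed simp
  have "(\<lambda>k. (D k $ i $ i - (m k $ i - l $ i) / of_real (h k)) - (D k $ j $ j - (m k $ j - l $ j) / of_real (h k))) \<longlonglongrightarrow> 0 - 0"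
    using splitting[OF same refl, of i] splitting[OF same refl, of j] by (intro tendsto_diff) simp_all
  moreover have "\<forall>\<^sub>F k in sequentially.
      (D k $ i $ i - (m k $ i - l $ i) / of_real (h k)) - (D k $ j $ j - (m k $ j - l $ j) / of_real (h k))
      = D k $ i $ i - D k $ j $ j"
    using same[OF ij] by eventually_elim (simp add: ij)
  ultimately have "(\<lambda>k. D k $ i $ i - D k $ j $ j) \<longlonglongrightarrow> 0"
    unfolding diff_zero by (rule Lim_transform_eventually)
  moreover have "(\<lambda>k. D k $ i $ i - D k $ j $ j) \<longlonglongrightarrow> C $ i $ i - C $ j $ j"
    by (intro tendsto_diff D)
  ultimately have "C $ i $ i - C $ j $ j = 0" using LIMSEQ_unique by blast
  then show "C $ i $ i = C $ j $ j" by simp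
qed

text \<open>Eigenvalues may split here, provided \<open>C\<close> is scalar on each eigenspace. For
  \<open>j\<close> in the group of \<open>i\<close>, \<open>sandwich\<close> says that
  \<open>W k ** D k\<close> multiplies \<open>W k $ i $ j\<close> by the difference quotient, while
  asymptotically it multiplies it by \<open>C $ i $ i\<close>. A single overlap may tend to
  \<open>0\<close>, so the relations are summed with weights
  \<open>cnj (W k $ i $ j)\<close>.\<close>

lemma eigenvalue_deriv:
  assumes C: "\<And>i j. l $ i = l $ j \<Longrightarrow> i \<noteq> j \<Longrightarrow> C $ i $ j = 0"
    "\<And>i j. l $ i = l $ j \<Longrightarrow> C $ i $ i = C $ j $ j"
  shows "(\<lambda>k. (m k $ i - l $ i) / of_real (h k)) \<longlonglongrightarrow> C $ i $ i"
proof -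
  let ?J = "{j. l $ j = l $ i}"
  \<comment> \<open>The squared length of the projection of the \<open>i\<close>th new eigenvector
    onto the old eigenspace of \<open>l $ i\<close>; it tends to \<open>1\<close> because all other
    overlaps vanish.\<close>
  define S where "S k = (\<Sum>j\<in>?J. W k $ i $ j * cnj (W k $ i $ j))" for k
  have "S k = 1 - (\<Sum>j\<in>-?J. W k $ i $ j * cnj (W k $ i $ j))" for k
  proof -
    have "S k + (\<Sum>j\<in>-?J. W k $ i $ j * cnj (W k $ i $ j)) = (\<Sum>j\<in>?J \<union> -?J. W k $ i $ j * cnj (W k $ i $ j))"
      unfolding S_def by (rule sum.union_disjoint[symmetric]) auto
    then show ?thesis
      using unitary_row_col(2)[OF unitary_W, of k i i] by (simp add: eq_diff_eq)
  qed
  moreover have "(\<lambda>k. 1 - (\<Sum>j\<in>-?J. W k $ i $ j * cnj (W k $ i $ j))) \<longlonglongrightarrow> 1 - (\<Sum>j\<in>-?J. 0 * cnj 0)"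
    by (intro tendsto_intros W_off_diag_0) auto
  then have "(\<lambda>k. 1 - (\<Sum>j\<in>-?J. W k $ i $ j * cnj (W k $ i $ j))) \<longlonglongrightarrow> 1" by simp
  ultimately have S: "S \<longlonglongrightarrow> 1" by presburger
  have summand: "(\<lambda>k. (W k ** D k) $ i $ j - C $ i $ i * W k $ i $ j) \<longlonglongrightarrow> 0" if j: "l $ j = l $ i" for j
  proof -
    have "(\<lambda>k. \<Sum>p\<in>UNIV. W k $ i $ p * (D k $ p $ j - (if p = j then C $ i $ i else 0))) \<longlonglongrightarrow> (\<Sum>p\<in>(UNIV::'n set). 0)"
    proof (rule tendsto_sum)
      fix p
      have lim: "(\<lambda>k. D k $ p $ j - (if p = j then C $ i $ i else 0)) \<longlonglongrightarrow> C $ p $ j - (if p = j then C $ i $ i else 0)"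
        by (intro tendsto_diff tendsto_const D)
      show "(\<lambda>k. W k $ i $ p * (D k $ p $ j - (if p = j then C $ i $ i else 0))) \<longlonglongrightarrow> 0"
      proof (cases "l $ p = l $ i")
        case True
        then have "C $ p $ j - (if p = j then C $ i $ i else 0) = 0"
          using C(1)[of p j] C(2)[of p i] j by auto
        with lim show ?thesis
          by (intro tendsto_bounded_mult_0[OF unitary_entry_le[OF unitary_W]]) simp
      next
        case False
        then show ?thesis
          using tendsto_mult[OF W_off_diag_0[of i p] lim] by auto
      qed
    qed
    moreover have "(\<Sum>p\<in>UNIV. W k $ i $ p * (D k $ p $ j - (if p = j then C $ i $ i else 0)))
        = (W k ** D k) $ i $ j - C $ i $ i * W k $ i $ j" for k
      by (simp add: right_diff_distrib sum_subtractf matrix_matrix_mult_def[of "W k"]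
          if_distrib[of "\<lambda>x. _ * x"] mult.commute cong: if_cong)
    ultimately show ?thesis by simp
  qed
  have "(\<lambda>k. \<Sum>j\<in>?J. cnj (W k $ i $ j) * ((W k ** D k) $ i $ j - C $ i $ i * W k $ i $ j)) \<longlonglongrightarrow> (\<Sum>j\<in>?J. 0)"
    using unitary_entry_le[OF unitary_W]
    by (intro tendsto_sum tendsto_bounded_mult_0[where c = 1] summand) auto
  moreover have "(\<Sum>j\<in>?J. cnj (W k $ i $ j) * ((W k ** D k) $ i $ j - C $ i $ i * W k $ i $ j))
      = ((m k $ i - l $ i) / of_real (h k) - C $ i $ i) * S k" for k
  proof -
    have "(W k ** D k) $ i $ j = (m k $ i - l $ i) / of_real (h k) * W k $ i $ j" if "j \<in> ?J" for j
      using sandwich[of k i j] h0[of k] that by (simp add: field_simps)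
    then show ?thesis
      unfolding S_def sum_distrib_left
      by (intro sum.cong) (simp_all add: algebra_simps)
  qed
  ultimately have "(\<lambda>k. ((m k $ i - l $ i) / of_real (h k) - C $ i $ i) * S k) \<longlonglongrightarrow> 0" by simp
  then have "(\<lambda>k. (m k $ i - l $ i) / of_real (h k) - C $ i $ i) \<longlonglongrightarrow> 0"
    by (rule tendsto_0_mult_cancel[OF _ S]) simp
  then show ?thesis by (rule Lim_null[THEN iffD2])
qed

end

text \<open>The candidate for the speed. In general it depends on \<open>U\<close>; where
  \<open>eigenvalue_curve_speed\<close> applies, uniqueness of limits makes it the same for all
  \<open>U\<close> that diagonalize \<open>A x\<close>.\<close>

definition diag_norm :: "complex^'n^'n \<Rightarrow> complex^'n^'n \<Rightarrow> real" where
  "diag_norm U B = norm (\<chi> i. (conj_transpose U ** B ** U) $ i $ i)"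

text \<open>The derivative compressed to an eigenspace is scalar unless the eigenvalue splits, which would
  raise the number of distinct eigenvalues nearby.\<close>

theorem eigenvalue_curve_speed:
  fixes A :: "real \<Rightarrow> complex^'n^'n"
  assumes I: "open I" "x \<in> I" and A: "\<And>y. y \<in> I \<Longrightarrow> A y \<in> Norm_matrices"
    and deriv: "(A has_vector_derivative B) (at x)"
    and lim: "x islimpt {y\<in>I. card (set_mset (eigenvalue_curve A y)) = card (set_mset (eigenvalue_curve A x))}"
    and U: "unitary_diag U l (A x)"
  shows "((\<lambda>h. d2 (eigenvalue_curve A (x + h)) (eigenvalue_curve A x) / \<bar>h\<bar>) \<longlongrightarrow> diag_norm U B) (at 0)"
proof -
  \<comment> \<open>For any sequence approaching \<open>x\<close>, diagonalizations matched with
    \<open>l\<close> satisfy the locale assumptions; \<open>m\<close> tends to \<open>l\<close>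
    because \<open>d2\<close> is continuous on normal matrices.\<close>
  have perturb: "\<exists>V m. eigen_perturbation U (A x) B l V (\<lambda>k. A (x + h k)) m h \<and>
      (\<forall>k. norm (l - m k) = d2 (eigenvalue_curve A x) (eigenvalue_curve A (x + h k)))"
    if h: "\<And>k. h k \<noteq> 0" "h \<longlonglongrightarrow> 0" "\<And>k. x + h k \<in> I" for h :: "nat \<Rightarrow> real"
  proof -
    have "\<forall>k. \<exists>V \<mu>. unitary_diag V \<mu> (A (x + h k)) \<and>
        norm (l - \<mu>) = d2 (eigenvalue_curve A x) (eigenvalue_curve A (x + h k))"
    proof
      fix k
      obtain V \<mu> where "unitary_diag V \<mu> (A (x + h k))"
        "norm (l - \<mu>) = d2 (unordered_eigenvalues (A x)) (unordered_eigenvalues (A (x + h k)))"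
        by (rule unitary_diag_nearest[OF U A[OF h(3)]])
      then show "\<exists>V \<mu>. unitary_diag V \<mu> (A (x + h k)) \<and>
          norm (l - \<mu>) = d2 (eigenvalue_curve A x) (eigenvalue_curve A (x + h k))"
        unfolding eigenvalue_curve_def by blast
    qed
    then obtain V m where V: "\<And>k. unitary_diag (V k) (m k) (A (x + h k))"
      and m: "\<And>k. norm (l - m k) = d2 (eigenvalue_curve A x) (eigenvalue_curve A (x + h k))"
      by metis
    have quot: "((\<lambda>t. (A (x + t) - A x) /\<^sub>R t) \<longlongrightarrow> B) (at 0)"
    proof -
      have "((\<lambda>t. norm (A (x + t) - A x - t *\<^sub>R B) / norm t) \<longlongrightarrow> 0) (at 0)"
        using deriv unfolding has_vector_derivative_def has_derivative_at by simp
      moreover have "norm (A (x + t) - A x - t *\<^sub>R B) / norm t = norm ((A (x + t) - A x) /\<^sub>R t - B)"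
        if "t \<noteq> 0" for t
      proof -
        have "(A (x + t) - A x) /\<^sub>R t - B = (A (x + t) - A x - t *\<^sub>R B) /\<^sub>R t"
          using that by (simp only: scaleR_diff_right scaleR_scaleR left_inverse scaleR_one not_False_eq_True)
        then show ?thesis by (simp only: norm_scaleR norm_inverse real_norm_def divide_inverse_commute abs_inverse)
      qed
      then have "\<forall>\<^sub>F t in at 0. norm (A (x + t) - A x - t *\<^sub>R B) / norm t = norm ((A (x + t) - A x) /\<^sub>R t - B)"
        unfolding eventually_at_topological by blast
      ultimately have "((\<lambda>t. norm ((A (x + t) - A x) /\<^sub>R t - B)) \<longlongrightarrow> 0) (at 0)"
        by (rule Lim_transform_eventually)
      then show ?thesis by (rule Lim_null[THEN iffD2, OF tendsto_norm_zero_cancel])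
    qed
    have h': "filterlim h (at 0) sequentially"
      using h by (simp add: filterlim_at)
    have "isCont A x"
      using deriv by (rule has_vector_derivative_continuous)
    then have Ah: "(\<lambda>k. A (x + h k)) \<longlonglongrightarrow> A x"
      using h(2) isCont_tendsto_compose[of x A "\<lambda>k. x + h k"] tendsto_add[OF tendsto_const h(2), of x] by simp
    have "(\<lambda>k. d2 (eigenvalue_curve A x) (eigenvalue_curve A (x + h k))) \<longlonglongrightarrow>
        d2 (eigenvalue_curve A x) (eigenvalue_curve A x)"
      unfolding eigenvalue_curve_def
      by (rule tendsto_d2_normal[OF _ _ tendsto_const Ah]) (use A I(2) h(3) in auto)
    then have "(\<lambda>k. norm (l - m k)) \<longlonglongrightarrow> 0"
      using A[OF I(2)] by (simp add: m eigenvalue_curve_def)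
    then have "m \<longlonglongrightarrow> l"
      unfolding tendsto_dist_iff[of m l] dist_norm by (simp only: norm_minus_commute)
    then show ?thesis
      using filterlim_compose[OF quot h'] V m h U
      by (intro exI[of _ V] exI[of _ m]) (auto simp: eigen_perturbation_def)
  qed
  let ?C = "conj_transpose U ** B ** U"
  \<comment> \<open>The number of distinct eigenvalues is constant along \<open>y\<close>. This
    sequence yields that \<open>?C\<close> is scalar on each eigenspace; the limit itself is taken
    along arbitrary sequences below.\<close>
  obtain y where y: "\<And>k::nat. y k \<in> {y\<in>I. card (set_mset (eigenvalue_curve A y)) = card (set_mset (eigenvalue_curve A x))} - {x}"
      "y \<longlonglongrightarrow> x"
    using lim unfolding islimpt_sequential by blast
  have "(\<lambda>k. y k - x) \<longlonglongrightarrow> x - x" by (intro tendsto_intros y)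
  then obtain V m where "eigen_perturbation U (A x) B l V (\<lambda>k. A (x + (y k - x))) m (\<lambda>k. y k - x)"
    using perturb[of "\<lambda>k. y k - x"] y(1) by auto
  then interpret P: eigen_perturbation U "A x" B l V "\<lambda>k. A (x + (y k - x))" m "\<lambda>k. y k - x" .
  have ev: "set_mset (entries z) = range (($) z)" for z :: "complex^'n"
    by (simp add: entries_def)
  \<comment> \<open>Distinct eigenvalues of \<open>A x\<close> stay distinct nearby, so an unchanged
    count leaves no room for one of them to split.\<close>
  have same: "\<forall>\<^sub>F k in sequentially. m k $ i = m k $ j" if ij: "l $ i = l $ j" for i j
  proof -
    have "\<forall>\<^sub>F k in sequentially. l $ p \<noteq> l $ q \<longrightarrow> m k $ p \<noteq> m k $ q" for p q
    proof (cases "l $ p = l $ q")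
      case False
      have "(\<lambda>k. m k $ p - m k $ q) \<longlonglongrightarrow> l $ p - l $ q" by (intro tendsto_intros P.m)
      then have "\<forall>\<^sub>F k in sequentially. m k $ p - m k $ q \<noteq> 0"
        using False by (intro tendsto_imp_eventually_ne) auto
      then show ?thesis by (rule eventually_mono) auto
    qed auto
    then have "\<forall>\<^sub>F k in sequentially. \<forall>p q. l $ p \<noteq> l $ q \<longrightarrow> m k $ p \<noteq> m k $ q"
      by (intro eventually_all_finite)
    then show ?thesis
    proof (rule eventually_mono)
      fix k assume k: "\<forall>p q. l $ p \<noteq> l $ q \<longrightarrow> m k $ p \<noteq> m k $ q"
      have "card (range (($) l)) = card (range (($) (m k)))"
        using y(1)[of k] unordered_eigenvalues_unitary_diag[OF U] unordered_eigenvalues_unitary_diag[OF P.V[of k]]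
        by (simp add: eigenvalue_curve_def ev)
      then show "m k $ i = m k $ j"
        using k ij inj_of_card_range_eq[of "($) (m k)" "($) l" i j] by blast
    qed
  qed
  have C1: "?C $ i $ j = 0" if "l $ i = l $ j" "i \<noteq> j" for i j
    using P.block_scalar(1)[OF same that(1)] that(2) by simp
  have C2: "?C $ i $ i = ?C $ j $ j" if "l $ i = l $ j" for i j
    using P.block_scalar(2)[OF same that] .
  show ?thesis
  proof (rule tendsto_at_iff_sequentially[THEN iffD2], intro allI impI)
    fix h :: "nat \<Rightarrow> real"
    assume h: "\<forall>i. h i \<in> UNIV - {0}" "h \<longlonglongrightarrow> 0"
    have "(\<lambda>k. x + h k) \<longlonglongrightarrow> x" using tendsto_add[OF tendsto_const h(2), of x] by simp
    then have "\<forall>\<^sub>F k in sequentially. x + h k \<in> I" using I by (rule topological_tendstoD)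
    then obtain k0 where k0: "\<And>k. k \<ge> k0 \<Longrightarrow> x + h k \<in> I"
      unfolding eventually_sequentially by blast
    \<comment> \<open>Shifted so that all points lie in \<open>I\<close>, where \<open>A\<close> is
      normal; \<open>LIMSEQ_offset\<close> undoes the shift.\<close>
    define g where "g = (\<lambda>k. h (k + k0))"
    have g: "\<And>k. g k \<noteq> 0" "g \<longlonglongrightarrow> 0" "\<And>k. x + g k \<in> I"
      using h k0 LIMSEQ_ignore_initial_segment[OF h(2), of k0] by (auto simp: g_def)
    obtain V m where "eigen_perturbation U (A x) B l V (\<lambda>k. A (x + g k)) m g"
      and d: "\<And>k. norm (l - m k) = d2 (eigenvalue_curve A x) (eigenvalue_curve A (x + g k))"
      using perturb[OF g] by blast
    then interpret G: eigen_perturbation U "A x" B l V "\<lambda>k. A (x + g k)" m g by simp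
    have "(\<lambda>k. norm (\<chi> i. (m k $ i - l $ i) / of_real (g k))) \<longlonglongrightarrow> norm (\<chi> i. ?C $ i $ i)"
      by (intro tendsto_norm vec_tendstoI) (simp add: G.eigenvalue_deriv[OF C1 C2])
    moreover have "norm (\<chi> i. (m k $ i - l $ i) / of_real (g k)) =
        d2 (eigenvalue_curve A (x + g k)) (eigenvalue_curve A x) / \<bar>g k\<bar>" for k
    proof -
      have "(\<chi> i. (m k $ i - l $ i) / of_real (g k)) = (m k - l) /\<^sub>R g k"
        by (simp add: vec_eq_iff scaleR_conv_of_real[of _ "_ :: complex"] divide_inverse mult.commute)
      then have "norm (\<chi> i. (m k $ i - l $ i) / of_real (g k)) = norm (l - m k) / \<bar>g k\<bar>"
        by (simp add: norm_minus_commute divide_inverse mult.commute)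
      moreover have "norm (l - m k) = d2 (eigenvalue_curve A (x + g k)) (eigenvalue_curve A x)"
        unfolding d eigenvalue_curve_def unordered_eigenvalues_unitary_diag[OF U]
          unordered_eigenvalues_unitary_diag[OF G.V[of k]] by (rule d2_entries_commute)
      ultimately show ?thesis by simp
    qed
    ultimately have "(\<lambda>k. d2 (eigenvalue_curve A (x + h (k + k0))) (eigenvalue_curve A x) / \<bar>h (k + k0)\<bar>) \<longlonglongrightarrow> diag_norm U B"
      by (simp add: diag_norm_def g_def)
    then show "((\<lambda>h. d2 (eigenvalue_curve A (x + h)) (eigenvalue_curve A x) / \<bar>h\<bar>) \<circ> h) \<longlonglongrightarrow> diag_norm U B"
      unfolding o_def by (rule LIMSEQ_offset)
  qed
qed

section \<open>Weak derivatives on an interval\<close>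

lemma integrable_lebesgue_on_iff:
  fixes f :: "'a::euclidean_space \<Rightarrow> 'b::euclidean_space"
  assumes "S \<in> sets lebesgue"
  shows "integrable (lebesgue_on S) f \<longleftrightarrow> f absolutely_integrable_on S"
  using assms by (simp add: integrable_restrict_space set_integrable_def)

lemma absolutely_integrable_extend:
  fixes f :: "'a::euclidean_space \<Rightarrow> 'b::euclidean_space"
  assumes f: "f absolutely_integrable_on K" and K: "K \<subseteq> S" and 0: "\<And>x. x \<in> S - K \<Longrightarrow> f x = 0"
  shows "f absolutely_integrable_on S" "integral S f = integral K f"
proof -
  have eq: "(\<lambda>x. if x \<in> K then f x else 0) = (\<lambda>x. if x \<in> S then f x else 0)"
    using K 0 by (auto simp: fun_eq_iff)
  show "f absolutely_integrable_on S"
    using f absolutely_integrable_restrict_UNIV[of K f] absolutely_integrable_restrict_UNIV[of S f] eq by simp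
  have "(f has_integral integral K f) K"
    using f by (simp add: integrable_integral set_lebesgue_integral_eq_integral(1))
  then have "(f has_integral integral K f) S"
    using has_integral_restrict_UNIV[of K f] has_integral_restrict_UNIV[of S f] eq by metis
  then show "integral S f = integral K f" by (rule integral_unique)
qed

lemma continuous_scaleR_absolutely_integrable:
  fixes u :: "real \<Rightarrow> 'b::euclidean_space"
  assumes K: "compact K" and \<phi>: "continuous_on K \<phi>" and u: "u absolutely_integrable_on K"
  shows "(\<lambda>x. \<phi> x *\<^sub>R u x) absolutely_integrable_on K"
proof (rule absolutely_integrable_bounded_measurable_product[where h = "(*\<^sub>R)"])
  have "K \<in> sets lebesgue" using K by (simp add: lmeasurable_compact fmeasurableD)
  then show "\<phi> \<in> borel_measurable (lebesgue_on K)" "K \<in> sets lebesgue"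
    using \<phi> by (auto intro: continuous_imp_measurable_on_sets_lebesgue)
  show "bilinear ((*\<^sub>R) :: real \<Rightarrow> 'b \<Rightarrow> 'b)"
    by (simp add: bilinear_conv_bounded_bilinear bounded_bilinear_scaleR)
  show "bounded (\<phi> ` K)"
    using compact_continuous_image[OF \<phi> K] by (rule compact_imp_bounded)
qed (rule u)

lemma test_function_deriv:
  assumes "test_function I \<phi>"
  obtains K where "compact K" "K \<subseteq> I" "continuous_on UNIV \<phi>" "continuous_on UNIV (deriv \<phi>)"
    "\<And>x. x \<notin> K \<Longrightarrow> \<phi> x = 0" "\<And>x. x \<notin> K \<Longrightarrow> deriv \<phi> x = 0"
proof -
  let ?K = "closure {x. \<phi> x \<noteq> 0}"
  have K: "compact ?K" "?K \<subseteq> I" using assms by (auto simp: test_function_def)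
  have "\<phi> C1_differentiable_on UNIV" using assms by (simp add: test_function_def)
  then obtain D where D: "\<And>x. (\<phi> has_vector_derivative D x) (at x)" "continuous_on UNIV D"
    unfolding C1_differentiable_on_def by blast
  have D': "(\<phi> has_real_derivative D x) (at x)" for x
    unfolding has_real_derivative_iff_has_vector_derivative by (rule D)
  have dD: "deriv \<phi> = D" by (rule ext) (rule DERIV_imp_deriv[OF D'])
  have 0: "\<phi> x = 0" if "x \<notin> ?K" for x
    using that closure_subset[of "{x. \<phi> x \<noteq> 0}"] by auto
  have 1: "deriv \<phi> x = 0" if "x \<notin> ?K" for x
  proof -
    have "(\<phi> has_real_derivative 0) (at x)"
    proof (rule has_field_derivative_transform_within_open)
      show "((\<lambda>x. 0) has_real_derivative 0) (at x)" by simp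
      show "open (- ?K)" by (intro open_Compl closed_closure)
      show "x \<in> - ?K" using that by blast
      show "0 = \<phi> y" if "y \<in> - ?K" for y using 0[of y] that by (metis ComplD)
    qed
    then show ?thesis by (rule DERIV_imp_deriv)
  qed
  have "continuous_on UNIV \<phi>"
    by (rule DERIV_continuous_on) (rule has_field_derivative_at_within[OF D'])
  then show thesis using D(2) 0 1 unfolding dD[symmetric] by (rule that[OF K])
qed

text \<open>\<open>W1q_norm\<close> of a difference involves the \<open>weak_deriv\<close> chosen
  for that difference, independently of the choices for its two terms. This provides the existence
  on which that choice rests.\<close>

lemma is_weak_deriv_diff:
  fixes u w :: "real \<Rightarrow> 'b::euclidean_space"
  assumes I: "I \<in> sets lebesgue" and u: "is_weak_deriv I u v" and w: "is_weak_deriv I w z"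
  shows "is_weak_deriv I (\<lambda>x. u x - w x) (\<lambda>x. v x - z x)"
  unfolding is_weak_deriv_def
proof (intro conjI allI impI)
  have li: "locally_integrable_on u I" "locally_integrable_on v I"
    "locally_integrable_on w I" "locally_integrable_on z I"
    using u w by (auto simp: is_weak_deriv_def)
  then show "locally_integrable_on (\<lambda>x. u x - w x) I" "locally_integrable_on (\<lambda>x. v x - z x) I"
    by (auto simp: locally_integrable_on_def)
  fix \<phi> assume \<phi>: "test_function I \<phi>"
  obtain K where K: "compact K" "K \<subseteq> I" "continuous_on UNIV \<phi>" "continuous_on UNIV (deriv \<phi>)"
    "\<And>x. x \<notin> K \<Longrightarrow> \<phi> x = 0" "\<And>x. x \<notin> K \<Longrightarrow> deriv \<phi> x = 0"
    by (rule test_function_deriv[OF \<phi>]) blast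
  have int: "integrable (lebesgue_on I) (\<lambda>x. \<phi> x *\<^sub>R f x)" "integrable (lebesgue_on I) (\<lambda>x. deriv \<phi> x *\<^sub>R f x)"
    if "locally_integrable_on f I" for f :: "real \<Rightarrow> 'b"
  proof -
    have "f absolutely_integrable_on K" using that K by (auto simp: locally_integrable_on_def)
    then have "(\<lambda>x. \<phi> x *\<^sub>R f x) absolutely_integrable_on K" "(\<lambda>x. deriv \<phi> x *\<^sub>R f x) absolutely_integrable_on K"
      using K by (auto intro!: continuous_scaleR_absolutely_integrable intro: continuous_on_subset)
    then show "integrable (lebesgue_on I) (\<lambda>x. \<phi> x *\<^sub>R f x)" "integrable (lebesgue_on I) (\<lambda>x. deriv \<phi> x *\<^sub>R f x)"
      using K(5,6) unfolding integrable_lebesgue_on_iff[OF I]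
      by (auto intro!: absolutely_integrable_extend(1)[OF _ K(2)])
  qed
  have "(LINT x|lebesgue_on I. deriv \<phi> x *\<^sub>R u x) = - (LINT x|lebesgue_on I. \<phi> x *\<^sub>R v x)"
    "(LINT x|lebesgue_on I. deriv \<phi> x *\<^sub>R w x) = - (LINT x|lebesgue_on I. \<phi> x *\<^sub>R z x)"
    using u w \<phi> by (auto simp: is_weak_deriv_def)
  then show "(LINT x|lebesgue_on I. deriv \<phi> x *\<^sub>R (u x - w x)) = - (LINT x|lebesgue_on I. \<phi> x *\<^sub>R (v x - z x))"
    using int[OF li(1)] int[OF li(2)] int[OF li(3)] int[OF li(4)] by (simp add: scaleR_diff_right)
qed

section \<open>A continuously differentiable step and averages against its derivative\<close>

lemma has_real_derivative_positive_part_square: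
  "((\<lambda>t. (max 0 t)\<^sup>2) has_real_derivative 2 * max 0 t) (at t)"
proof -
  consider "t > 0" | "t < 0" | "t = 0" by linarith
  then show ?thesis
  proof cases
    case 1
    have "((\<lambda>t. t\<^sup>2) has_real_derivative 2 * max 0 t) (at t)"
      using 1 by (auto intro!: derivative_eq_intros)
    then show ?thesis
      by (rule has_field_derivative_transform_within_open[where S = "{0<..}"]) (use 1 in auto)
  next
    case 2
    have "((\<lambda>t. 0) has_real_derivative 2 * max 0 t) (at t)"
      using 2 by (auto intro!: derivative_eq_intros)
    then show ?thesis
      by (rule has_field_derivative_transform_within_open[where S = "{..<0}"]) (use 2 in auto)
  next
    case 3
    have "((\<lambda>h::real. \<bar>h\<bar>) \<longlongrightarrow> 0) (at 0)" by (rule tendsto_eq_intros tendsto_ident_at | simp)+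
    then have "((\<lambda>h. (max 0 h)\<^sup>2 / h) \<longlongrightarrow> 0) (at (0::real))"
    proof (rule Lim_null_comparison[rotated])
      have "norm ((max 0 h)\<^sup>2 / h) \<le> \<bar>h\<bar>" for h :: real
        by (auto simp: max_def power2_eq_square)
      then show "\<forall>\<^sub>F h in at 0. norm ((max 0 h)\<^sup>2 / h) \<le> \<bar>h::real\<bar>" by simp
    qed
    then show ?thesis using 3 by (simp add: has_field_derivative_iff)
  qed
qed

text \<open>A piecewise quadratic step; its derivative is a tent function on \<open>{0..1}\<close> with integral \<open>1\<close>.\<close>

definition smooth_step :: "real \<Rightarrow> real" where
  "smooth_step t = 2 * (max 0 t)\<^sup>2 - 4 * (max 0 (t - 1/2))\<^sup>2 + 2 * (max 0 (t - 1))\<^sup>2"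

definition tent :: "real \<Rightarrow> real" where
  "tent t = 4 * max 0 t - 8 * max 0 (t - 1/2) + 4 * max 0 (t - 1)"

lemma smooth_step_has_real_derivative: "(smooth_step has_real_derivative tent t) (at t)"
proof -
  have "((\<lambda>t. (max 0 (t - c))\<^sup>2) has_real_derivative 2 * max 0 (t - c)) (at t)" for c
  proof -
    have "((\<lambda>t. t - c) has_real_derivative 1) (at t)" by (auto intro!: derivative_eq_intros)
    from DERIV_chain2[where g = "\<lambda>t. t - c", OF has_real_derivative_positive_part_square this]
    show ?thesis by simp
  qed
  note sq = this
  have "((\<lambda>t. 2 * (max 0 (t - 0))\<^sup>2 - 4 * (max 0 (t - 1/2))\<^sup>2 + 2 * (max 0 (t - 1))\<^sup>2) has_real_derivative
      2 * (2 * max 0 (t - 0)) - 4 * (2 * max 0 (t - 1/2)) + 2 * (2 * max 0 (t - 1))) (at t)"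
    by (intro DERIV_add DERIV_diff DERIV_cmult sq)
  then show ?thesis
    by (simp add: smooth_step_def[abs_def] tent_def)
qed

lemma smooth_step_scale_has_real_derivative:
  assumes "e \<noteq> 0"
  shows "((\<lambda>t. smooth_step ((t - z) / e)) has_real_derivative tent ((t - z) / e) / e) (at t)"
proof -
  have "((\<lambda>t. (t - z) / e) has_real_derivative 1 / e) (at t)"
    using assms by (auto intro!: derivative_eq_intros)
  from DERIV_chain2[where g = "\<lambda>t. (t - z) / e", OF smooth_step_has_real_derivative this]
  show ?thesis by simp
qed

lemma smooth_step_0: "t \<le> 0 \<Longrightarrow> smooth_step t = 0"
  and smooth_step_1: "1 \<le> t \<Longrightarrow> smooth_step t = 1"
  and tent_nonneg: "0 \<le> tent t"
  and tent_0: "t \<le> 0 \<or> 1 \<le> t \<Longrightarrow> tent t = 0"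
  by (auto simp: smooth_step_def tent_def max_def power2_eq_square algebra_simps)

lemma continuous_on_tent: "continuous_on S tent"
  unfolding tent_def by (intro continuous_intros)

lemma smooth_step_mono: "s \<le> t \<Longrightarrow> smooth_step s \<le> smooth_step t"
  by (rule DERIV_nonneg_imp_nondecreasing) (auto intro: smooth_step_has_real_derivative tent_nonneg)

lemma smooth_step_bounds: "0 \<le> smooth_step t" "smooth_step t \<le> 1"
  using smooth_step_mono[of 0 t] smooth_step_mono[of t 1] smooth_step_0[of t] smooth_step_1[of t]
    smooth_step_0[of 0] smooth_step_1[of 1]
  by (cases "t \<le> 0"; cases "1 \<le> t"; force)+

text \<open>The rescaled tent is nonnegative with integral \<open>1\<close> over an interval
  shrinking to \<open>x\<close> from the right, so the average differs from \<open>u x\<close> by at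
  most the oscillation of \<open>u\<close> on that interval.\<close>

lemma tent_average:
  fixes u :: "real \<Rightarrow> 'b::euclidean_space"
  assumes I: "open I" "x \<in> I" and u: "continuous_on I u" and \<epsilon>: "\<epsilon> \<longlonglongrightarrow> 0" "\<And>n. 0 < \<epsilon> n"
    and sub: "\<And>n. {x..x + \<epsilon> n} \<subseteq> I"
  shows "(\<lambda>n. integral {x..x + \<epsilon> n} (\<lambda>t. (tent ((t - x) / \<epsilon> n) / \<epsilon> n) *\<^sub>R u t)) \<longlonglongrightarrow> u x"
proof (rule LIMSEQ_I)
  fix r :: real assume r: "0 < r"
  have "isCont u x" using u I by (simp add: continuous_on_eq_continuous_at)
  then obtain d where d: "d > 0" "\<And>t. dist t x < d \<Longrightarrow> dist (u t) (u x) < r / 2"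
    unfolding continuous_at_eps_delta using half_gt_zero[OF r] by blast
  obtain N where N: "\<And>n. n \<ge> N \<Longrightarrow> \<epsilon> n < d"
    using order_tendstoD(2)[OF \<epsilon>(1) d(1)] by (auto simp: eventually_sequentially)
  show "\<exists>N. \<forall>n\<ge>N. norm (integral {x..x + \<epsilon> n} (\<lambda>t. (tent ((t - x) / \<epsilon> n) / \<epsilon> n) *\<^sub>R u t) - u x) < r"
  proof (intro exI allI impI)
    fix n assume n: "n \<ge> N"
    define e where "e = \<epsilon> n"
    have e: "0 < e" "e < d" using \<epsilon> N n by (auto simp: e_def)
    let ?S = "{x..x + e}"
    define k where "k t = tent ((t - x) / e) / e" for t
    have k0: "k t \<ge> 0" for t using tent_nonneg e by (simp add: k_def)
    have ck: "continuous_on ?S k"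
      unfolding k_def using e by (intro continuous_intros continuous_on_compose2[OF continuous_on_tent[of UNIV]]) auto
    have cu: "continuous_on ?S u" using u sub[of n] by (auto simp: e_def intro: continuous_on_subset)
    have "((\<lambda>t. smooth_step ((t - x) / e)) has_vector_derivative k t) (at t within ?S)" for t
    proof -
      have "((\<lambda>t. smooth_step ((t - x) / e)) has_real_derivative k t) (at t within ?S)"
        unfolding k_def using e
        by (intro has_field_derivative_at_within[OF smooth_step_scale_has_real_derivative]) simp
      then show ?thesis
        by (simp only: has_real_derivative_iff_has_vector_derivative)
    qed
    then have "(k has_integral (smooth_step ((x + e - x) / e) - smooth_step ((x - x) / e))) ?S"
      using e by (intro fundamental_theorem_of_calculus) auto
    then have int1: "(k has_integral 1) ?S"
      using e by (simp add: smooth_step_0 smooth_step_1)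
    have "integral ?S (\<lambda>t. k t *\<^sub>R u t) - u x = integral ?S (\<lambda>t. k t *\<^sub>R (u t - u x))"
    proof -
      have "((\<lambda>t. k t *\<^sub>R u x) has_integral 1 *\<^sub>R u x) ?S"
        using has_integral_scaleR_left[OF int1, of "u x"] by simp
      moreover have "((\<lambda>t. k t *\<^sub>R u t) has_integral integral ?S (\<lambda>t. k t *\<^sub>R u t)) ?S"
        by (intro integrable_integral integrable_continuous_real continuous_intros ck cu)
      ultimately have "((\<lambda>t. k t *\<^sub>R u t - k t *\<^sub>R u x) has_integral (integral ?S (\<lambda>t. k t *\<^sub>R u t) - 1 *\<^sub>R u x)) ?S"
        by (intro has_integral_diff)
      then show ?thesis by (simp add: scaleR_diff_right integral_unique)
    qed
    moreover have "norm (integral ?S (\<lambda>t. k t *\<^sub>R (u t - u x))) \<le> integral ?S (\<lambda>t. k t * (r / 2))"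
    proof (rule Henstock_Kurzweil_Integration.integral_norm_bound_integral)
      show "(\<lambda>t. k t *\<^sub>R (u t - u x)) integrable_on ?S" "(\<lambda>t. k t * (r / 2)) integrable_on ?S"
        by (intro integrable_continuous_real continuous_intros ck cu)+
      fix t assume "t \<in> ?S"
      then have "dist t x < d" using e by (auto simp: dist_real_def)
      then have "norm (u t - u x) \<le> r / 2" using d(2)[of t] by (simp add: dist_norm)
      then show "norm (k t *\<^sub>R (u t - u x)) \<le> k t * (r / 2)"
        unfolding norm_scaleR using k0[of t] by (simp only: abs_of_nonneg mult_left_mono real_norm_def)
    qed
    moreover have "integral ?S (\<lambda>t. k t * (r / 2)) = 1 * (r / 2)"
      by (intro integral_unique has_integral_mult_left int1)
    ultimately show "norm (integral {x..x + \<epsilon> n} (\<lambda>t. (tent ((t - x) / \<epsilon> n) / \<epsilon> n) *\<^sub>R u t) - u x) < r"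
      using r by (simp add: k_def[symmetric] e_def[symmetric])
  qed
qed

text \<open>Testing against a smoothed indicator function of \<open>{x..y}\<close>.\<close>

theorem weak_deriv_integral:
  fixes u :: "real \<Rightarrow> 'b::euclidean_space"
  assumes I: "I = {a<..<b}" and u: "continuous_on I u" and weak: "is_weak_deriv I u v"
    and v: "v absolutely_integrable_on I" and xy: "x \<in> I" "y \<in> I" "x \<le> y"
  shows "u y - u x = integral {x..y} v"
proof (cases "x = y")
  case False
  then have "x < y" using xy by simp
  have Ileb: "I \<in> sets lebesgue" by (simp add: I)
  \<comment> \<open>Half of \<open>b - y\<close> keeps \<open>y + \<epsilon> n\<close>, and with it
    \<open>x + \<epsilon> n\<close>, below \<open>b\<close>, so that the test functions are
    supported in \<open>I\<close>.\<close>
  define \<epsilon> where "\<epsilon> n = (b - y) / 2 * inverse (real (Suc n))" for n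
  have \<epsilon>: "0 < \<epsilon> n" "y + \<epsilon> n < b" for n
  proof -
    have by_pos: "b - y > 0" using xy by (simp add: I)
    show "0 < \<epsilon> n" unfolding \<epsilon>_def using by_pos by (intro mult_pos_pos) auto
    have "\<epsilon> n \<le> (b - y) / 2 * 1"
      unfolding \<epsilon>_def using by_pos by (intro mult_left_mono) (auto simp: inverse_le_1_iff)
    then show "y + \<epsilon> n < b" using by_pos by simp
  qed
  have \<epsilon>0: "\<epsilon> \<longlonglongrightarrow> 0"
    unfolding \<epsilon>_def using tendsto_mult[OF tendsto_const LIMSEQ_inverse_real_of_nat, of "(b - y) / 2"] by simp
  \<comment> \<open>A ramp to the right of \<open>x\<close> minus one to the right of
    \<open>y\<close>. For large \<open>\<epsilon> n\<close> the ramps may overlap; the estimates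
    hold all the same.\<close>
  define \<phi> where "\<phi> n t = smooth_step ((t - x) / \<epsilon> n) - smooth_step ((t - y) / \<epsilon> n)" for n t
  define k where "k n z t = tent ((t - z) / \<epsilon> n) / \<epsilon> n" for n z t
  have d\<phi>: "(\<phi> n has_real_derivative k n x t - k n y t) (at t)" for n t
  proof -
    have "\<epsilon> n \<noteq> 0" using \<epsilon>(1)[of n] by simp
    then show ?thesis
      unfolding \<phi>_def k_def by (intro DERIV_diff smooth_step_scale_has_real_derivative)
  qed
  have ck: "continuous_on S (k n z)" for S n z
    unfolding k_def using \<epsilon>(1)[of n]
    by (intro continuous_intros continuous_on_compose2[OF continuous_on_tent[of UNIV]]) auto
  have \<phi>0: "\<phi> n t = 0" if "t \<notin> {x..y + \<epsilon> n}" for n t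
  proof (cases "t < x")
    case True
    then show ?thesis using \<open>x < y\<close> \<epsilon>(1)[of n]
      by (simp add: \<phi>_def smooth_step_0 divide_le_0_iff)
  next
    case False
    with that have t: "t > y + \<epsilon> n" by auto
    then show ?thesis using \<open>x < y\<close> \<epsilon>(1)[of n]
      by (simp add: \<phi>_def smooth_step_1)
  qed
  have test: "test_function I (\<phi> n)" for n
  proof -
    have "closure {t. \<phi> n t \<noteq> 0} \<subseteq> {x..y + \<epsilon> n}"
    proof (rule closure_minimal)
      show "{t. \<phi> n t \<noteq> 0} \<subseteq> {x..y + \<epsilon> n}" using \<phi>0[of _ n] by blast
    qed simp
    moreover have "{x..y + \<epsilon> n} \<subseteq> I" using xy \<epsilon>[of n] by (auto simp: I)
    moreover have "\<phi> n C1_differentiable_on UNIV"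
      unfolding C1_differentiable_on_def
      using d\<phi> ck by (intro exI[of _ "\<lambda>t. k n x t - k n y t"])
        (auto simp: has_real_derivative_iff_has_vector_derivative[symmetric] intro!: continuous_on_diff)
    moreover have "compact (closure {t. \<phi> n t \<noteq> 0})"
      using calculation(1) by (meson bounded_closed_interval bounded_subset closed_closure compact_eq_bounded_closed)
    ultimately show ?thesis by (auto simp: test_function_def)
  qed
  have ku: "(\<lambda>t. k n z t *\<^sub>R u t) absolutely_integrable_on I"
      "integral I (\<lambda>t. k n z t *\<^sub>R u t) = integral {z..z + \<epsilon> n} (\<lambda>t. k n z t *\<^sub>R u t)"
    if "z \<in> {x, y}" for n z
  proof -
    have sub: "{z..z + \<epsilon> n} \<subseteq> I" using that \<epsilon>[of n] xy by (auto simp: I)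
    have 0: "k n z t *\<^sub>R u t = 0" if "t \<in> I - {z..z + \<epsilon> n}" for t
    proof -
      have "(t - z) / \<epsilon> n \<le> 0 \<or> 1 \<le> (t - z) / \<epsilon> n"
        using that \<epsilon>(1)[of n] by (auto simp: divide_le_0_iff)
      then show ?thesis by (simp add: k_def tent_0)
    qed
    have "(\<lambda>t. k n z t *\<^sub>R u t) absolutely_integrable_on {z..z + \<epsilon> n}"
      using continuous_on_subset[OF u sub] ck
      by (intro absolutely_integrable_continuous_real continuous_intros)
    from absolutely_integrable_extend[OF this sub 0] show
      "(\<lambda>t. k n z t *\<^sub>R u t) absolutely_integrable_on I"
      "integral I (\<lambda>t. k n z t *\<^sub>R u t) = integral {z..z + \<epsilon> n} (\<lambda>t. k n z t *\<^sub>R u t)"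
      by auto
  qed
  have eq: "(LINT t|lebesgue_on I. \<phi> n t *\<^sub>R v t) =
      integral {y..y + \<epsilon> n} (\<lambda>t. k n y t *\<^sub>R u t) - integral {x..x + \<epsilon> n} (\<lambda>t. k n x t *\<^sub>R u t)" for n
  proof -
    have "(LINT t|lebesgue_on I. deriv (\<phi> n) t *\<^sub>R u t) = - (LINT t|lebesgue_on I. \<phi> n t *\<^sub>R v t)"
      using weak test by (auto simp: is_weak_deriv_def)
    moreover have "(LINT t|lebesgue_on I. deriv (\<phi> n) t *\<^sub>R u t) =
        (LINT t|lebesgue_on I. k n x t *\<^sub>R u t) - (LINT t|lebesgue_on I. k n y t *\<^sub>R u t)"
      using ku(1)[of x n] ku(1)[of y n]
      by (simp add: DERIV_imp_deriv[OF d\<phi>] scaleR_diff_left integrable_lebesgue_on_iff[OF Ileb])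
    moreover have "(LINT t|lebesgue_on I. k n z t *\<^sub>R u t) = integral {z..z + \<epsilon> n} (\<lambda>t. k n z t *\<^sub>R u t)"
      if "z \<in> {x, y}" for z
      using ku[OF that, of n] Ileb by (simp add: lebesgue_integral_eq_integral integrable_lebesgue_on_iff)
    ultimately show ?thesis by (simp add: algebra_simps eq_neg_iff_add_eq_0)
  qed
  have "open I" by (simp add: I)
  have sub: "{x..x + \<epsilon> n} \<subseteq> I" "{y..y + \<epsilon> n} \<subseteq> I" for n
    using xy \<epsilon>[of n] by (auto simp: I)
  have "(\<lambda>n. LINT t|lebesgue_on I. \<phi> n t *\<^sub>R v t) \<longlonglongrightarrow> u y - u x"
    unfolding eq k_def
    by (intro tendsto_diff tent_average[OF \<open>open I\<close> _ u \<epsilon>0 \<epsilon>(1)] xy sub)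
  \<comment> \<open>The limiting interval is half-open because each ramp is \<open>0\<close> at its
    left end and tends to \<open>1\<close> at every point to the right of it.\<close>
  moreover have "(\<lambda>n. LINT t|lebesgue_on I. \<phi> n t *\<^sub>R v t) \<longlonglongrightarrow> (LINT t|lebesgue_on I. indicator {x<..y} t *\<^sub>R v t)"
  proof (rule integral_dominated_convergence[where w = "\<lambda>t. norm (v t)"])
    have vi: "integrable (lebesgue_on I) v" using v Ileb by (simp add: integrable_lebesgue_on_iff)
    then show "integrable (lebesgue_on I) (\<lambda>t. norm (v t))" by (rule integrable_norm)
    have vm: "v \<in> borel_measurable (lebesgue_on I)" using vi by (rule borel_measurable_integrable)
    have "{x<..y} \<in> sets lebesgue" by simp
    then show "(\<lambda>t. indicator {x<..y} t *\<^sub>R v t) \<in> borel_measurable (lebesgue_on I)"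
      by (intro borel_measurable_scaleR vm measurable_restrict_space1 borel_measurable_indicator)
    have "continuous_on I (\<phi> n)" for n
      by (rule DERIV_continuous_on) (rule has_field_derivative_at_within[OF d\<phi>])
    then show "(\<lambda>t. \<phi> n t *\<^sub>R v t) \<in> borel_measurable (lebesgue_on I)" for n
      by (intro borel_measurable_scaleR vm continuous_imp_measurable_on_sets_lebesgue Ileb)
    show "AE t in lebesgue_on I. norm (\<phi> n t *\<^sub>R v t) \<le> norm (v t)" for n
    proof (rule AE_I2)
      fix t
      have "\<bar>\<phi> n t\<bar> \<le> 1"
        using smooth_step_bounds[of "(t - x) / \<epsilon> n"] smooth_step_bounds[of "(t - y) / \<epsilon> n"]
        unfolding \<phi>_def by linarith
      then show "norm (\<phi> n t *\<^sub>R v t) \<le> norm (v t)"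
        by (simp add: mult_left_le_one_le)
    qed
    have step: "(\<lambda>n. smooth_step ((t - z) / \<epsilon> n)) \<longlonglongrightarrow> (if z < t then 1 else 0)" for t z
    proof (rule tendsto_eventually)
      show "\<forall>\<^sub>F n in sequentially. smooth_step ((t - z) / \<epsilon> n) = (if z < t then 1 else 0)"
      proof (cases "z < t")
        case True
        then have "\<forall>\<^sub>F n in sequentially. \<epsilon> n < t - z" using \<epsilon>0 by (intro order_tendstoD(2)) auto
        then show ?thesis
          by (rule eventually_mono) (use \<epsilon>(1) True in \<open>auto intro!: smooth_step_1 simp: less_imp_le\<close>)
      next
        case False
        then show ?thesis using \<epsilon>(1) by (auto intro!: always_eventually smooth_step_0 simp: divide_le_0_iff less_imp_le)
      qed
    qed
    show "AE t in lebesgue_on I. (\<lambda>n. \<phi> n t *\<^sub>R v t) \<longlonglongrightarrow> indicator {x<..y} t *\<^sub>R v t"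
    proof (rule AE_I2)
      fix t
      have "(\<lambda>n. \<phi> n t) \<longlonglongrightarrow> (if x < t then 1 else 0) - (if y < t then 1 else 0)"
        unfolding \<phi>_def by (intro tendsto_diff step)
      moreover have "(if x < t then 1 else 0) - (if y < t then 1 else 0) = (indicator {x<..y} t :: real)"
        using \<open>x < y\<close> by (auto simp: indicator_def)
      ultimately show "(\<lambda>n. \<phi> n t *\<^sub>R v t) \<longlonglongrightarrow> indicator {x<..y} t *\<^sub>R v t"
        by (intro tendsto_scaleR tendsto_const) simp
    qed
  qed
  ultimately have "u y - u x = (LINT t|lebesgue_on I. indicator {x<..y} t *\<^sub>R v t)"
    by (rule LIMSEQ_unique)
  also have "\<dots> = (LINT t|lebesgue. indicator I t *\<^sub>R indicator {x<..y} t *\<^sub>R v t)"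
    by (subst integral_restrict_space) (use Ileb in auto)
  also have "(\<lambda>t. indicator I t *\<^sub>R indicator {x<..y} t *\<^sub>R v t) = (\<lambda>t. indicator {x<..y} t *\<^sub>R v t)"
    using xy by (auto simp: I indicator_def fun_eq_iff)
  also have "(LINT t|lebesgue. indicator {x<..y} t *\<^sub>R v t) = integral {x<..y} v"
  proof -
    have "v absolutely_integrable_on {x<..y}"
      using xy by (intro set_integrable_subset[OF v]) (auto simp: I)
    from set_lebesgue_integral_eq_integral(2)[OF this] show ?thesis
      by (simp add: set_lebesgue_integral_def)
  qed
  also have "\<dots> = integral {x..y} v"
    by (rule integral_spike_set) (auto intro: negligible_subset[OF negligible_sing[of x]])
  finally show ?thesis .
qed simp

text \<open>The library version of Lebesgue's differentiation theorem, \<open>integrable_ccontinuous_explicit\<close>, is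
  one-sided; the other side comes from reflection.\<close>

theorem weak_deriv_differentiable:
  fixes u :: "real \<Rightarrow> 'b::euclidean_space"
  assumes I: "I = {a<..<b}" and v: "v absolutely_integrable_on I"
    and eq: "\<And>x y. x \<in> I \<Longrightarrow> y \<in> I \<Longrightarrow> x \<le> y \<Longrightarrow> u y - u x = integral {x..y} v"
  shows "AE x in lebesgue_on I. (u has_vector_derivative v x) (at x)"
proof -
  \<comment> \<open>Extension by \<open>0\<close>: the differentiation theorem asks for
    integrability on every bounded box.\<close>
  define f where "f x = (if x \<in> I then v x else 0)" for x
  have fU: "f absolutely_integrable_on UNIV"
    unfolding f_def absolutely_integrable_restrict_UNIV by (rule v)
  have f: "f integrable_on cbox c d" for c d
    using set_lebesgue_integral_eq_integral(1)[OF fU] integrable_on_subcbox by blast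
  then have g: "(\<lambda>x. f (- x)) integrable_on cbox c d" for c d
    using integrable_reflect[of f "-c" "-d"] by simp
  obtain N where N: "negligible N" "\<And>x e. \<lbrakk>x \<notin> N; 0 < e\<rbrakk> \<Longrightarrow>
      \<exists>d>0. \<forall>h. 0 < h \<and> h < d \<longrightarrow> norm (integral {x..x + h} f /\<^sub>R h - f x) < e"
    using integrable_ccontinuous_explicit[OF f] by auto
  obtain N' where N': "negligible N'" "\<And>x e. \<lbrakk>x \<notin> N'; 0 < e\<rbrakk> \<Longrightarrow>
      \<exists>d>0. \<forall>h. 0 < h \<and> h < d \<longrightarrow> norm (integral {x..x + h} (\<lambda>x. f (- x)) /\<^sub>R h - f (- x)) < e"
    using integrable_ccontinuous_explicit[OF g] by auto
  \<comment> \<open>\<open>N'\<close> is exceptional for the reflected function, so it is reflected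
    back.\<close>
  let ?N = "N \<union> uminus ` N'"
  have "negligible ?N"
    by (intro negligible_Un N(1) negligible_differentiable_image_negligible[OF _ N'(1)])
      (auto intro!: derivative_intros simp: differentiable_on_def)
  then have "AE x in lebesgue. x \<notin> ?N"
    by (simp only: negligible_iff_null_sets AE_not_in)
  then have "AE x in lebesgue_on I. x \<notin> ?N"
    by (subst AE_restrict_space_iff) (auto simp: I)
  then show ?thesis
  proof (rule AE_mp, intro AE_I2 impI)
    fix x assume "x \<in> space (lebesgue_on I)" and xN: "x \<notin> ?N"
    then have x: "x \<in> I" by simp
    have "- x \<notin> N'" using xN by force
    have fi: "integral {s..t} f = u t - u s" if "s \<in> I" "t \<in> I" "s \<le> t" for s t
    proof -
      have "{s..t} \<subseteq> I" using that by (auto simp: I)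
      then have "integral {s..t} f = integral {s..t} v"
        by (intro integral_cong) (auto simp: f_def)
      then show ?thesis using eq[OF that] by simp
    qed
    obtain r where r: "r > 0" "\<And>t. \<bar>t - x\<bar> < r \<Longrightarrow> t \<in> I"
      using openE[of I x] x unfolding I by (auto simp: dist_real_def ball_def abs_minus_commute subset_eq)
    have "((\<lambda>h. norm (u (x + h) - u x - h *\<^sub>R v x) / norm h) \<longlongrightarrow> 0) (at 0)"
    proof (rule LIM_I)
      fix e :: real assume "0 < e"
      obtain d1 where d1: "d1 > 0" "\<And>h::real. 0 < h \<Longrightarrow> h < d1 \<Longrightarrow> norm (integral {x..x + h} f /\<^sub>R h - f x) < e"
        using N(2)[of x e] xN \<open>0 < e\<close> by auto
      obtain d2 where d2: "d2 > 0" "\<And>h::real. 0 < h \<Longrightarrow> h < d2 \<Longrightarrow>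
          norm (integral {- x..- x + h} (\<lambda>x. f (- x)) /\<^sub>R h - f x) < e"
        using N'(2)[of "- x" e] \<open>- x \<notin> N'\<close> \<open>0 < e\<close> by auto
      have quot: "norm (w - h *\<^sub>R v x) / \<bar>h\<bar> = norm (w /\<^sub>R h - v x)" if "h \<noteq> 0" for h :: real and w :: 'b
      proof -
        have "w /\<^sub>R h - v x = (w - h *\<^sub>R v x) /\<^sub>R h" using that by (simp add: scaleR_diff_right)
        then show ?thesis by (simp only: norm_scaleR divide_inverse_commute abs_inverse)
      qed
      show "\<exists>s>0. \<forall>h::real. h \<noteq> 0 \<and> norm (h - 0) < s \<longrightarrow> norm (norm (u (x + h) - u x - h *\<^sub>R v x) / norm h - 0) < e"
      proof (intro exI[of _ "min r (min d1 d2)"] conjI allI impI)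
        show "0 < min r (min d1 d2)" using r d1 d2 by simp
        fix h :: real assume h: "h \<noteq> 0 \<and> norm (h - 0) < min r (min d1 d2)"
        have xh: "x + h \<in> I" using r(2)[of "x + h"] h by simp
        have "norm ((u (x + h) - u x) /\<^sub>R h - v x) < e"
        proof (cases "h > 0")
          case True
          then show ?thesis using d1(2)[of h] h fi[OF x xh] x by (simp add: f_def)
        next
          case False
          then have h': "0 < - h" "- h < d2" using h by auto
          have "integral {- x..- x + - h} (\<lambda>x. f (- x)) = integral {x + h..x} f"
            using Henstock_Kurzweil_Integration.integral_reflect_real[of x "x + h" f] by simp
          also have "\<dots> = u x - u (x + h)" using fi[OF xh x] False by simp
          finally have "norm ((u x - u (x + h)) /\<^sub>R (- h) - v x) < e"
            using d2(2)[OF h'] x by (simp add: f_def)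
          moreover have "(u x - u (x + h)) /\<^sub>R (- h) = (u (x + h) - u x) /\<^sub>R h"
            by (simp flip: scaleR_minus_right)
          ultimately show ?thesis by simp
        qed
        then show "norm (norm (u (x + h) - u x - h *\<^sub>R v x) / norm h - 0) < e"
          using quot[of h "u (x + h) - u x"] h by simp
      qed
    qed
    then show "(u has_vector_derivative v x) (at x)"
      unfolding has_vector_derivative_def has_derivative_at
      by (simp add: bounded_linear_scaleR_left)
  qed
qed

section \<open>Convergence in \<open>L\<^sup>q\<close> and \<open>W\<^sup>1\<^sup>,\<^sup>q\<close>\<close>

lemma absolutely_continuous_on_imp_continuous_on:
  fixes u :: "real \<Rightarrow> 'b::real_normed_vector"
  assumes u: "absolutely_continuous_on I u" and I: "is_interval I"
  shows "continuous_on I u"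
  unfolding continuous_on_iff
proof (intro ballI allI impI)
  fix x and e :: real assume x: "x \<in> I" and e: "0 < e"
  from u[unfolded absolutely_continuous_on_def, THEN spec, THEN mp, OF e]
  obtain d where d: "d > 0" and *: "\<forall>(n::nat) s t. (\<forall>k<n. s k \<le> t k \<and> {s k..t k} \<subseteq> I) \<and>
        disjoint_family_on (\<lambda>k. {s k<..<t k}) {..<n} \<and> (\<Sum>k<n. t k - s k) < d \<longrightarrow>
        (\<Sum>k<n. norm (u (t k) - u (s k))) < e"
    by (elim exE conjE)
  have le: "norm (u t - u s) < e" if "s \<in> I" "t \<in> I" "s \<le> t" "t - s < d" for s t
  proof -
    have "{s..t} \<subseteq> I"
      using I that unfolding is_interval_1 by (meson atLeastAtMost_iff subsetI)
    then show ?thesis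
      using *[rule_format, of 1 "\<lambda>_. s" "\<lambda>_. t"] that by (simp add: disjoint_family_on_def)
  qed
  show "\<exists>d>0. \<forall>x'\<in>I. dist x' x < d \<longrightarrow> dist (u x') (u x) < e"
  proof (intro exI[of _ d] conjI d ballI impI)
    fix y assume y: "y \<in> I" "dist y x < d"
    show "dist (u y) (u x) < e"
    proof (cases "x \<le> y")
      case True
      then show ?thesis using le[of x y] x y by (simp add: dist_norm)
    next
      case False
      then show ?thesis using le[of y x] x y by (simp add: dist_norm norm_minus_commute)
    qed
  qed
qed

text \<open>Stands in for Hoelder's inequality. Small values are absorbed by
  \<open>\<delta>\<close>; for \<open>t > \<delta>\<close> the factor \<open>t powr (1 - q)\<close>
  is at most \<open>\<delta> powr (1 - q)\<close> because its exponent is not positive.\<close>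

lemma le_add_powr:
  fixes t :: real
  assumes "0 < \<delta>" "1 \<le> q" "0 \<le> t"
  shows "t \<le> \<delta> + \<delta> powr (1 - q) * t powr q"
proof (cases "t \<le> \<delta>")
  case False
  have "t = t powr ((1 - q) + q)" using False assms by simp
  also have "\<dots> = t powr (1 - q) * t powr q" by (rule powr_add)
  also have "\<dots> \<le> \<delta> powr (1 - q) * t powr q"
    using False assms by (intro mult_right_mono powr_mono2') auto
  finally show ?thesis using assms by simp
qed (simp add: add_increasing2)

text \<open>From \<open>x + y \<le> 2 * max x y\<close>, which explains the constant.\<close>

lemma add_powr_le:
  fixes x y :: real
  assumes "0 \<le> x" "0 \<le> y" "0 \<le> q"
  shows "(x + y) powr q \<le> 2 powr q * (x powr q + y powr q)"
proof -
  have "(x + y) powr q \<le> (2 * max x y) powr q"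
    using assms by (intro powr_mono2) auto
  also have "\<dots> = 2 powr q * max x y powr q" using assms by (simp add: powr_mult)
  also have "max x y powr q \<le> x powr q + y powr q" by (simp add: max_def)
  finally show ?thesis by simp
qed

lemma (in finite_measure) integrable_of_norm_powr:
  fixes f :: "'a \<Rightarrow> 'b::{banach, second_countable_topology}"
  assumes f: "f \<in> borel_measurable M" "integrable M (\<lambda>x. norm (f x) powr q)" and q: "1 \<le> q"
  shows "integrable M f"
proof (rule Bochner_Integration.integrable_bound)
  show "integrable M (\<lambda>x. 1 + norm (f x) powr q)" by (intro Bochner_Integration.integrable_add f) simp
  show "AE x in M. norm (f x) \<le> norm (1 + norm (f x) powr q)"
    using le_add_powr[of 1 q] q by (intro AE_I2) auto
qed (rule f)

lemma (in finite_measure) integral_norm_le_powr: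
  fixes f :: "'a \<Rightarrow> 'b::{banach, second_countable_topology}"
  assumes f: "f \<in> borel_measurable M" "integrable M (\<lambda>x. norm (f x) powr q)" and q: "1 \<le> q"
    and \<delta>: "0 < \<delta>"
  shows "(LINT x|M. norm (f x)) \<le> \<delta> * measure M (space M) + \<delta> powr (1 - q) * (LINT x|M. norm (f x) powr q)"
proof -
  have "(LINT x|M. norm (f x)) \<le> (LINT x|M. \<delta> + \<delta> powr (1 - q) * norm (f x) powr q)"
    using integrable_of_norm_powr[OF f q] f(2) le_add_powr[OF \<delta> q]
    by (intro integral_mono) auto
  also have "\<dots> = \<delta> * measure M (space M) + \<delta> powr (1 - q) * (LINT x|M. norm (f x) powr q)"
    using f(2) by (simp add: mult.commute)
  finally show ?thesis .
qed

lemma (in finite_measure) integral_norm_tendsto_0_of_powr: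
  fixes f :: "nat \<Rightarrow> 'a \<Rightarrow> 'b::{banach, second_countable_topology}"
  assumes f: "\<forall>\<^sub>F n in sequentially. f n \<in> borel_measurable M \<and> integrable M (\<lambda>x. norm (f n x) powr q)"
    and q: "1 \<le> q" and lim: "(\<lambda>n. LINT x|M. norm (f n x) powr q) \<longlonglongrightarrow> 0"
  shows "(\<lambda>n. LINT x|M. norm (f n x)) \<longlonglongrightarrow> 0"
proof (rule LIMSEQ_I)
  fix r :: real assume r: "0 < r"
  define m where "m = measure M (space M)"
  have m: "0 \<le> m" by (simp add: m_def)
  \<comment> \<open>Makes the first term of \<open>integral_norm_le_powr\<close> at most
    \<open>r / 2\<close>; the \<open>+ 1\<close> covers a space of measure \<open>0\<close>.\<close>
  define \<delta> where "\<delta> = r / (2 * (m + 1))"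
  have \<delta>: "0 < \<delta>" using r m by (simp add: \<delta>_def)
  have "\<delta> * m \<le> \<delta> * (m + 1)" using \<delta> by simp
  also have "\<dots> = r / 2" using m by (simp add: \<delta>_def field_simps)
  finally have \<delta>m: "\<delta> * m \<le> r / 2" .
  have "(\<lambda>n. \<delta> powr (1 - q) * (LINT x|M. norm (f n x) powr q)) \<longlonglongrightarrow> 0"
    using tendsto_mult[OF tendsto_const lim] by simp
  then have "\<forall>\<^sub>F n in sequentially. \<delta> powr (1 - q) * (LINT x|M. norm (f n x) powr q) < r / 2"
    using r by (intro order_tendstoD(2)) auto
  with f have "\<forall>\<^sub>F n in sequentially. norm ((LINT x|M. norm (f n x)) - 0) < r"
  proof eventually_elim
    case (elim n)
    then have "(LINT x|M. norm (f n x)) < r"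
      using integral_norm_le_powr[of "f n" q \<delta>] q \<delta> \<delta>m unfolding m_def by linarith
    moreover have "0 \<le> (LINT x|M. norm (f n x))" by (rule Bochner_Integration.integral_nonneg) simp
    ultimately show ?case by simp
  qed
  then show "\<exists>N. \<forall>n\<ge>N. norm ((LINT x|M. norm (f n x)) - 0) < r"
    unfolding eventually_sequentially .
qed

lemma Lq_norm_less_top:
  "Lq_norm q I f < \<infinity> \<longleftrightarrow>
    f \<in> borel_measurable (lebesgue_on I) \<and> integrable (lebesgue_on I) (\<lambda>x. norm (f x) powr q)"
  by (simp add: Lq_norm_def)

text \<open>As \<open>Lq_norm\<close> is infinite outside the space, its convergence to
  \<open>0\<close> already contains measurability and integrability, though only for large
  \<open>n\<close>.\<close>

lemma Lq_norm_tendsto_0_iff: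
  fixes f :: "nat \<Rightarrow> real \<Rightarrow> 'b::real_normed_vector"
  assumes q: "0 < q"
  shows "(\<lambda>n. Lq_norm q I (f n)) \<longlonglongrightarrow> 0 \<longleftrightarrow>
    (\<forall>\<^sub>F n in sequentially. f n \<in> borel_measurable (lebesgue_on I) \<and>
       integrable (lebesgue_on I) (\<lambda>x. norm (f n x) powr q)) \<and>
    (\<lambda>n. LINT x|lebesgue_on I. norm (f n x) powr q) \<longlonglongrightarrow> 0"
proof -
  let ?P = "\<lambda>n. f n \<in> borel_measurable (lebesgue_on I) \<and> integrable (lebesgue_on I) (\<lambda>x. norm (f n x) powr q)"
  let ?J = "\<lambda>n. LINT x|lebesgue_on I. norm (f n x) powr q"
  have J0: "0 \<le> ?J n" for n by (rule Bochner_Integration.integral_nonneg) simp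
  have *: "(\<lambda>n. Lq_norm q I (f n)) \<longlonglongrightarrow> 0 \<longleftrightarrow> ?J \<longlonglongrightarrow> 0" if "\<forall>\<^sub>F n in sequentially. ?P n"
  proof -
    have "\<forall>\<^sub>F n in sequentially. Lq_norm q I (f n) = ennreal (?J n powr (1 / q))"
      using that by (rule eventually_mono) (simp add: Lq_norm_def)
    then have "(\<lambda>n. Lq_norm q I (f n)) \<longlonglongrightarrow> 0 \<longleftrightarrow> (\<lambda>n. ennreal (?J n powr (1 / q))) \<longlonglongrightarrow> ennreal 0"
      by (simp add: tendsto_cong)
    also have "\<dots> \<longleftrightarrow> (\<lambda>n. ?J n powr (1 / q)) \<longlonglongrightarrow> 0"
      by (rule tendsto_ennreal_iff) auto
    also have "\<dots> \<longleftrightarrow> ?J \<longlonglongrightarrow> 0"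
    proof
      assume "(\<lambda>n. ?J n powr (1 / q)) \<longlonglongrightarrow> 0"
      then have "(\<lambda>n. (?J n powr (1 / q)) powr q) \<longlonglongrightarrow> 0"
        using q tendsto_zero_powrI[OF _ tendsto_const, of "\<lambda>n. ?J n powr (1 / q)" sequentially q] by simp
      then show "?J \<longlonglongrightarrow> 0"
        using q J0 by (simp add: powr_powr)
    next
      assume "?J \<longlonglongrightarrow> 0"
      then show "(\<lambda>n. ?J n powr (1 / q)) \<longlonglongrightarrow> 0"
        using q J0 tendsto_zero_powrI[OF _ tendsto_const, of ?J sequentially "1 / q"] by simp
    qed
    finally show ?thesis .
  qed
  moreover have "\<forall>\<^sub>F n in sequentially. ?P n" if "(\<lambda>n. Lq_norm q I (f n)) \<longlonglongrightarrow> 0"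
  proof -
    have "\<forall>\<^sub>F n in sequentially. Lq_norm q I (f n) < \<infinity>"
      using order_tendstoD(2)[OF that, of \<infinity>] by simp
    then show ?thesis unfolding Lq_norm_less_top .
  qed
  ultimately show ?thesis by blast
qed

text \<open>The dominating functions need not be bounded by a single integrable function: their varying part
  \<open>H n\<close> is subtracted before dominated convergence is applied.\<close>

lemma integral_tendsto_0_dominated:
  fixes f :: "nat \<Rightarrow> 'a \<Rightarrow> real"
  assumes f: "\<And>n. f n \<in> borel_measurable M" and bound: "\<And>n. AE x in M. \<bar>f n x\<bar> \<le> G x + H n x"
    and G: "integrable M G" and H: "\<And>n. integrable M (H n)" "\<And>n x. 0 \<le> H n x"
    and lim: "(\<lambda>n. LINT x|M. H n x) \<longlonglongrightarrow> 0"
    and sub: "\<And>r. strict_mono (r :: nat \<Rightarrow> nat) \<Longrightarrow> \<exists>s. strict_mono (s :: nat \<Rightarrow> nat) \<and> (AE x in M. (\<lambda>n. f (r (s n)) x) \<longlonglongrightarrow> 0)"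
  shows "integrable M (f n)" "(\<lambda>n. LINT x|M. \<bar>f n x\<bar>) \<longlonglongrightarrow> 0"
proof -
  show int: "integrable M (f n)" for n
  proof (rule Bochner_Integration.integrable_bound)
    show "integrable M (\<lambda>x. G x + H n x)" by (intro Bochner_Integration.integrable_add G H)
    show "AE x in M. norm (f n x) \<le> norm (G x + H n x)"
      using bound[of n] by eventually_elim simp
  qed (rule f)
  show "(\<lambda>n. LINT x|M. \<bar>f n x\<bar>) \<longlonglongrightarrow> 0"
  proof (rule tendsto_by_subsequences)
    fix r :: "nat \<Rightarrow> nat" assume r: "strict_mono r"
    obtain s :: "nat \<Rightarrow> nat" where s: "strict_mono s" and ae: "AE x in M. (\<lambda>n. f (r (s n)) x) \<longlonglongrightarrow> 0"
      using sub[OF r] by blast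
    \<comment> \<open>After the subtraction \<open>\<bar>G\<bar>\<close> dominates every
      \<open>g n\<close>, and \<open>\<bar>f\<bar> \<le> g + H\<close> leads back to the original
      integrals.\<close>
    define g where "g n x = max 0 (\<bar>f (r (s n)) x\<bar> - H (r (s n)) x)" for n x
    have gm: "g n \<in> borel_measurable M" for n
      unfolding g_def
      by (intro borel_measurable_max borel_measurable_diff borel_measurable_abs borel_measurable_const
          f borel_measurable_integrable[OF H(1)])
    have glim: "(\<lambda>n. LINT x|M. g n x) \<longlonglongrightarrow> (LINT x|M. 0)"
    proof (rule integral_dominated_convergence[where w = "\<lambda>x. \<bar>G x\<bar>"])
      show "AE x in M. (\<lambda>n. g n x) \<longlonglongrightarrow> 0"
        using ae
      proof eventually_elim
        case (elim x)
        have "norm (g n x) \<le> \<bar>f (r (s n)) x\<bar>" for n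
          using H(2)[of "r (s n)" x] by (auto simp: g_def)
        then show ?case
          by (intro Lim_null_comparison[OF _ tendsto_rabs_zero[OF elim]] always_eventually allI)
      qed
      show "AE x in M. norm (g n x) \<le> \<bar>G x\<bar>" for n
        using bound[of "r (s n)"] by eventually_elim (simp add: g_def)
      show "integrable M (\<lambda>x. \<bar>G x\<bar>)" by (intro integrable_abs G)
    qed (simp_all add: gm)
    have gint: "integrable M (g n)" for n
      unfolding g_def
      by (intro integrable_max Bochner_Integration.integrable_diff integrable_abs integrable_zero int H(1))
    have "(\<lambda>n. (LINT x|M. g n x) + (LINT x|M. H (r (s n)) x)) \<longlonglongrightarrow> 0 + 0"
      using glim LIMSEQ_subseq_LIMSEQ[OF lim strict_mono_o[OF r s]]
      by (intro tendsto_add) (auto simp: o_def)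
    then have up: "(\<lambda>n. (LINT x|M. g n x) + (LINT x|M. H (r (s n)) x)) \<longlonglongrightarrow> 0" by simp
    have le: "(LINT x|M. \<bar>f (r (s n)) x\<bar>) \<le> (LINT x|M. g n x) + (LINT x|M. H (r (s n)) x)" for n
    proof -
      have "(LINT x|M. \<bar>f (r (s n)) x\<bar>) \<le> (LINT x|M. g n x + H (r (s n)) x)"
        using int gint H(1) by (intro integral_mono) (auto simp: g_def)
      also have "\<dots> = (LINT x|M. g n x) + (LINT x|M. H (r (s n)) x)"
        using gint H(1) by simp
      finally show ?thesis .
    qed
    have "(\<lambda>n. LINT x|M. \<bar>f (r (s n)) x\<bar>) \<longlonglongrightarrow> 0"
      by (rule tendsto_sandwich[OF always_eventually always_eventually tendsto_const up]) (simp_all add: le)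
    then show "\<exists>s. strict_mono s \<and> (\<lambda>n. LINT x|M. \<bar>f (r (s n)) x\<bar>) \<longlonglongrightarrow> 0"
      using s by blast
  qed
qed

text \<open>An isolated point of \<open>S\<close> is the only point of \<open>S\<close> in some
  member of a countable basis, and different points need different members. Applied below to the
  level sets of the number of distinct eigenvalues.\<close>

lemma countable_isolated_points:
  fixes S :: "'a::second_countable_topology set"
  shows "countable {x\<in>S. \<not> x islimpt S}"
proof -
  obtain \<B> :: "'a set set" where \<B>: "countable \<B>" "topological_basis \<B>"
    using ex_countable_basis[where 'a = 'a] by (elim exE conjE)
  have "\<exists>b. b \<in> \<B> \<and> x \<in> b \<and> b \<inter> S \<subseteq> {x}" if "\<not> x islimpt S" for x
  proof -
    from that obtain T where T: "x \<in> T" "open T" and TS: "\<forall>y\<in>S. y \<in> T \<longrightarrow> y = x"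
      by (auto simp: islimpt_def)
    obtain b where b: "b \<in> \<B>" "x \<in> b" "b \<subseteq> T"
      by (rule topological_basisE[OF \<B>(2) T(2,1)])
    have "b \<inter> S \<subseteq> {x}" using TS b(3) by auto
    with b(1,2) show ?thesis by (intro exI[of _ b] conjI)
  qed
  then have "\<forall>x. \<exists>b. \<not> x islimpt S \<longrightarrow> b \<in> \<B> \<and> x \<in> b \<and> b \<inter> S \<subseteq> {x}"
    by blast
  from choice[OF this] obtain b where b: "\<forall>x. \<not> x islimpt S \<longrightarrow> b x \<in> \<B> \<and> x \<in> b x \<and> b x \<inter> S \<subseteq> {x}"
    by (elim exE)
  have "inj_on b {x\<in>S. \<not> x islimpt S}"
  proof (rule inj_onI)
    fix x y assume xy: "x \<in> {x\<in>S. \<not> x islimpt S}" "y \<in> {x\<in>S. \<not> x islimpt S}" and eq: "b x = b y"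
    have "x \<in> b x" using b[THEN spec, of x] xy(1) by simp
    then have "x \<in> b y \<inter> S" using eq xy(1) by simp
    then show "x = y" using b[THEN spec, of y] xy(2) by auto
  qed
  moreover have "countable (b ` {x\<in>S. \<not> x islimpt S})"
  proof (rule countable_subset[OF _ \<B>(1)], rule image_subsetI)
    fix x assume "x \<in> {x\<in>S. \<not> x islimpt S}"
    then show "b x \<in> \<B>" using b[THEN spec, of x] by simp
  qed
  ultimately show ?thesis by (rule countable_image_inj_on[rotated])
qed

section \<open>Sobolev functions on a bounded interval\<close>

context
  fixes I :: "real set" and a b q :: real
  assumes I: "I = {a<..<b}" and ab: "a < b" and q: "1 \<le> q"
begin

lemma interval_lebesgue: "I \<in> sets lebesgue"
  by (simp add: I)

lemma finite_measure_interval: "finite_measure (lebesgue_on I)"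
  by (rule finite_measure_lebesgue_on) (simp add: I)

text \<open>The hypotheses are consequences of membership in \<open>W1q\<close> that are easily
  checked for differences too, so the lemma applies to \<open>An n - A\<close> without closure of
  \<open>W1q\<close> under subtraction.\<close>

lemma weak_deriv_ftc:
  fixes u :: "real \<Rightarrow> 'b::euclidean_space"
  assumes u: "continuous_on I u" "\<exists>v. is_weak_deriv I u v" "Lq_norm q I (weak_deriv I u) < \<infinity>"
  shows "integrable (lebesgue_on I) (weak_deriv I u)"
    and "\<And>x y. x \<in> I \<Longrightarrow> y \<in> I \<Longrightarrow> norm (u y - u x) \<le> (LINT t|lebesgue_on I. norm (weak_deriv I u t))"
    and "AE x in lebesgue_on I. (u has_vector_derivative weak_deriv I u x) (at x)"
proof -
  let ?v = "weak_deriv I u"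
  have weak: "is_weak_deriv I u ?v"
    unfolding weak_deriv_def using u(2) by (rule someI_ex)
  show int: "integrable (lebesgue_on I) ?v"
    using u(3) finite_measure.integrable_of_norm_powr[OF finite_measure_interval _ _ q]
    unfolding Lq_norm_less_top by blast
  then have v: "?v absolutely_integrable_on I"
    using integrable_lebesgue_on_iff[OF interval_lebesgue] by blast
  note eq = weak_deriv_integral[OF I u(1) weak v]
  show "AE x in lebesgue_on I. (u has_vector_derivative ?v x) (at x)"
    by (rule weak_deriv_differentiable[OF I v eq])
  have le: "norm (u y - u x) \<le> (LINT t|lebesgue_on I. norm (?v t))" if "x \<in> I" "y \<in> I" "x \<le> y" for x y
  proof -
    have sub: "{x..y} \<subseteq> I" using that by (auto simp: I)
    have vxy: "?v absolutely_integrable_on {x..y}"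
      by (rule set_integrable_subset[OF v]) (use sub in auto)
    have "norm (u y - u x) = norm (integral {x..y} ?v)" by (simp add: eq[OF that])
    also have "\<dots> \<le> integral {x..y} (\<lambda>t. norm (?v t))"
      using vxy by (intro Henstock_Kurzweil_Integration.integral_norm_bound_integral) (auto simp: absolutely_integrable_on_def)
    also have "\<dots> \<le> integral I (\<lambda>t. norm (?v t))"
      using vxy v sub by (intro integral_subset_le) (auto simp: absolutely_integrable_on_def)
    also have "\<dots> = (LINT t|lebesgue_on I. norm (?v t))"
      using int by (intro lebesgue_integral_eq_integral[symmetric] interval_lebesgue) auto
    finally show ?thesis .
  qed
  show "norm (u y - u x) \<le> (LINT t|lebesgue_on I. norm (?v t))" if "x \<in> I" "y \<in> I" for x y
    using le[of x y] le[of y x] that by (cases "x \<le> y") (auto simp: norm_minus_commute)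
qed

text \<open>The bound of \<open>norm (u x)\<close> by \<open>norm (u t)\<close> plus the total
  variation is averaged over \<open>t\<close>. This is the embedding into bounded functions.\<close>

lemma norm_le_L1:
  fixes u :: "real \<Rightarrow> 'b::euclidean_space"
  assumes u: "continuous_on I u" "\<exists>v. is_weak_deriv I u v" "Lq_norm q I (weak_deriv I u) < \<infinity>"
    and int: "integrable (lebesgue_on I) u" and x: "x \<in> I"
  shows "norm (u x) \<le> (LINT t|lebesgue_on I. norm (u t)) / (b - a) + (LINT t|lebesgue_on I. norm (weak_deriv I u t))"
proof -
  interpret finite_measure "lebesgue_on I" by (rule finite_measure_interval)
  let ?J = "LINT t|lebesgue_on I. norm (weak_deriv I u t)"
  have meas: "measure (lebesgue_on I) I = b - a"
    using ab by (simp add: I measure_restrict_space)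
  have "norm (u x) \<le> norm (u t) + ?J" if "t \<in> I" for t
    using weak_deriv_ftc(2)[OF u that x] norm_triangle_sub[of "u x" "u t"] by linarith
  then have "(LINT t|lebesgue_on I. norm (u x)) \<le> (LINT t|lebesgue_on I. norm (u t) + ?J)"
    using int by (intro integral_mono) auto
  also have "\<dots> = (LINT t|lebesgue_on I. norm (u t)) + (b - a) * ?J"
    using int by (simp add: meas)
  finally have "(b - a) * norm (u x) \<le> (LINT t|lebesgue_on I. norm (u t)) + (b - a) * ?J"
    by (simp add: meas)
  then show ?thesis using ab by (simp add: field_simps)
qed

lemma W1q_D:
  fixes u :: "real \<Rightarrow> 'b::euclidean_space"
  assumes "u \<in> W1q q I"
  shows "continuous_on I u" "\<exists>v. is_weak_deriv I u v" "Lq_norm q I (weak_deriv I u) < \<infinity>" "Lq_norm q I u < \<infinity>"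
  using assms absolutely_continuous_on_imp_continuous_on[of I u]
  by (auto simp: W1q_def I is_interval_oo)

lemma W1q_convergence:
  fixes u :: "real \<Rightarrow> 'b::euclidean_space" and w :: "nat \<Rightarrow> real \<Rightarrow> 'b"
  assumes u: "u \<in> W1q q I" and w: "\<And>n. w n \<in> W1q q I"
    and lim: "(\<lambda>n. W1q_norm q I (\<lambda>x. w n x - u x)) \<longlonglongrightarrow> 0"
  shows "\<And>\<epsilon>. 0 < \<epsilon> \<Longrightarrow> \<forall>\<^sub>F n in sequentially. \<forall>x\<in>I. norm (w n x - u x) < \<epsilon>"
    and "(\<lambda>n. LINT x|lebesgue_on I. norm (weak_deriv I (w n) x - weak_deriv I u x) powr q) \<longlonglongrightarrow> 0"
proof -
  interpret finite_measure "lebesgue_on I" by (rule finite_measure_interval)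
  let ?d = "\<lambda>n x. w n x - u x"
  have q0: "0 < q" using q by simp
  have cont: "continuous_on I (?d n)" for n
    by (intro continuous_on_diff W1q_D(1) u w)
  have weak: "\<exists>v. is_weak_deriv I (?d n) v" for n
    using W1q_D(2)[OF u] W1q_D(2)[OF w[of n]] is_weak_deriv_diff[OF interval_lebesgue] by blast
  have "(\<lambda>n. Lq_norm q I (?d n)) \<longlonglongrightarrow> 0"
    by (rule tendsto_sandwich[OF always_eventually always_eventually tendsto_const lim])
      (simp_all add: W1q_norm_def)
  note L0 = this[unfolded Lq_norm_tendsto_0_iff[OF q0]]
  have "(\<lambda>n. Lq_norm q I (weak_deriv I (?d n))) \<longlonglongrightarrow> 0"
    by (rule tendsto_sandwich[OF always_eventually always_eventually tendsto_const lim])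
      (simp_all add: W1q_norm_def)
  note L1 = this[unfolded Lq_norm_tendsto_0_iff[OF q0]]
  have fin: "\<forall>\<^sub>F n in sequentially. Lq_norm q I (weak_deriv I (?d n)) < \<infinity>"
    "\<forall>\<^sub>F n in sequentially. Lq_norm q I (?d n) < \<infinity>"
    unfolding Lq_norm_less_top by (rule conjunct1[OF L1], rule conjunct1[OF L0])
  \<comment> \<open>The bound of \<open>norm_le_L1\<close> for the difference; on a space of finite
    measure, convergence to \<open>0\<close> in \<open>L\<^sup>q\<close> implies the same in
    \<open>L\<^sup>1\<close>.\<close>
  have "(\<lambda>n. (LINT t|lebesgue_on I. norm (?d n t)) / (b - a) + (LINT t|lebesgue_on I. norm (weak_deriv I (?d n) t))) \<longlonglongrightarrow> 0 / (b - a) + 0"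
    using ab integral_norm_tendsto_0_of_powr[OF conjunct1[OF L0] q conjunct2[OF L0]]
      integral_norm_tendsto_0_of_powr[OF conjunct1[OF L1] q conjunct2[OF L1]]
    by (intro tendsto_add tendsto_divide tendsto_const) simp_all
  then have bd: "(\<lambda>n. (LINT t|lebesgue_on I. norm (?d n t)) / (b - a) + (LINT t|lebesgue_on I. norm (weak_deriv I (?d n) t))) \<longlonglongrightarrow> 0"
    by simp
  show "\<forall>\<^sub>F n in sequentially. \<forall>x\<in>I. norm (w n x - u x) < \<epsilon>" if "0 < \<epsilon>" for \<epsilon>
    using fin order_tendstoD(2)[OF bd that]
  proof eventually_elim
    case (elim n)
    have "integrable (lebesgue_on I) (?d n)"
      using elim(2) integrable_of_norm_powr[OF _ _ q] unfolding Lq_norm_less_top by blast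
    then show ?case
      using norm_le_L1[OF cont weak elim(1)] elim(3) by fastforce
  qed
  have "\<forall>\<^sub>F n in sequentially. (LINT x|lebesgue_on I. norm (weak_deriv I (?d n) x) powr q)
      = (LINT x|lebesgue_on I. norm (weak_deriv I (w n) x - weak_deriv I u x) powr q)"
    using fin(1)
  proof eventually_elim
    case (elim n)
    have m: "weak_deriv I u \<in> borel_measurable (lebesgue_on I)" "weak_deriv I (w n) \<in> borel_measurable (lebesgue_on I)"
      "weak_deriv I (?d n) \<in> borel_measurable (lebesgue_on I)"
      using W1q_D(3)[OF u] W1q_D(3)[OF w[of n]] elim unfolding Lq_norm_less_top by simp_all
    note [measurable] = m
    show ?case
    proof (rule integral_cong_AE)
      \<comment> \<open>Each chosen weak derivative is almost everywhere the classical one, and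
        classical derivatives are unique; this reconciles the three independent choices.\<close>
      have "AE x in lebesgue_on I. weak_deriv I (?d n) x = weak_deriv I (w n) x - weak_deriv I u x"
        using weak_deriv_ftc(3)[OF cont weak elim] weak_deriv_ftc(3)[OF W1q_D(1-3)[OF u]]
          weak_deriv_ftc(3)[OF W1q_D(1-3)[OF w[of n]]]
      proof eventually_elim
        case (elim x)
        then show ?case
          using vector_derivative_unique_at[OF elim(1) has_vector_derivative_diff[OF elim(3,2)]] by simp
      qed
      then show "AE x in lebesgue_on I. norm (weak_deriv I (?d n) x) powr q =
          norm (weak_deriv I (w n) x - weak_deriv I u x) powr q"
        by eventually_elim simp
    qed measurable
  qed
  then show "(\<lambda>n. LINT x|lebesgue_on I. norm (weak_deriv I (w n) x - weak_deriv I u x) powr q) \<longlonglongrightarrow> 0"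
    by (rule Lim_transform_eventually[OF conjunct2[OF L1]])
qed

end

section \<open>Speeds of eigenvalue curves\<close>

lemma diag_norm_nonneg: "0 \<le> diag_norm U B"
  by (simp add: diag_norm_def)

text \<open>One factor \<open>CARD('n)\<close> comes from summing the diagonal entries, two more
  from the double sum for each entry, whose terms are bounded by \<open>norm B\<close>.\<close>

lemma diag_norm_le:
  fixes U B :: "complex^'n^'n"
  assumes "conj_transpose U ** U = mat 1"
  shows "diag_norm U B \<le> real CARD('n) ^ 3 * norm B"
proof -
  have entry: "cmod ((conj_transpose U ** B ** U) $ i $ i) \<le> real CARD('n) ^ 2 * norm B" for i
  proof -
    have "cmod ((conj_transpose U ** B ** U) $ i $ i)
        = cmod (\<Sum>k\<in>UNIV. \<Sum>j\<in>UNIV. cnj (U $ j $ i) * B $ j $ k * U $ k $ i)"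
      by (simp add: matrix_matrix_mult_def sum_distrib_right)
    also have "\<dots> \<le> (\<Sum>k\<in>(UNIV::'n set). \<Sum>j\<in>(UNIV::'n set). norm B)"
    proof (intro sum_norm_le)
      fix k j
      have "cmod (B $ j $ k) \<le> norm B"
        using Finite_Cartesian_Product.norm_nth_le[of "B $ j" k] Finite_Cartesian_Product.norm_nth_le[of B j]
        by linarith
      moreover have "cmod (U $ j $ i) * cmod (B $ j $ k) * cmod (U $ k $ i) \<le> 1 * cmod (B $ j $ k) * 1"
        by (intro mult_mono unitary_entry_le assms) auto
      ultimately show "cmod (cnj (U $ j $ i) * B $ j $ k * U $ k $ i) \<le> norm B"
        by (simp add: norm_mult)
    qed
    also have "\<dots> = real CARD('n) ^ 2 * norm B" by (simp add: power2_eq_square)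
    finally show ?thesis .
  qed
  have "diag_norm U B \<le> (\<Sum>i\<in>UNIV. cmod ((conj_transpose U ** B ** U) $ i $ i))"
    unfolding diag_norm_def norm_vec_def by (simp add: L2_set_le_sum)
  also have "\<dots> \<le> (\<Sum>i\<in>(UNIV::'n set). real CARD('n) ^ 2 * norm B)"
    by (intro sum_mono entry)
  finally show ?thesis by (simp add: power3_eq_cube power2_eq_square mult.assoc)
qed

lemma tendsto_diag_norm:
  fixes U B :: "'a \<Rightarrow> complex^'n^'n"
  assumes U: "(U \<longlongrightarrow> U0) F" and B: "(B \<longlongrightarrow> B0) F"
  shows "((\<lambda>k. diag_norm (U k) (B k)) \<longlongrightarrow> diag_norm U0 B0) F"
  unfolding diag_norm_def
proof (intro tendsto_norm vec_tendstoI)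
  fix i
  have "((\<lambda>k. (conj_transpose (U k) ** B k ** U k) $ i $ i) \<longlongrightarrow> (conj_transpose U0 ** B0 ** U0) $ i $ i) F"
    by (intro tendsto_vec_nth tendsto_matrix_mult tendsto_conj_transpose U B)
  then show "((\<lambda>k. (\<chi> i. (conj_transpose (U k) ** B k ** U k) $ i $ i) $ i) \<longlongrightarrow>
      (\<chi> i. (conj_transpose U0 ** B0 ** U0) $ i $ i) $ i) F"
    by simp
qed

text \<open>Quantified over all diagonalizing \<open>U\<close>, so that a limit of such matrices,
  over which there is no control, can be inserted. It is vacuous if \<open>A x\<close> is not
  unitarily diagonalizable.\<close>

definition speed_limit :: "(real \<Rightarrow> complex^'n^'n) \<Rightarrow> real \<Rightarrow> complex^'n^'n \<Rightarrow> bool" where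
  "speed_limit A x B \<longleftrightarrow> (\<forall>U l. unitary_diag U l (A x) \<longrightarrow>
     ((\<lambda>h. d2 (eigenvalue_curve A (x + h)) (eigenvalue_curve A x) / \<bar>h\<bar>) \<longlongrightarrow> diag_norm U B) (at 0))"

lemma metric_speed_eq:
  assumes "speed_limit A x B" "unitary_diag U l (A x)"
  shows "metric_speed d2 (eigenvalue_curve A) x = diag_norm U B"
  using assms tendsto_Lim unfolding speed_limit_def metric_speed_def by (metis trivial_limit_at)

lemma metric_speed_tendsto:
  fixes A :: "real \<Rightarrow> complex^'n^'n"
  assumes A: "A x \<in> Norm_matrices" "\<And>n. An n x \<in> Norm_matrices"
    and lim: "(\<lambda>n. An n x) \<longlonglongrightarrow> A x" "v \<longlonglongrightarrow> v0"
    and sp: "speed_limit A x v0" "\<And>n. speed_limit (An n) x (v n)"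
  shows "(\<lambda>n. metric_speed d2 (eigenvalue_curve (An n)) x) \<longlonglongrightarrow> metric_speed d2 (eigenvalue_curve A) x"
proof (rule tendsto_by_subsequences)
  fix r :: "nat \<Rightarrow> nat" assume r: "strict_mono r"
  have "\<forall>n. \<exists>U z. unitary_diag U z (An (r n) x)"
    using normal_unitary_diag A(2) by metis
  then obtain U z where U: "\<And>n. unitary_diag (U n) (z n) (An (r n) x)" by metis
  have lim': "(\<lambda>n. An (r n) x) \<longlonglongrightarrow> A x" "(\<lambda>n. v (r n)) \<longlonglongrightarrow> v0"
    using LIMSEQ_subseq_LIMSEQ[OF lim(1) r] LIMSEQ_subseq_LIMSEQ[OF lim(2) r] by (simp_all add: o_def)
  obtain s U0 z0 where s: "strict_mono s" "(\<lambda>n. U (s n)) \<longlonglongrightarrow> U0" "unitary_diag U0 z0 (A x)"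
    by (rule unitary_diag_limit[OF U lim'(1)])
  have "(\<lambda>n. v (r (s n))) \<longlonglongrightarrow> v0"
    using LIMSEQ_subseq_LIMSEQ[OF lim'(2) s(1)] by (simp add: o_def)
  then have "(\<lambda>n. diag_norm (U (s n)) (v (r (s n)))) \<longlonglongrightarrow> diag_norm U0 v0"
    by (intro tendsto_diag_norm s(2))
  then have "(\<lambda>n. metric_speed d2 (eigenvalue_curve (An (r (s n)))) x) \<longlonglongrightarrow> metric_speed d2 (eigenvalue_curve A) x"
    \<comment> \<open>The speeds are expressed through exactly the matrices \<open>U (s n)\<close>
      and \<open>U0\<close> produced by compactness.\<close>
    by (simp only: metric_speed_eq[OF sp(1) s(3)] metric_speed_eq[OF sp(2) U])
  with s(1) show "\<exists>s. strict_mono s \<and>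
      (\<lambda>n. metric_speed d2 (eigenvalue_curve (An (r (s n)))) x) \<longlonglongrightarrow> metric_speed d2 (eigenvalue_curve A) x"
    by blast
qed

lemma metric_speed_bounds:
  fixes A :: "real \<Rightarrow> complex^'n^'n"
  assumes A: "A x \<in> Norm_matrices" and sp: "speed_limit A x B"
  shows "0 \<le> metric_speed d2 (eigenvalue_curve A) x"
    "metric_speed d2 (eigenvalue_curve A) x \<le> real CARD('n) ^ 3 * norm B"
proof -
  obtain U z where U: "unitary_diag U z (A x)" by (rule normal_unitary_diag[OF A])
  then have "conj_transpose U ** U = mat 1" by (simp add: unitary_diag_def)
  then show "metric_speed d2 (eigenvalue_curve A) x \<le> real CARD('n) ^ 3 * norm B"
    unfolding metric_speed_eq[OF sp U] by (rule diag_norm_le)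
  show "0 \<le> metric_speed d2 (eigenvalue_curve A) x"
    unfolding metric_speed_eq[OF sp U] by (rule diag_norm_nonneg)
qed

lemma continuous_on_d2_eigenvalue_curve:
  fixes f g :: "'a::topological_space \<Rightarrow> complex^'n^'n"
  assumes A: "continuous_on S f" "continuous_on S g"
    and "\<And>x. x \<in> S \<Longrightarrow> f x \<in> Norm_matrices" "\<And>x. x \<in> S \<Longrightarrow> g x \<in> Norm_matrices"
  shows "continuous_on S (\<lambda>x. d2 (unordered_eigenvalues (f x)) (unordered_eigenvalues (g x)))"
proof -
  have "continuous_on S (\<lambda>x. case (f x, g x) of (M, N) \<Rightarrow> d2 (unordered_eigenvalues M) (unordered_eigenvalues N))"
    by (rule continuous_on_compose2[OF continuous_on_d2_normal continuous_on_Pair[OF A]])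
      (use assms in auto)
  then show ?thesis by simp
qed

context
  fixes I :: "real set" and a b q :: real
  assumes I: "I = {a<..<b}" and ab: "a < b" and q: "1 \<le> q"
begin

lemma W1q_Norm_D:
  assumes "A \<in> W1q_Norm q I"
  shows "A \<in> W1q q I" "\<And>x. x \<in> I \<Longrightarrow> A x \<in> Norm_matrices" "continuous_on I A"
    "weak_deriv I A \<in> borel_measurable (lebesgue_on I)"
    "integrable (lebesgue_on I) (\<lambda>x. norm (weak_deriv I A x) powr q)"
  using assms W1q_D[OF I ab q, of A] Lq_norm_less_top[of q I "weak_deriv I A"]
  by (auto simp: W1q_Norm_def)

lemma AE_speed_limit:
  fixes A :: "real \<Rightarrow> complex^'n^'n"
  assumes A: "A \<in> W1q_Norm q I"
  shows "AE x in lebesgue_on I. speed_limit A x (weak_deriv I A x)"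
proof -
  have W: "A \<in> W1q q I" using W1q_Norm_D(1)[OF A] .
  define S where "S m = {x\<in>I. card (set_mset (eigenvalue_curve A x)) = m}" for m
  \<comment> \<open>A point outside \<open>N\<close> is a limit point of its own level set, as
    \<open>eigenvalue_curve_speed\<close> demands.\<close>
  define N where "N = (\<Union>m. {x\<in>S m. \<not> x islimpt S m})"
  have "countable N"
    unfolding N_def by (intro countable_UN countable_isolated_points) auto
  then have "N \<in> null_sets lebesgue"
    using countable_imp_null_set_lborel[of N] null_sets_completionI by blast
  then have "AE x in lebesgue. x \<notin> N" by (rule AE_not_in)
  then have "AE x in lebesgue_on I. x \<notin> N"
    by (subst AE_restrict_space_iff) (auto simp: I)
  moreover have "AE x in lebesgue_on I. x \<in> I"
    by (rule AE_I2) simp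
  ultimately show ?thesis
    using weak_deriv_ftc(3)[OF I ab q W1q_D(1-3)[OF I ab q W]]
  proof eventually_elim
    case (elim x)
    have "x islimpt S (card (set_mset (eigenvalue_curve A x)))"
      using elim(1,2) unfolding N_def S_def by blast
    then show ?case
      unfolding speed_limit_def S_def
      using eigenvalue_curve_speed[of I x A] elim W1q_Norm_D(2)[OF A] by (auto simp: I)
  qed
qed

text \<open>\<open>metric_speed\<close> is defined by \<open>Lim\<close>, which carries no
  measurability. Almost everywhere it is the limit of difference quotients along the fixed steps
  \<open>e k\<close>, which are continuous in \<open>x\<close>, and Lebesgue measurability is
  insensitive to null sets.\<close>

lemma metric_speed_measurable:
  fixes A :: "real \<Rightarrow> complex^'n^'n"
  assumes A: "A \<in> W1q_Norm q I"
  shows "metric_speed d2 (eigenvalue_curve A) \<in> borel_measurable (lebesgue_on I)"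
proof -
  let ?\<gamma> = "eigenvalue_curve A"
  have Ileb: "I \<in> sets lebesgue" by (simp add: I)
  define e where "e k = inverse (real (Suc k))" for k
  have e: "0 < e k" for k by (simp add: e_def)
  have e0: "e \<longlonglongrightarrow> 0" unfolding e_def by (rule LIMSEQ_inverse_real_of_nat)
  \<comment> \<open>Cut off where \<open>x + e k\<close> would leave \<open>I\<close>, since nothing
    is known about \<open>A\<close> there; a given \<open>x\<close> is affected for finitely many
    \<open>k\<close> only.\<close>
  define f where "f k x = (if x \<in> {a<..<b - e k} then d2 (?\<gamma> (x + e k)) (?\<gamma> x) / \<bar>e k\<bar> else 0)" for k x
  have fm: "f k \<in> borel_measurable lebesgue" for k
    unfolding f_def
  proof (rule borel_measurable_if_I)
    have sub: "{a<..<b - e k} \<subseteq> I" "(\<lambda>x. x + e k) ` {a<..<b - e k} \<subseteq> I"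
      using e[of k] by (auto simp: I)
    have "continuous_on {a<..<b - e k} (\<lambda>x. d2 (?\<gamma> (x + e k)) (?\<gamma> x))"
      unfolding eigenvalue_curve_def
    proof (rule continuous_on_d2_eigenvalue_curve)
      show "continuous_on {a<..<b - e k} (\<lambda>x. A (x + e k))"
        by (rule continuous_on_compose2[OF W1q_Norm_D(3)[OF A] _ sub(2)]) (intro continuous_intros)
      show "continuous_on {a<..<b - e k} A"
        by (rule continuous_on_subset[OF W1q_Norm_D(3)[OF A] sub(1)])
      show "A x \<in> Norm_matrices" "A (x + e k) \<in> Norm_matrices" if "x \<in> {a<..<b - e k}" for x
        using that sub by (auto intro!: W1q_Norm_D(2)[OF A])
    qed
    then show "(\<lambda>x. d2 (?\<gamma> (x + e k)) (?\<gamma> x) / \<bar>e k\<bar>) \<in> borel_measurable (lebesgue_on {a<..<b - e k})"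
      by (intro borel_measurable_divide borel_measurable_const continuous_imp_measurable_on_sets_lebesgue) auto
  qed simp
  then have "(\<lambda>x. lim (\<lambda>k. f k x)) \<in> borel_measurable lebesgue"
    by (rule borel_measurable_lim_metric)
  then have "(\<lambda>x. if x \<in> I then lim (\<lambda>k. f k x) else 0) \<in> borel_measurable lebesgue"
    using Ileb by (intro measurable_If) auto
  moreover have "AE x in lebesgue. (if x \<in> I then lim (\<lambda>k. f k x) else 0) = (if x \<in> I then metric_speed d2 ?\<gamma> x else 0)"
  proof -
    have "AE x in lebesgue. x \<in> I \<longrightarrow> speed_limit A x (weak_deriv I A x)"
      using AE_speed_limit[OF A] by (subst (asm) AE_restrict_space_iff) (use Ileb in auto)
    then show ?thesis
    proof eventually_elim
      case (elim x)
      show ?case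
      proof (cases "x \<in> I")
        case True
        obtain U z where U: "unitary_diag U z (A x)"
          by (rule normal_unitary_diag[OF W1q_Norm_D(2)[OF A True]])
        have sp: "speed_limit A x (weak_deriv I A x)" using elim True by simp
        have lim: "((\<lambda>h. d2 (?\<gamma> (x + h)) (?\<gamma> x) / \<bar>h\<bar>) \<longlongrightarrow> metric_speed d2 ?\<gamma> x) (at 0)"
          using sp U unfolding metric_speed_eq[OF sp U] speed_limit_def by blast
        have "filterlim e (at 0) sequentially"
          using e0 e by (auto simp: filterlim_at less_imp_neq[symmetric])
        then have "(\<lambda>k. d2 (?\<gamma> (x + e k)) (?\<gamma> x) / \<bar>e k\<bar>) \<longlonglongrightarrow> metric_speed d2 ?\<gamma> x"
          by (rule filterlim_compose[OF lim])
        moreover have "\<forall>\<^sub>F k in sequentially. d2 (?\<gamma> (x + e k)) (?\<gamma> x) / \<bar>e k\<bar> = f k x"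
        proof -
          have "\<forall>\<^sub>F k in sequentially. e k < b - x"
            using True by (intro order_tendstoD(2)[OF e0]) (simp add: I)
          then show ?thesis
            by (rule eventually_mono) (use True in \<open>simp add: f_def I\<close>)
        qed
        ultimately have "(\<lambda>k. f k x) \<longlonglongrightarrow> metric_speed d2 ?\<gamma> x"
          by (rule Lim_transform_eventually)
        then show ?thesis using True by (simp add: limI)
      qed simp
    qed
  qed
  ultimately have "(\<lambda>x. if x \<in> I then metric_speed d2 ?\<gamma> x else 0) \<in> borel_measurable lebesgue"
    by (rule borel_measurable_AE)
  then show ?thesis
    using borel_measurable_if[OF Ileb] by blast
qed

end

lemma ennreal_tendsto_0I:
  fixes f :: "'a \<Rightarrow> ennreal"
  assumes "\<And>e. 0 < e \<Longrightarrow> \<forall>\<^sub>F x in F. f x \<le> ennreal e"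
  shows "(f \<longlongrightarrow> 0) F"
proof (rule order_tendstoI)
  fix c :: ennreal assume "0 < c"
  then obtain c' where c': "0 < c'" "c' < c" using dense by blast
  then have "c' < top" using order_less_le_trans top_greatest by blast
  with c'(1) have "c' = ennreal (enn2real c')" "0 < enn2real c'"
    by (simp_all add: enn2real_positive_iff)
  then show "\<forall>\<^sub>F x in F. f x < c"
    using assms[of "enn2real c'"] c'(2) by (auto elim!: eventually_mono)
qed simp

theorem corollary1p9:
  fixes A :: "real \<Rightarrow> complex^'n^'n" and An :: "nat \<Rightarrow> real \<Rightarrow> complex^'n^'n"
    and q a b :: real and I :: "real set"
  assumes "1 \<le> q" and "a < b" and "I = {a<..<b}"
    and "A \<in> W1q_Norm q I" and "\<And>n. An n \<in> W1q_Norm q I"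
    and "(\<lambda>n. W1q_norm q I (\<lambda>x. An n x - A x)) \<longlonglongrightarrow> 0"
  shows "(\<lambda>n. Linf_norm I (\<lambda>x. d2 (eigenvalue_curve A x) (eigenvalue_curve (An n) x))) \<longlonglongrightarrow> 0
    \<and> (\<lambda>n. Lq_norm q I (\<lambda>x. metric_speed d2 (eigenvalue_curve A) x
                              - metric_speed d2 (eigenvalue_curve (An n)) x)) \<longlonglongrightarrow> 0
    \<and> (\<lambda>n. \<bar>energy d2 q I (eigenvalue_curve A) - energy d2 q I (eigenvalue_curve (An n))\<bar>) \<longlonglongrightarrow> 0"
proof -
  note q = assms(1) and ab = assms(2) and I = assms(3) and A = assms(4) and An = assms(5)
  note N = W1q_Norm_D[OF I ab q]
  have Ileb: "I \<in> sets lebesgue" by (simp add: I)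
  have q0: "0 < q" "0 \<le> q" using q by auto
  have uniform: "\<forall>\<^sub>F n in sequentially. \<forall>x\<in>I. norm (An n x - A x) < \<epsilon>" if "0 < \<epsilon>" for \<epsilon>
    using W1q_convergence(1)[OF I ab q N(1)[OF A] N(1)[OF An] assms(6) that] .
  have derivs: "(\<lambda>n. LINT x|lebesgue_on I. norm (weak_deriv I (An n) x - weak_deriv I A x) powr q) \<longlonglongrightarrow> 0"
    using W1q_convergence(2)[OF I ab q N(1)[OF A] N(1)[OF An] assms(6)] .

  \<comment> \<open>Uniform convergence of the spectra\<close>
  define c where "c = (a + b) / 2"
  have c: "c \<in> I" using ab by (simp add: c_def I)
  \<comment> \<open>\<open>A\<close> is bounded by \<open>R - 1\<close> through its variation from
    the midpoint \<open>c\<close>; the extra \<open>1\<close> leaves room for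
    \<open>An n\<close>.\<close>
  define R where "R = norm (A c) + (LINT t|lebesgue_on I. norm (weak_deriv I A t)) + 1"
  have AR: "norm (A x) \<le> R - 1" if "x \<in> I" for x
    using weak_deriv_ftc(2)[OF I ab q W1q_D(1-3)[OF I ab q N(1)[OF A]] c that]
      norm_triangle_sub[of "A x" "A c"] by (simp add: R_def)
  have 1: "(\<lambda>n. Linf_norm I (\<lambda>x. d2 (eigenvalue_curve A x) (eigenvalue_curve (An n) x))) \<longlonglongrightarrow> 0"
  proof (rule ennreal_tendsto_0I)
    fix e :: real assume "0 < e"
    then obtain \<delta> where \<delta>: "0 < \<delta>" "\<And>M N :: complex^'n^'n. \<lbrakk>M \<in> Norm_matrices; N \<in> Norm_matrices; norm M \<le> R; norm N \<le> R;
      norm (M - N) < \<delta>\<rbrakk> \<Longrightarrow> d2 (unordered_eigenvalues M) (unordered_eigenvalues N) < e"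
      using d2_normal_uniform by metis
    \<comment> \<open>\<open>\<delta>\<close> serves uniform continuity, and \<open>1\<close> keeps
      \<open>An n x\<close> in the ball of radius \<open>R\<close>.\<close>
    have "\<forall>\<^sub>F n in sequentially. \<forall>x\<in>I. norm (An n x - A x) < min \<delta> 1"
      using \<delta>(1) by (intro uniform) simp
    then show "\<forall>\<^sub>F n in sequentially. Linf_norm I (\<lambda>x. d2 (eigenvalue_curve A x) (eigenvalue_curve (An n) x)) \<le> ennreal e"
    proof eventually_elim
      case (elim n)
      have le: "norm (d2 (eigenvalue_curve A x) (eigenvalue_curve (An n) x)) \<le> e" if x: "x \<in> I" for x
      proof -
        have "norm (An n x) \<le> R"
          using AR[OF x] elim x norm_triangle_sub[of "An n x" "A x"] by fastforce
        moreover have "norm (A x - An n x) < \<delta>" using elim x by (simp add: norm_minus_commute)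
        ultimately have "d2 (unordered_eigenvalues (A x)) (unordered_eigenvalues (An n x)) < e"
          using \<delta>(2)[OF N(2)[OF A x] N(2)[OF An x]] AR[OF x] by simp
        then show ?thesis
          using d2_normal_nonneg[OF N(2)[OF A x] N(2)[OF An x]] by (simp add: eigenvalue_curve_def)
      qed
      have "continuous_on I (\<lambda>x. d2 (eigenvalue_curve A x) (eigenvalue_curve (An n) x))"
        unfolding eigenvalue_curve_def
        by (intro continuous_on_d2_eigenvalue_curve N(3) A An N(2))
      then have "(\<lambda>x. d2 (eigenvalue_curve A x) (eigenvalue_curve (An n) x)) \<in> borel_measurable (lebesgue_on I)"
        by (rule continuous_imp_measurable_on_sets_lebesgue[OF _ Ileb])
      then have "(\<lambda>x. ennreal (norm (d2 (eigenvalue_curve A x) (eigenvalue_curve (An n) x)))) \<in> borel_measurable (lebesgue_on I)"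
        by measurable
      then show ?case
        unfolding Linf_norm_def
        by (rule esssup_I) (intro AE_I2 ennreal_leI le, simp)
    qed
  qed

  \<comment> \<open>Dominating functions for the speeds\<close>
  define s where "s = metric_speed d2 (eigenvalue_curve A)"
  define sn where "sn n = metric_speed d2 (eigenvalue_curve (An n))" for n
  define v where "v = weak_deriv I A"
  define vn where "vn n = weak_deriv I (An n)" for n
  have meas [measurable]: "s \<in> borel_measurable (lebesgue_on I)" "sn n \<in> borel_measurable (lebesgue_on I)"
    "v \<in> borel_measurable (lebesgue_on I)" "vn n \<in> borel_measurable (lebesgue_on I)" for n
    unfolding s_def sn_def v_def vn_def
    by (rule metric_speed_measurable[OF I ab q] N(4) A An)+
  \<comment> \<open>The first factor comes from \<open>diag_norm_le\<close>, the second from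
    splitting \<open>vn n\<close> into \<open>v\<close> and \<open>vn n - v\<close> by
    \<open>add_powr_le\<close>.\<close>
  define K where "K = (real CARD('n) ^ 3) powr q * 2 powr q"
  define G where "G x = K * norm (v x) powr q" for x
  define H where "H n x = K * norm (vn n x - v x) powr q" for n x
  have vq: "integrable (lebesgue_on I) (\<lambda>x. norm (v x) powr q)" "integrable (lebesgue_on I) (\<lambda>x. norm (vn n x) powr q)" for n
    unfolding v_def vn_def by (rule N(5) A An)+
  have G: "integrable (lebesgue_on I) G"
    unfolding G_def by (intro integrable_mult_right vq)
  have dq: "integrable (lebesgue_on I) (\<lambda>x. norm (vn n x - v x) powr q)" for n
  proof (rule Bochner_Integration.integrable_bound)
    show "integrable (lebesgue_on I) (\<lambda>x. 2 powr q * (norm (vn n x) powr q + norm (v x) powr q))"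
      by (intro integrable_mult_right Bochner_Integration.integrable_add vq)
    have "norm (vn n x - v x) powr q \<le> 2 powr q * (norm (vn n x) powr q + norm (v x) powr q)" for x
    proof -
      have "norm (vn n x - v x) powr q \<le> (norm (vn n x) + norm (v x)) powr q"
        using q0 by (intro powr_mono2 norm_triangle_ineq4) auto
      also have "\<dots> \<le> 2 powr q * (norm (vn n x) powr q + norm (v x) powr q)"
        using q0 by (intro add_powr_le) auto
      finally show ?thesis .
    qed
    then show "AE x in lebesgue_on I. norm (norm (vn n x - v x) powr q) \<le> norm (2 powr q * (norm (vn n x) powr q + norm (v x) powr q))"
      by (intro AE_I2) simp
  qed measurable
  have H: "integrable (lebesgue_on I) (H n)" "0 \<le> H n x" for n x
    unfolding H_def by (intro integrable_mult_right dq) (simp add: K_def)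
  have Hlim: "(\<lambda>n. LINT x|lebesgue_on I. H n x) \<longlonglongrightarrow> 0"
    using tendsto_mult[OF tendsto_const derivs, of K] by (simp add: H_def v_def vn_def)

  have speed: "AE x in lebesgue_on I. speed_limit A x (v x)" "AE x in lebesgue_on I. speed_limit (An n) x (vn n x)" for n
    unfolding v_def vn_def by (rule AE_speed_limit[OF I ab q] A An)+
  have bounds: "AE x in lebesgue_on I. 0 \<le> s x \<and> 0 \<le> sn n x \<and> s x powr q \<le> G x \<and> s x powr q \<le> G x + H n x \<and> sn n x powr q \<le> G x + H n x
      \<and> \<bar>s x - sn n x\<bar> powr q \<le> G x + H n x" for n
    using speed(1) speed(2)[of n] AE_space[of "lebesgue_on I"]
  proof eventually_elim
    case (elim x)
    then have x: "x \<in> I" by simp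
    let ?C = "real CARD('n) ^ 3"
    let ?y = "norm (v x) + norm (vn n x - v x)"
    have sx: "0 \<le> s x" "s x \<le> ?C * norm (v x)"
      unfolding s_def using metric_speed_bounds[OF N(2)[OF A x] elim(1)] by auto
    have snx: "0 \<le> sn n x" "sn n x \<le> ?C * norm (vn n x)"
      unfolding sn_def using metric_speed_bounds[OF N(2)[OF An x] elim(2)] by auto
    have "norm (vn n x) \<le> ?y" using norm_triangle_sub[of "vn n x" "v x"] by simp
    then have "?C * norm (vn n x) \<le> ?C * ?y" "?C * norm (v x) \<le> ?C * ?y"
      by (intro mult_left_mono; simp)+
    then have le: "s x \<le> ?C * ?y" "sn n x \<le> ?C * ?y" using sx(2) snx(2) by linarith+
    have bd: "t powr q \<le> G x + H n x" if "0 \<le> t" "t \<le> ?C * ?y" for t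
    proof -
      have "t powr q \<le> (?C * ?y) powr q" using that q0 by (intro powr_mono2) auto
      also have "\<dots> = ?C powr q * ?y powr q" by (simp add: powr_mult)
      also have "\<dots> \<le> ?C powr q * (2 powr q * (norm (v x) powr q + norm (vn n x - v x) powr q))"
        using q0 by (intro mult_left_mono add_powr_le) auto
      also have "\<dots> = G x + H n x" by (simp add: G_def H_def K_def algebra_simps)
      finally show ?thesis .
    qed
    \<comment> \<open>The bound without \<open>H\<close> gives integrability of
      \<open>s x powr q\<close>; a factor \<open>2 powr q\<close>, at least \<open>1\<close>, is
      inserted to reach \<open>K\<close>.\<close>
    have "s x powr q \<le> (?C * norm (v x)) powr q" using sx q0 by (intro powr_mono2) auto
    also have "\<dots> = ?C powr q * 1 * norm (v x) powr q" by (simp add: powr_mult)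
    also have "\<dots> \<le> ?C powr q * 2 powr q * norm (v x) powr q"
      using q0 ge_one_powr_ge_zero[of 2 q] by (intro mult_right_mono mult_left_mono) auto
    finally have "s x powr q \<le> G x" by (simp add: G_def K_def)
    moreover have "\<bar>s x - sn n x\<bar> \<le> ?C * ?y" using le sx(1) snx(1) by linarith
    ultimately show ?case using bd[of "s x"] bd[of "sn n x"] bd[of "\<bar>s x - sn n x\<bar>"] le sx snx by simp
  qed

  \<comment> \<open>Convergence of the speeds almost everywhere along subsequences\<close>
  have pointwise: "\<exists>t. strict_mono (t :: nat \<Rightarrow> nat) \<and> (AE x in lebesgue_on I. (\<lambda>n. sn (r (t n)) x) \<longlonglongrightarrow> s x)"
    if r: "strict_mono (r :: nat \<Rightarrow> nat)" for r
  proof -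
    \<comment> \<open>Read as convergence of the \<open>q\<close>th powers in
      \<open>L\<^sup>1\<close>, this yields a subsequence converging almost everywhere.\<close>
    have "(\<lambda>n. LINT x|lebesgue_on I. norm (norm (vn (r n) x - v x) powr q)) \<longlonglongrightarrow> 0"
      using LIMSEQ_subseq_LIMSEQ[OF derivs r] by (simp add: o_def v_def vn_def)
    then obtain t :: "nat \<Rightarrow> nat" where t: "strict_mono t"
      and ae: "AE x in lebesgue_on I. (\<lambda>n. norm (vn (r (t n)) x - v x) powr q) \<longlonglongrightarrow> 0"
      using tendsto_L1_AE_subseq[OF dq, of r] by blast
    have "AE x in lebesgue_on I. \<forall>n. speed_limit (An n) x (vn n x)"
      using speed(2) by (subst AE_all_countable) blast
    then have "AE x in lebesgue_on I. (\<lambda>n. sn (r (t n)) x) \<longlonglongrightarrow> s x"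
      using ae speed(1) AE_space[of "lebesgue_on I"]
    proof eventually_elim
      case (elim x)
      then have x: "x \<in> I" by simp
      have "(\<lambda>n. (norm (vn (r (t n)) x - v x) powr q) powr (1 / q)) \<longlonglongrightarrow> 0"
        using q0 elim(2) tendsto_zero_powrI[OF _ tendsto_const, of "\<lambda>n. norm (vn (r (t n)) x - v x) powr q" sequentially "1 / q"]
        by simp
      then have "(\<lambda>n. norm (vn (r (t n)) x - v x)) \<longlonglongrightarrow> 0"
        using q0 by (simp add: powr_powr)
      then have vlim: "(\<lambda>n. vn (r (t n)) x) \<longlonglongrightarrow> v x"
        by (rule LIM_zero_cancel[OF tendsto_norm_zero_cancel])
      have "(\<lambda>n. An n x) \<longlonglongrightarrow> A x"
      proof (rule LIMSEQ_I)
        fix e :: real assume "0 < e"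
        then show "\<exists>N. \<forall>n\<ge>N. norm (An n x - A x) < e"
          using uniform[of e] x unfolding eventually_sequentially by blast
      qed
      then have Alim: "(\<lambda>n. An (r (t n)) x) \<longlonglongrightarrow> A x"
        using LIMSEQ_subseq_LIMSEQ[OF _ strict_mono_o[OF r t]] by (simp add: o_def)
      show ?case
        unfolding s_def sn_def
        by (rule metric_speed_tendsto[where A = A and An = "\<lambda>n. An (r (t n))" and v = "\<lambda>n. vn (r (t n)) x",
              OF N(2)[OF A x] _ Alim vlim elim(3)])
          (use elim(1) N(2)[OF An x] in blast)+
    qed
    with t show ?thesis by blast
  qed

  have 2: "integrable (lebesgue_on I) (\<lambda>x. \<bar>s x - sn n x\<bar> powr q)"
    "(\<lambda>n. LINT x|lebesgue_on I. \<bar>\<bar>s x - sn n x\<bar> powr q\<bar>) \<longlonglongrightarrow> 0" for n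
  proof -
    have m: "(\<lambda>x. \<bar>s x - sn n x\<bar> powr q) \<in> borel_measurable (lebesgue_on I)" for n by measurable
    have bd: "AE x in lebesgue_on I. \<bar>\<bar>s x - sn n x\<bar> powr q\<bar> \<le> G x + H n x" for n
      using bounds[of n] by eventually_elim simp
    have sub: "\<exists>t. strict_mono (t :: nat \<Rightarrow> nat) \<and> (AE x in lebesgue_on I. (\<lambda>n. \<bar>s x - sn (r (t n)) x\<bar> powr q) \<longlonglongrightarrow> 0)"
      if r: "strict_mono (r :: nat \<Rightarrow> nat)" for r
    proof -
      obtain t :: "nat \<Rightarrow> nat" where t: "strict_mono t" and ae: "AE x in lebesgue_on I. (\<lambda>n. sn (r (t n)) x) \<longlonglongrightarrow> s x"
        using pointwise[OF r] by blast
      from ae have "AE x in lebesgue_on I. (\<lambda>n. \<bar>s x - sn (r (t n)) x\<bar> powr q) \<longlonglongrightarrow> 0"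
      proof eventually_elim
        case (elim x)
        have "(\<lambda>n. s x - sn (r (t n)) x) \<longlonglongrightarrow> s x - s x" by (intro tendsto_diff tendsto_const elim)
        then have "(\<lambda>n. \<bar>s x - sn (r (t n)) x\<bar>) \<longlonglongrightarrow> 0" by (intro tendsto_rabs_zero) simp
        then show ?case using q0 tendsto_zero_powrI[OF _ tendsto_const, of "\<lambda>n. \<bar>s x - sn (r (t n)) x\<bar>" sequentially q] by simp
      qed
      with t show ?thesis by blast
    qed
    show "integrable (lebesgue_on I) (\<lambda>x. \<bar>s x - sn n x\<bar> powr q)"
      "(\<lambda>n. LINT x|lebesgue_on I. \<bar>\<bar>s x - sn n x\<bar> powr q\<bar>) \<longlonglongrightarrow> 0"
      by (rule integral_tendsto_0_dominated[OF m bd G H Hlim sub]; assumption)+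
  qed
  \<comment> \<open>Domination is applied to the difference of the powers itself, so the energies
    are handled without Minkowski's inequality.\<close>
  have 3: "(\<lambda>n. LINT x|lebesgue_on I. \<bar>s x powr q - sn n x powr q\<bar>) \<longlonglongrightarrow> 0"
  proof -
    have m: "(\<lambda>x. s x powr q - sn n x powr q) \<in> borel_measurable (lebesgue_on I)" for n by measurable
    have bd: "AE x in lebesgue_on I. \<bar>s x powr q - sn n x powr q\<bar> \<le> G x + H n x" for n
      using bounds[of n]
    proof eventually_elim
      case (elim x)
      have "0 \<le> s x powr q" "0 \<le> sn n x powr q" by simp_all
      then show ?case using elim by linarith
    qed
    have sub: "\<exists>t. strict_mono (t :: nat \<Rightarrow> nat) \<and> (AE x in lebesgue_on I. (\<lambda>n. s x powr q - sn (r (t n)) x powr q) \<longlonglongrightarrow> 0)"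
      if r: "strict_mono (r :: nat \<Rightarrow> nat)" for r
    proof -
      obtain t :: "nat \<Rightarrow> nat" where t: "strict_mono t" and ae: "AE x in lebesgue_on I. (\<lambda>n. sn (r (t n)) x) \<longlonglongrightarrow> s x"
        using pointwise[OF r] by blast
      \<comment> \<open>Required by \<open>tendsto_powr'\<close> at points where the limit
        \<open>s x\<close> is \<open>0\<close>.\<close>
      have "AE x in lebesgue_on I. \<forall>n. 0 \<le> sn n x"
      proof (subst AE_all_countable, rule allI)
        show "AE x in lebesgue_on I. 0 \<le> sn n x" for n
          using bounds[of n] by eventually_elim simp
      qed
      with ae have "AE x in lebesgue_on I. (\<lambda>n. s x powr q - sn (r (t n)) x powr q) \<longlonglongrightarrow> 0"
      proof eventually_elim
        case (elim x)
        have "(\<lambda>n. sn (r (t n)) x powr q) \<longlonglongrightarrow> s x powr q"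
          using elim q0 by (intro tendsto_powr' tendsto_const) auto
        then have "(\<lambda>n. s x powr q - sn (r (t n)) x powr q) \<longlonglongrightarrow> s x powr q - s x powr q"
          by (intro tendsto_diff tendsto_const)
        then show ?case by simp
      qed
      with t show ?thesis by blast
    qed
    show ?thesis
      by (rule integral_tendsto_0_dominated(2)[OF m bd G H Hlim sub])
  qed

  have part2: "(\<lambda>n. Lq_norm q I (\<lambda>x. s x - sn n x)) \<longlonglongrightarrow> 0"
    unfolding Lq_norm_tendsto_0_iff[OF q0(1)]
  proof (intro conjI always_eventually allI)
    show "(\<lambda>x. s x - sn n x) \<in> borel_measurable (lebesgue_on I)" for n by measurable
    show "integrable (lebesgue_on I) (\<lambda>x. norm (s x - sn n x) powr q)" for n
      using 2(1)[of n] by simp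
    show "(\<lambda>n. LINT x|lebesgue_on I. norm (s x - sn n x) powr q) \<longlonglongrightarrow> 0"
      using 2(2) by simp
  qed

  \<comment> \<open>Convergence of the energies\<close>
  have sq: "integrable (lebesgue_on I) (\<lambda>x. s x powr q)"
  proof (rule Bochner_Integration.integrable_bound[OF G])
    show "AE x in lebesgue_on I. norm (s x powr q) \<le> norm (G x)"
      using bounds[of 0] by eventually_elim auto
  qed measurable
  have snq: "integrable (lebesgue_on I) (\<lambda>x. sn n x powr q)" for n
  proof (rule Bochner_Integration.integrable_bound[OF Bochner_Integration.integrable_add[OF G H(1)[of n]]])
    show "AE x in lebesgue_on I. norm (sn n x powr q) \<le> norm (G x + H n x)"
      using bounds[of n] by eventually_elim auto
  qed measurable
  have "(\<lambda>n. (LINT x|lebesgue_on I. s x powr q) - (LINT x|lebesgue_on I. sn n x powr q)) \<longlonglongrightarrow> 0"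
  proof (rule Lim_null_comparison[OF _ 3], intro always_eventually allI)
    fix n
    have "(LINT x|lebesgue_on I. s x powr q) - (LINT x|lebesgue_on I. sn n x powr q)
        = (LINT x|lebesgue_on I. s x powr q - sn n x powr q)"
      using sq snq by simp
    then show "norm ((LINT x|lebesgue_on I. s x powr q) - (LINT x|lebesgue_on I. sn n x powr q))
        \<le> (LINT x|lebesgue_on I. \<bar>s x powr q - sn n x powr q\<bar>)"
      using integral_abs_bound[of "lebesgue_on I" "\<lambda>x. s x powr q - sn n x powr q"] by simp
  qed
  then have "(\<lambda>n. ereal \<bar>(LINT x|lebesgue_on I. s x powr q) - (LINT x|lebesgue_on I. sn n x powr q)\<bar>) \<longlonglongrightarrow> ereal 0"
    by (intro tendsto_ereal tendsto_rabs_zero)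
  \<comment> \<open>Integrability excludes the value \<open>\<infinity>\<close>, so the difference
    in \<open>ereal\<close> is one of real numbers.\<close>
  moreover have "\<bar>energy d2 q I (eigenvalue_curve A) - energy d2 q I (eigenvalue_curve (An n))\<bar>
      = ereal \<bar>(LINT x|lebesgue_on I. s x powr q) - (LINT x|lebesgue_on I. sn n x powr q)\<bar>" for n
    using sq snq[of n] by (simp add: energy_def s_def sn_def)
  ultimately have part3: "(\<lambda>n. \<bar>energy d2 q I (eigenvalue_curve A) - energy d2 q I (eigenvalue_curve (An n))\<bar>) \<longlonglongrightarrow> 0"
    by (simp add: zero_ereal_def)
  show ?thesis
    using 1 part2 part3 unfolding s_def sn_def by blast
qed

end
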